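(* Let $F$ be an algebraically closed field of characteristic $0$ and let $A$ be a nonzero finite dimensional Lie or associative algebra over $F$ with an action of a Lie algebra $\mathfrak g$ over $F$ by derivations. Then the following are equivalent: (i) $\mathrm{PIexp}^{U(\mathfrak g)}(A)=\dim A$; (ii) $A$ is $\mathfrak g$-simple; (iii) $A$ is simple.
   Context: Associative algebras $A$ are not assumed unital. $A$ is simple if $A^2\neq0$ and it has no two-sided ideals other than $0$ and $A$; $A$ is $\mathfrak g$-simple if $A^2\ne0$ and it has no $\mathfrak g$-invariant two-sided ideals other than $0$ and $A$ (for Lie algebras, $A^2=[A,A]$). An action of $\mathfrak g$ on $A$ by derivations is a Lie algebra homomorphism from $\mathfrak g$ to the derivations of $A$; it extends to a unital algebra homomorphism $U(\mathfrak g)\to\mathrm{End}_F(A)$, where $U(\mathfrak g)$ is the universal enveloping algebra. Put $H=U(\mathfrak g)$ and let $(\gamma_\beta)_{\beta\in\Lambda}$ be a basis of $H$. Differential codimensions. In the associative case let $F\langle X|H\rangle$ be the free associative algebra without $1$ on free generators $x_i^{\gamma_\beta}$, $i\in\mathbb N$, $\beta\in\Lambda$; in the Lie case let $L(X|H)$ be the free Lie algebra on the same free generators. Define $x_i^h$ for $h\in H$ by linearity in $h$. Let $P_n^H$ be the span of all $x_{\sigma(1)}^{h_1}\cdots x_{\sigma(n)}^{h_n}$ and $V_n^H$ the span of all $[x_{\sigma(1)}^{h_1},\ldots,x_{\sigma(n)}^{h_n}]$ (long commutators), $h_i\in H$, $\sigma\in S_n$. An element $f$ of $F\langle X|H\rangle$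 (resp. $L(X|H)$) belongs to $\mathrm{Id}^H(A)$ if $f$ vanishes under every substitution $x_i^h\mapsto ha_i$ with $a_i\in A$. Then $c_n^{U(\mathfrak g)}(A):=\dim\bigl(P_n^H/(P_n^H\cap\mathrm{Id}^H(A))\bigr)$ for $A$ associative and $c_n^{U(\mathfrak g)}(A):=\dim\bigl(V_n^H/(V_n^H\cap\mathrm{Id}^H(A))\bigr)$ for $A$ Lie. $\mathrm{PIexp}^{U(\mathfrak g)}(A):=\lim_{n\to\infty}\sqrt[n]{c_n^{U(\mathfrak g)}(A)}$; the equality in (i) means that the limit exists and equals $\dim A$. *)

theory Defs
  imports
    "HOL-Computational_Algebra.Polynomial"
    "HOL-Combinatorics.Permutations"
    "HOL-Library.Poly_Mapping"
    Complex_Main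
begin

section \<open>Algebras, ideals, simplicity, derivations\<close>

locale bilinear_algebra = vector_space scale
  for scale :: "'f::field \<Rightarrow> 'a::ab_group_add \<Rightarrow> 'a" +
  fixes mul :: "'a \<Rightarrow> 'a \<Rightarrow> 'a"
  assumes linear_mul_right: "Vector_Spaces.linear scale scale (mul x)"
    and linear_mul_left: "Vector_Spaces.linear scale scale (\<lambda>x. mul x y)"

locale associative_algebra = bilinear_algebra +
  assumes mul_assoc: "mul (mul x y) z = mul x (mul y z)"

locale lie_algebra = bilinear_algebra +
  assumes mul_self: "mul x x = 0"
    and jacobi: "mul x (mul y z) + mul y (mul z x) + mul z (mul x y) = 0"

definition two_sided_ideal ::
    "('f::field \<Rightarrow> 'a::ab_group_add \<Rightarrow> 'a) \<Rightarrow> ('a \<Rightarrow> 'a \<Rightarrow> 'a) \<Rightarrow> 'a set \<Rightarrow> bool" where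
  "two_sided_ideal scale mul I \<longleftrightarrow>
     module.subspace scale I \<and> (\<forall>a. \<forall>x\<in>I. mul a x \<in> I \<and> mul x a \<in> I)"

definition algebra_square ::
    "('f::field \<Rightarrow> 'a::ab_group_add \<Rightarrow> 'a) \<Rightarrow> ('a \<Rightarrow> 'a \<Rightarrow> 'a) \<Rightarrow> 'a set" where
  "algebra_square scale mul = module.span scale {mul x y | x y. True}"

definition simple_algebra ::
    "('f::field \<Rightarrow> 'a::ab_group_add \<Rightarrow> 'a) \<Rightarrow> ('a \<Rightarrow> 'a \<Rightarrow> 'a) \<Rightarrow> bool" where
  "simple_algebra scale mul \<longleftrightarrow>
     algebra_square scale mul \<noteq> {0} \<and>
     (\<forall>I. two_sided_ideal scale mul I \<longrightarrow> I = {0} \<or> I = UNIV)"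

definition action_simple_algebra ::
    "('f::field \<Rightarrow> 'a::ab_group_add \<Rightarrow> 'a) \<Rightarrow> ('a \<Rightarrow> 'a \<Rightarrow> 'a) \<Rightarrow> ('g \<Rightarrow> 'a \<Rightarrow> 'a) \<Rightarrow> bool" where
  "action_simple_algebra scale mul act \<longleftrightarrow>
     algebra_square scale mul \<noteq> {0} \<and>
     (\<forall>I. two_sided_ideal scale mul I \<and> (\<forall>g. \<forall>x\<in>I. act g x \<in> I) \<longrightarrow> I = {0} \<or> I = UNIV)"

locale derivation_action =
  A: bilinear_algebra scale mul + G: lie_algebra gscale gbracket
  for scale :: "'f::field \<Rightarrow> 'a::ab_group_add \<Rightarrow> 'a" and mul :: "'a \<Rightarrow> 'a \<Rightarrow> 'a"
    and gscale :: "'f \<Rightarrow> 'g::ab_group_add \<Rightarrow> 'g" and gbracket :: "'g \<Rightarrow> 'g \<Rightarrow> 'g" +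
  fixes act :: "'g \<Rightarrow> 'a \<Rightarrow> 'a"
  assumes act_linear: "Vector_Spaces.linear scale scale (act g)"
    and act_derivation: "act g (mul a b) = mul (act g a) b + mul a (act g b)"
    and act_add: "act (g + h) a = act g a + act h a"
    and act_scale: "act (gscale c g) a = scale c (act g a)"
    and act_bracket: "act (gbracket g h) a = act g (act h a) - act h (act g a)"


section \<open>Linear combinations and bases of quotient spaces\<close>

definition lincomb ::
    "('f::zero \<Rightarrow> 'v::comm_monoid_add \<Rightarrow> 'v) \<Rightarrow> ('i \<Rightarrow> 'v) \<Rightarrow> ('i \<Rightarrow>\<^sub>0 'f) \<Rightarrow> 'v" where
  "lincomb scale v c = (\<Sum>i\<in>Poly_Mapping.keys c. scale (Poly_Mapping.lookup c i) (v i))"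

text \<open>
  For subspaces \<open>W \<subseteq> V\<close>, the cosets \<open>v i + W\<close> with \<open>i \<in> I\<close> form a basis of \<open>V / W\<close>:
  every coset is a linear combination of them with unique coefficients.
\<close>
definition quotient_basis ::
    "('f::zero \<Rightarrow> 'v::ab_group_add \<Rightarrow> 'v) \<Rightarrow> 'v set \<Rightarrow> 'v set \<Rightarrow> 'i set \<Rightarrow> ('i \<Rightarrow> 'v) \<Rightarrow> bool" where
  "quotient_basis scale V W I v \<longleftrightarrow>
     v ` I \<subseteq> V \<and>
     (\<forall>x\<in>V. \<exists>!c. Poly_Mapping.keys c \<subseteq> I \<and> x - lincomb scale v c \<in> W)"

definition quotient_coords ::
    "('f::zero \<Rightarrow> 'v::ab_group_add \<Rightarrow> 'v) \<Rightarrow> 'v set \<Rightarrow> 'i set \<Rightarrow> ('i \<Rightarrow> 'v) \<Rightarrow> 'v \<Rightarrow> ('i \<Rightarrow>\<^sub>0 'f)" where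
  "quotient_coords scale W I v x =
     (THE c. Poly_Mapping.keys c \<subseteq> I \<and> x - lincomb scale v c \<in> W)"

text \<open>As for \<^const>\<open>vector_space.dim\<close>, the value is 0 when \<open>V / W\<close> is infinite-dimensional.\<close>
definition quotient_dim ::
    "('f::zero \<Rightarrow> 'v::ab_group_add \<Rightarrow> 'v) \<Rightarrow> 'v set \<Rightarrow> 'v set \<Rightarrow> nat" where
  "quotient_dim scale V W = card (SOME B. quotient_basis scale V W B (\<lambda>b. b))"


section \<open>Free associative algebras\<close>

datatype 'x word = Word (letters: "'x list")

instantiation word :: (type) monoid_add
begin

definition zero_word :: "'a word" where "zero_word = Word []"

definition plus_word :: "'a word \<Rightarrow> 'a word \<Rightarrow> 'a word" where
  "plus_word u w = Word (letters u @ letters w)"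

instance
  by standard (auto simp: zero_word_def plus_word_def)

end

text \<open>
  With this instance, the ring \<open>'x word \<Rightarrow>\<^sub>0 'f\<close> is the free associative unital algebra over
  \<open>'f\<close> on the set of all elements of \<open>'x\<close>; the free algebra without 1 consists of
  those elements whose coefficient at the empty word vanishes.
\<close>

definition pm_scale :: "'f::semiring_0 \<Rightarrow> ('i \<Rightarrow>\<^sub>0 'f) \<Rightarrow> ('i \<Rightarrow>\<^sub>0 'f)" where
  "pm_scale c f = Poly_Mapping.map ((*) c) f"

definition letter :: "'x \<Rightarrow> ('x word \<Rightarrow>\<^sub>0 'f::semiring_1)" where
  "letter x = Poly_Mapping.single (Word [x]) 1"

fun list_product :: "('a \<Rightarrow> 'a \<Rightarrow> 'a) \<Rightarrow> 'a::zero list \<Rightarrow> 'a" where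
  "list_product mul [] = 0"
| "list_product mul [a] = a"
| "list_product mul (a # b # as) = mul a (list_product mul (b # as))"

text \<open>The value at \<open>x \<mapsto> s x\<close> of an element of the free algebra without 1.\<close>
definition assoc_eval ::
    "('f::field \<Rightarrow> 'a::ab_group_add \<Rightarrow> 'a) \<Rightarrow> ('a \<Rightarrow> 'a \<Rightarrow> 'a) \<Rightarrow> ('x \<Rightarrow> 'a) \<Rightarrow>
     ('x word \<Rightarrow>\<^sub>0 'f) \<Rightarrow> 'a" where
  "assoc_eval scale mul s = lincomb scale (\<lambda>w. list_product mul (map s (letters w)))"


section \<open>Universal enveloping algebras\<close>

text \<open>
  \<open>U(g)\<close> is the quotient of the free associative unital algebra on the set \<open>g\<close> by the following
  two-sided ideal; the linearity relations make this the usual quotient of the tensor algebra.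
  Since this quotient depends on the Lie bracket, it is not a type: elements of \<open>U(g)\<close> are given by
  representatives in the free algebra. The action defined below respects congruence
  (\<open>derivation_action.uea_act_ideal\<close>).
\<close>
inductive_set uea_ideal ::
    "('f::field \<Rightarrow> 'g::ab_group_add \<Rightarrow> 'g) \<Rightarrow> ('g \<Rightarrow> 'g \<Rightarrow> 'g) \<Rightarrow> ('g word \<Rightarrow>\<^sub>0 'f) set"
  for gscale :: "'f \<Rightarrow> 'g \<Rightarrow> 'g" and gbracket :: "'g \<Rightarrow> 'g \<Rightarrow> 'g" where
  letter_add: "letter (g + h) - (letter g + letter h) \<in> uea_ideal gscale gbracket"
| letter_scale: "letter (gscale c g) - pm_scale c (letter g) \<in> uea_ideal gscale gbracket"
| letter_bracket:
    "letter g * letter h - letter h * letter g - letter (gbracket g h) \<in> uea_ideal gscale gbracket"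
| zero: "0 \<in> uea_ideal gscale gbracket"
| add: "u \<in> uea_ideal gscale gbracket \<Longrightarrow> v \<in> uea_ideal gscale gbracket \<Longrightarrow>
        u + v \<in> uea_ideal gscale gbracket"
| mult_left: "u \<in> uea_ideal gscale gbracket \<Longrightarrow> t * u \<in> uea_ideal gscale gbracket"
| mult_right: "u \<in> uea_ideal gscale gbracket \<Longrightarrow> u * t \<in> uea_ideal gscale gbracket"

definition uea_basis ::
    "('f::field \<Rightarrow> 'g::ab_group_add \<Rightarrow> 'g) \<Rightarrow> ('g \<Rightarrow> 'g \<Rightarrow> 'g) \<Rightarrow>
     'l set \<Rightarrow> ('l \<Rightarrow> ('g word \<Rightarrow>\<^sub>0 'f)) \<Rightarrow> bool" where
  "uea_basis gscale gbracket \<Lambda> \<gamma> \<longleftrightarrow>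
     quotient_basis pm_scale UNIV (uea_ideal gscale gbracket) \<Lambda> \<gamma>"

definition uea_act ::
    "('f::field \<Rightarrow> 'a::ab_group_add \<Rightarrow> 'a) \<Rightarrow> ('g \<Rightarrow> 'a \<Rightarrow> 'a) \<Rightarrow> ('g word \<Rightarrow>\<^sub>0 'f) \<Rightarrow> 'a \<Rightarrow> 'a" where
  "uea_act scale act h a = lincomb scale (\<lambda>w. foldr act (letters w) a) h"


section \<open>Free Lie algebras\<close>

text \<open>
  The free Lie algebra is the quotient of the free nonassociative algebra \<open>'x magma \<Rightarrow>\<^sub>0 'f\<close>
  by the ideal generated by all squares and all Jacobi sums.
\<close>

datatype 'x magma = MGen 'x | MProd "'x magma" "'x magma"

definition magma_mult ::
    "('x magma \<Rightarrow>\<^sub>0 'f::field) \<Rightarrow> ('x magma \<Rightarrow>\<^sub>0 'f) \<Rightarrow> ('x magma \<Rightarrow>\<^sub>0 'f)" where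
  "magma_mult f g =
     lincomb pm_scale (\<lambda>s. lincomb pm_scale (\<lambda>t. Poly_Mapping.single (MProd s t) 1) g) f"

inductive_set free_lie_ideal :: "('x magma \<Rightarrow>\<^sub>0 'f::field) set" where
  square: "magma_mult f f \<in> free_lie_ideal"
| jacobi: "magma_mult f (magma_mult g h) + magma_mult g (magma_mult h f)
             + magma_mult h (magma_mult f g) \<in> free_lie_ideal"
| zero: "0 \<in> free_lie_ideal"
| add: "f \<in> free_lie_ideal \<Longrightarrow> g \<in> free_lie_ideal \<Longrightarrow> f + g \<in> free_lie_ideal"
| scale: "f \<in> free_lie_ideal \<Longrightarrow> pm_scale c f \<in> free_lie_ideal"
| mult_left: "f \<in> free_lie_ideal \<Longrightarrow> magma_mult g f \<in> free_lie_ideal"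
| mult_right: "f \<in> free_lie_ideal \<Longrightarrow> magma_mult f g \<in> free_lie_ideal"

lemma lookup_pm_scale [simp]:
  "Poly_Mapping.lookup (pm_scale c f) i = c * Poly_Mapping.lookup f i"
  unfolding pm_scale_def by (simp add: map.rep_eq when_def)

lemma vector_space_pm_scale:
  "vector_space (pm_scale :: 'f::field \<Rightarrow> ('i \<Rightarrow>\<^sub>0 'f) \<Rightarrow> _)"
  by unfold_locales (auto intro!: poly_mapping_eqI simp: lookup_add algebra_simps)

interpretation pm: vector_space "pm_scale :: 'f::field \<Rightarrow> ('i \<Rightarrow>\<^sub>0 'f) \<Rightarrow> _"
  by (rule vector_space_pm_scale)

context vector_space
begin

lemma lincomb_superset:
  assumes "finite S" "Poly_Mapping.keys c \<subseteq> S"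
  shows "lincomb scale v c = (\<Sum>i\<in>S. scale (Poly_Mapping.lookup c i) (v i))"
  unfolding lincomb_def using assms
  by (intro sum.mono_neutral_left) (auto simp: in_keys_iff)

lemma lincomb_add: "lincomb scale v (c + d) = lincomb scale v c + lincomb scale v d"
proof -
  let ?S = "Poly_Mapping.keys c \<union> Poly_Mapping.keys d"
  have "Poly_Mapping.keys (c + d) \<subseteq> ?S" by (rule Poly_Mapping.keys_add)
  then show ?thesis
    by (simp add: lincomb_superset[of ?S] lookup_add scale_left_distrib sum.distrib)
qed

lemma lincomb_pm_scale: "lincomb scale v (pm_scale a c) = scale a (lincomb scale v c)"
proof -
  have "Poly_Mapping.keys (pm_scale a c) \<subseteq> Poly_Mapping.keys c" by (auto simp: in_keys_iff)
  then show ?thesis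
    by (simp add: lincomb_superset[of "Poly_Mapping.keys c"] scale_sum_right)
qed

lemma lincomb_family_add:
  "lincomb scale (\<lambda>i. v i + w i) c = lincomb scale v c + lincomb scale w c"
  by (simp add: lincomb_def scale_right_distrib sum.distrib)

lemma lincomb_family_scale:
  "lincomb scale (\<lambda>i. scale a (v i)) c = scale a (lincomb scale v c)"
  by (simp add: lincomb_def scale_sum_right mult.commute)

lemma lincomb_single [simp]: "lincomb scale v (Poly_Mapping.single i a) = scale a (v i)"
  by (simp add: lincomb_def)

lemma lincomb_sum: "lincomb scale v (\<Sum>i\<in>S. c i) = (\<Sum>i\<in>S. lincomb scale v (c i))"
  by (induction S rule: infinite_finite_induct) (simp_all add: lincomb_add, simp_all add: lincomb_def)

lemma lincomb_lincomb:
  "lincomb scale v (lincomb pm_scale w c) = lincomb scale (\<lambda>i. lincomb scale v (w i)) c"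
  unfolding lincomb_def[of pm_scale] lincomb_sum lincomb_pm_scale by (simp add: lincomb_def)

lemma linear_lincomb: "Vector_Spaces.linear pm_scale scale (lincomb scale v)"
  by unfold_locales (simp_all add: lincomb_add lincomb_pm_scale algebra_simps)

end

lemma bilinear_magma_mult:
  "bilinear_algebra pm_scale (magma_mult :: ('x magma \<Rightarrow>\<^sub>0 'f::field) \<Rightarrow> _)"
  by unfold_locales
    (simp_all add: magma_mult_def pm.lincomb_add pm.lincomb_pm_scale
      pm.lincomb_family_add pm.lincomb_family_scale)

interpretation magma: bilinear_algebra pm_scale "magma_mult :: ('x magma \<Rightarrow>\<^sub>0 'f::field) \<Rightarrow> _"
  by (rule bilinear_magma_mult)

context bilinear_algebra
begin

sublocale mul_right: Vector_Spaces.linear scale scale "mul x" for x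
  by (rule linear_mul_right)

sublocale mul_left: Vector_Spaces.linear scale scale "\<lambda>x. mul x y" for y
  by (rule linear_mul_left)

end

lemma free_lie_ideal_uminus: "f \<in> free_lie_ideal \<Longrightarrow> - f \<in> free_lie_ideal"
  using free_lie_ideal.scale[of f "-1"] by simp

lemma free_lie_ideal_diff:
  "f \<in> free_lie_ideal \<Longrightarrow> g \<in> free_lie_ideal \<Longrightarrow> f - g \<in> free_lie_ideal"
  using free_lie_ideal.add[of f "- g"] free_lie_ideal_uminus[of g] by simp

definition free_lie_rel :: "('x magma \<Rightarrow>\<^sub>0 'f::field) \<Rightarrow> ('x magma \<Rightarrow>\<^sub>0 'f) \<Rightarrow> bool" where
  "free_lie_rel f g \<longleftrightarrow> f - g \<in> free_lie_ideal"

lemma equivp_free_lie_rel: "equivp free_lie_rel"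
proof (rule equivpI)
  show "reflp free_lie_rel"
    by (simp add: reflp_def free_lie_rel_def free_lie_ideal.zero)
  show "symp free_lie_rel"
    unfolding symp_def free_lie_rel_def by (metis free_lie_ideal_uminus minus_diff_eq)
  show "transp free_lie_rel"
    unfolding transp_def free_lie_rel_def
    by (intro allI impI, drule (1) free_lie_ideal.add) simp
qed

quotient_type (overloaded) ('x, 'f) free_lie = "'x magma \<Rightarrow>\<^sub>0 'f::field" / free_lie_rel
  by (rule equivp_free_lie_rel)

instantiation free_lie :: (type, field) ab_group_add
begin

lift_definition zero_free_lie :: "('a, 'b) free_lie" is 0 .

lift_definition plus_free_lie ::
    "('a, 'b) free_lie \<Rightarrow> ('a, 'b) free_lie \<Rightarrow> ('a, 'b) free_lie" is "(+)"
  unfolding free_lie_rel_def by (drule (1) free_lie_ideal.add) (simp add: algebra_simps)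

lift_definition uminus_free_lie :: "('a, 'b) free_lie \<Rightarrow> ('a, 'b) free_lie" is uminus
  unfolding free_lie_rel_def by (drule free_lie_ideal_uminus) (simp add: algebra_simps)

lift_definition minus_free_lie ::
    "('a, 'b) free_lie \<Rightarrow> ('a, 'b) free_lie \<Rightarrow> ('a, 'b) free_lie" is "(-)"
  unfolding free_lie_rel_def by (drule (1) free_lie_ideal_diff) (simp add: algebra_simps)

instance
  by (standard; transfer; simp add: free_lie_rel_def free_lie_ideal.zero algebra_simps)

end

lift_definition free_lie_scale :: "'f \<Rightarrow> ('x, 'f::field) free_lie \<Rightarrow> ('x, 'f) free_lie"
  is pm_scale
  unfolding free_lie_rel_def by (metis free_lie_ideal.scale pm.scale_right_diff_distrib)

lift_definition free_lie_bracket ::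
    "('x, 'f::field) free_lie \<Rightarrow> ('x, 'f) free_lie \<Rightarrow> ('x, 'f) free_lie" is magma_mult
proof -
  fix f f' g g' :: "'x magma \<Rightarrow>\<^sub>0 'f"
  assume "free_lie_rel f f'" and "free_lie_rel g g'"
  then have "magma_mult (f - f') g + magma_mult f' (g - g') \<in> free_lie_ideal"
    unfolding free_lie_rel_def
    by (intro free_lie_ideal.add free_lie_ideal.mult_left free_lie_ideal.mult_right)
  then show "free_lie_rel (magma_mult f g) (magma_mult f' g')"
    by (simp add: free_lie_rel_def magma.mul_left.diff magma.mul_right.diff)
qed

lift_definition free_lie_gen :: "'x \<Rightarrow> ('x, 'f::field) free_lie"
  is "\<lambda>x. Poly_Mapping.single (MGen x) 1" .

lemma vector_space_free_lie:
  "vector_space (free_lie_scale :: 'f::field \<Rightarrow> ('x, 'f) free_lie \<Rightarrow> _)"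
proof
  fix a b :: 'f and f g :: "('x, 'f) free_lie"
  show "free_lie_scale a (f + g) = free_lie_scale a f + free_lie_scale a g"
    by transfer (simp add: free_lie_rel_def free_lie_ideal.zero pm.scale_right_distrib)
  show "free_lie_scale (a + b) f = free_lie_scale a f + free_lie_scale b f"
    by transfer (simp add: free_lie_rel_def free_lie_ideal.zero pm.scale_left_distrib)
  show "free_lie_scale a (free_lie_scale b f) = free_lie_scale (a * b) f"
    by transfer (simp add: free_lie_rel_def free_lie_ideal.zero)
  show "free_lie_scale 1 f = f"
    by transfer (simp add: free_lie_rel_def free_lie_ideal.zero)
qed

lemma lie_algebra_free_lie:
  "lie_algebra free_lie_scale (free_lie_bracket :: ('x, 'f::field) free_lie \<Rightarrow> _)"
proof -
  interpret vector_space "free_lie_scale :: 'f \<Rightarrow> ('x, 'f) free_lie \<Rightarrow> _"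
    by (rule vector_space_free_lie)
  show ?thesis
  proof
    fix a :: 'f and f g h :: "('x, 'f) free_lie"
    show "free_lie_bracket f (g + h) = free_lie_bracket f g + free_lie_bracket f h"
      by transfer (simp add: free_lie_rel_def free_lie_ideal.zero magma.mul_right.add)
    show "free_lie_bracket (f + g) h = free_lie_bracket f h + free_lie_bracket g h"
      by transfer (simp add: free_lie_rel_def free_lie_ideal.zero magma.mul_left.add)
    show "free_lie_bracket f (free_lie_scale a g) = free_lie_scale a (free_lie_bracket f g)"
      by transfer (simp add: free_lie_rel_def free_lie_ideal.zero magma.mul_right.scale)
    show "free_lie_bracket (free_lie_scale a f) g = free_lie_scale a (free_lie_bracket f g)"
      by transfer (simp add: free_lie_rel_def free_lie_ideal.zero magma.mul_left.scale)
    show "free_lie_bracket f f = 0"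
      by transfer (simp add: free_lie_rel_def free_lie_ideal.square)
    show "free_lie_bracket f (free_lie_bracket g h) + free_lie_bracket g (free_lie_bracket h f)
            + free_lie_bracket h (free_lie_bracket f g) = 0"
      by transfer (simp add: free_lie_rel_def free_lie_ideal.jacobi)
  qed
qed

primrec magma_product :: "('a \<Rightarrow> 'a \<Rightarrow> 'a) \<Rightarrow> ('x \<Rightarrow> 'a) \<Rightarrow> 'x magma \<Rightarrow> 'a" where
  "magma_product mul s (MGen x) = s x"
| "magma_product mul s (MProd t u) = mul (magma_product mul s t) (magma_product mul s u)"

text \<open>The value at \<open>x \<mapsto> s x\<close> of an element of the free Lie algebra, computed on a representative;
  for a Lie algebra it does not depend on the choice (\<open>lie_algebra.lie_eval_abs\<close>).\<close>
definition lie_eval ::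
    "('f::field \<Rightarrow> 'a::ab_group_add \<Rightarrow> 'a) \<Rightarrow> ('a \<Rightarrow> 'a \<Rightarrow> 'a) \<Rightarrow> ('x \<Rightarrow> 'a) \<Rightarrow>
     ('x, 'f) free_lie \<Rightarrow> 'a" where
  "lie_eval scale mul s f = lincomb scale (magma_product mul s) (rep_free_lie f)"

context bilinear_algebra
begin

lemma lincomb_mul_left: "mul (lincomb scale v c) y = lincomb scale (\<lambda>i. mul (v i) y) c"
  by (simp add: lincomb_def mul_left.sum mul_left.scale)

lemma lincomb_mul_right: "mul x (lincomb scale v c) = lincomb scale (\<lambda>i. mul x (v i)) c"
  by (simp add: lincomb_def mul_right.sum mul_right.scale)

lemma lincomb_magma_mult:
  "lincomb scale (magma_product mul s) (magma_mult f g) =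
     mul (lincomb scale (magma_product mul s) f) (lincomb scale (magma_product mul s) g)"
  by (simp add: magma_mult_def lincomb_lincomb flip: lincomb_mul_left lincomb_mul_right)

end

lemma (in lie_algebra) lincomb_free_lie_ideal:
  "f \<in> free_lie_ideal \<Longrightarrow> lincomb scale (magma_product mul s) f = 0"
  by (induction rule: free_lie_ideal.induct)
    (simp_all add: lincomb_magma_mult lincomb_add lincomb_pm_scale mul_self jacobi,
      simp add: lincomb_def)

lemma (in lie_algebra) lie_eval_abs:
  "lie_eval scale mul s (abs_free_lie f) = lincomb scale (magma_product mul s) f"
proof -
  have "free_lie_rel (rep_free_lie (abs_free_lie f)) f"
    by (rule Quotient3_rep_abs[OF Quotient3_free_lie]) (simp add: free_lie_rel_def free_lie_ideal.zero)
  then have "lincomb scale (magma_product mul s) (rep_free_lie (abs_free_lie f) - f) = 0"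
    unfolding free_lie_rel_def by (rule lincomb_free_lie_ideal)
  moreover have "lincomb scale (magma_product mul s) (rep_free_lie (abs_free_lie f)) =
      lincomb scale (magma_product mul s) (rep_free_lie (abs_free_lie f) - f)
      + lincomb scale (magma_product mul s) f"
    by (simp flip: lincomb_add)
  ultimately show ?thesis by (simp add: lie_eval_def)
qed

fun long_commutator :: "('a \<Rightarrow> 'a \<Rightarrow> 'a) \<Rightarrow> 'a::zero list \<Rightarrow> 'a" where
  "long_commutator br [] = 0"
| "long_commutator br (a # as) = foldl br a as"


lemma poly_mapping_as_sum:
  fixes t :: "'i \<Rightarrow>\<^sub>0 'f::comm_monoid_add"
  shows "t = (\<Sum>k\<in>Poly_Mapping.keys t. Poly_Mapping.single k (Poly_Mapping.lookup t k))"
  by (rule poly_mapping_eqI)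
    (auto simp: lookup_sum lookup_single when_def in_keys_iff sum.delta' cong: if_cong)

context derivation_action
begin

lemma foldr_act_lincomb:
  "foldr act gs (lincomb scale v c) = lincomb scale (\<lambda>i. foldr act gs (v i)) c"
proof (induction gs)
  case (Cons g gs)
  interpret g: Vector_Spaces.linear scale scale "act g" by (rule act_linear)
  show ?case using Cons by (simp add: lincomb_def g.sum g.scale)
qed simp

lemma uea_act_single [simp]:
  "uea_act scale act (Poly_Mapping.single w c) a = scale c (foldr act (letters w) a)"
  by (simp add: uea_act_def)

lemma uea_act_sum: "uea_act scale act (\<Sum>i\<in>S. t i) a = (\<Sum>i\<in>S. uea_act scale act (t i) a)"
  by (simp add: uea_act_def A.lincomb_sum)

lemma uea_act_mult: "uea_act scale act (t * u) a = uea_act scale act t (uea_act scale act u a)"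
proof -
  let ?l = Poly_Mapping.lookup and ?s = Poly_Mapping.single and ?K = Poly_Mapping.keys
  have "t * u = (\<Sum>v\<in>?K t. ?s v (?l t v)) * (\<Sum>w\<in>?K u. ?s w (?l u w))"
    by (simp flip: poly_mapping_as_sum)
  also have "\<dots> = (\<Sum>v\<in>?K t. \<Sum>w\<in>?K u. ?s (v + w) (?l t v * ?l u w))"
    by (simp add: sum_product mult_single)
  finally have "uea_act scale act (t * u) a =
      (\<Sum>v\<in>?K t. \<Sum>w\<in>?K u. scale (?l t v * ?l u w) (foldr act (letters v) (foldr act (letters w) a)))"
    by (simp add: uea_act_sum plus_word_def)
  also have "\<dots> = uea_act scale act t (uea_act scale act u a)"
    by (simp add: uea_act_def foldr_act_lincomb) (simp add: lincomb_def A.scale_sum_right)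
  finally show ?thesis .
qed

lemma uea_act_ideal: "u \<in> uea_ideal gscale gbracket \<Longrightarrow> uea_act scale act u a = 0"
proof (induction arbitrary: a rule: uea_ideal.induct)
  interpret L: Vector_Spaces.linear pm_scale scale "\<lambda>t. uea_act scale act t a" for a
    unfolding uea_act_def by (rule A.linear_lincomb)
  have act0: "uea_act scale act t 0 = 0" for t
  proof -
    have "foldr act gs 0 = 0" for gs
      using foldr_act_lincomb[of gs "\<lambda>_. 0" 0] by (simp add: lincomb_def)
    then show ?thesis by (simp add: uea_act_def lincomb_def)
  qed
  have letter: "uea_act scale act (letter g) a = act g a" for g a
    by (simp add: letter_def)
  {
    case (letter_add g h) show ?case by (simp add: L.diff L.add letter act_add)
  next
    case (letter_scale c g) show ?case by (simp add: L.diff L.scale letter act_scale)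
  next
    case (letter_bracket g h) show ?case by (simp add: L.diff letter uea_act_mult act_bracket)
  next
    case zero show ?case by (simp add: uea_act_def lincomb_def)
  next
    case (add u v) then show ?case by (simp add: L.add)
  next
    case (mult_left u t) then show ?case by (simp add: uea_act_mult act0)
  next
    case (mult_right u t) then show ?case by (simp add: uea_act_mult)
  }
qed

end


section \<open>Differential codimensions\<close>

text \<open>
  \<open>(i, \<beta>)\<close> stands for the generator \<open>x_i\<close> with exponent \<open>\<gamma> \<beta>\<close>. Pairs with \<open>\<beta> \<notin> \<Lambda>\<close>
  do not occur in the spaces \<open>P_n\<close> and \<open>V_n\<close> below, hence do not affect the codimensions.
\<close>

definition assoc_var ::
    "('f::field \<Rightarrow> 'g::ab_group_add \<Rightarrow> 'g) \<Rightarrow> ('g \<Rightarrow> 'g \<Rightarrow> 'g) \<Rightarrow> 'l set \<Rightarrow>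
     ('l \<Rightarrow> ('g word \<Rightarrow>\<^sub>0 'f)) \<Rightarrow> nat \<Rightarrow> ('g word \<Rightarrow>\<^sub>0 'f) \<Rightarrow> ((nat \<times> 'l) word \<Rightarrow>\<^sub>0 'f)" where
  "assoc_var gscale gbracket \<Lambda> \<gamma> i h =
     lincomb pm_scale (\<lambda>\<beta>. letter (i, \<beta>))
       (quotient_coords pm_scale (uea_ideal gscale gbracket) \<Lambda> \<gamma> h)"

definition lie_var ::
    "('f::field \<Rightarrow> 'g::ab_group_add \<Rightarrow> 'g) \<Rightarrow> ('g \<Rightarrow> 'g \<Rightarrow> 'g) \<Rightarrow> 'l set \<Rightarrow>
     ('l \<Rightarrow> ('g word \<Rightarrow>\<^sub>0 'f)) \<Rightarrow> nat \<Rightarrow> ('g word \<Rightarrow>\<^sub>0 'f) \<Rightarrow> (nat \<times> 'l, 'f) free_lie" where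
  "lie_var gscale gbracket \<Lambda> \<gamma> i h =
     lincomb free_lie_scale (\<lambda>\<beta>. free_lie_gen (i, \<beta>))
       (quotient_coords pm_scale (uea_ideal gscale gbracket) \<Lambda> \<gamma> h)"

definition assoc_multilinear ::
    "('f::field \<Rightarrow> 'g::ab_group_add \<Rightarrow> 'g) \<Rightarrow> ('g \<Rightarrow> 'g \<Rightarrow> 'g) \<Rightarrow> 'l set \<Rightarrow>
     ('l \<Rightarrow> ('g word \<Rightarrow>\<^sub>0 'f)) \<Rightarrow> nat \<Rightarrow> ((nat \<times> 'l) word \<Rightarrow>\<^sub>0 'f) set" where
  "assoc_multilinear gscale gbracket \<Lambda> \<gamma> n =
     module.span pm_scale
       {prod_list (map (\<lambda>k. assoc_var gscale gbracket \<Lambda> \<gamma> (\<sigma> k) (h k)) [1..<Suc n]) | \<sigma> h.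
          \<sigma> permutes {1..n}}"

definition lie_multilinear ::
    "('f::field \<Rightarrow> 'g::ab_group_add \<Rightarrow> 'g) \<Rightarrow> ('g \<Rightarrow> 'g \<Rightarrow> 'g) \<Rightarrow> 'l set \<Rightarrow>
     ('l \<Rightarrow> ('g word \<Rightarrow>\<^sub>0 'f)) \<Rightarrow> nat \<Rightarrow> (nat \<times> 'l, 'f) free_lie set" where
  "lie_multilinear gscale gbracket \<Lambda> \<gamma> n =
     module.span free_lie_scale
       {long_commutator free_lie_bracket
          (map (\<lambda>k. lie_var gscale gbracket \<Lambda> \<gamma> (\<sigma> k) (h k)) [1..<Suc n]) | \<sigma> h.
          \<sigma> permutes {1..n}}"

definition assoc_identities ::
    "('f::field \<Rightarrow> 'a::ab_group_add \<Rightarrow> 'a) \<Rightarrow> ('a \<Rightarrow> 'a \<Rightarrow> 'a) \<Rightarrow> ('g \<Rightarrow> 'a \<Rightarrow> 'a) \<Rightarrow>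
     ('l \<Rightarrow> ('g word \<Rightarrow>\<^sub>0 'f)) \<Rightarrow> ((nat \<times> 'l) word \<Rightarrow>\<^sub>0 'f) set" where
  "assoc_identities scale mul act \<gamma> =
     {f. Poly_Mapping.lookup f 0 = 0 \<and>
         (\<forall>a :: nat \<Rightarrow> 'a. assoc_eval scale mul (\<lambda>(i, \<beta>). uea_act scale act (\<gamma> \<beta>) (a i)) f = 0)}"

definition lie_identities ::
    "('f::field \<Rightarrow> 'a::ab_group_add \<Rightarrow> 'a) \<Rightarrow> ('a \<Rightarrow> 'a \<Rightarrow> 'a) \<Rightarrow> ('g \<Rightarrow> 'a \<Rightarrow> 'a) \<Rightarrow>
     ('l \<Rightarrow> ('g word \<Rightarrow>\<^sub>0 'f)) \<Rightarrow> (nat \<times> 'l, 'f) free_lie set" where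
  "lie_identities scale mul act \<gamma> =
     {f. \<forall>a :: nat \<Rightarrow> 'a. lie_eval scale mul (\<lambda>(i, \<beta>). uea_act scale act (\<gamma> \<beta>) (a i)) f = 0}"

definition assoc_codim ::
    "('f::field \<Rightarrow> 'a::ab_group_add \<Rightarrow> 'a) \<Rightarrow> ('a \<Rightarrow> 'a \<Rightarrow> 'a) \<Rightarrow>
     ('f \<Rightarrow> 'g::ab_group_add \<Rightarrow> 'g) \<Rightarrow> ('g \<Rightarrow> 'g \<Rightarrow> 'g) \<Rightarrow> ('g \<Rightarrow> 'a \<Rightarrow> 'a) \<Rightarrow>
     'l set \<Rightarrow> ('l \<Rightarrow> ('g word \<Rightarrow>\<^sub>0 'f)) \<Rightarrow> nat \<Rightarrow> nat" where
  "assoc_codim scale mul gscale gbracket act \<Lambda> \<gamma> n =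
     quotient_dim pm_scale (assoc_multilinear gscale gbracket \<Lambda> \<gamma> n)
       (assoc_multilinear gscale gbracket \<Lambda> \<gamma> n \<inter> assoc_identities scale mul act \<gamma>)"

definition lie_codim ::
    "('f::field \<Rightarrow> 'a::ab_group_add \<Rightarrow> 'a) \<Rightarrow> ('a \<Rightarrow> 'a \<Rightarrow> 'a) \<Rightarrow>
     ('f \<Rightarrow> 'g::ab_group_add \<Rightarrow> 'g) \<Rightarrow> ('g \<Rightarrow> 'g \<Rightarrow> 'g) \<Rightarrow> ('g \<Rightarrow> 'a \<Rightarrow> 'a) \<Rightarrow>
     'l set \<Rightarrow> ('l \<Rightarrow> ('g word \<Rightarrow>\<^sub>0 'f)) \<Rightarrow> nat \<Rightarrow> nat" where
  "lie_codim scale mul gscale gbracket act \<Lambda> \<gamma> n =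
     quotient_dim free_lie_scale (lie_multilinear gscale gbracket \<Lambda> \<gamma> n)
       (lie_multilinear gscale gbracket \<Lambda> \<gamma> n \<inter> lie_identities scale mul act \<gamma>)"

definition has_PIexp :: "(nat \<Rightarrow> nat) \<Rightarrow> real \<Rightarrow> bool" where
  "has_PIexp c d \<longleftrightarrow> (\<lambda>n. root n (real (c n))) \<longlonglongrightarrow> d"

end

theory Submission
  imports Defs
    "HOL-Library.Function_Algebras"
    "HOL-Combinatorics.Multiset_Permutations"
    "HOL-Real_Asymp.Real_Asymp"
    "Jordan_Normal_Form.Determinant"
begin

text \<open>
  Write \<open>T x\<close> for left multiplication by \<open>x\<close>, which is \<open>ad x\<close> if the algebra is a Lie algebra, and let
  \<open>\<kappa> x y = tr (T x T y)\<close> be the trace form; put \<open>d = dim A\<close>. Both parts of the theorem rest on one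
  fact, a form of Cartan's criterion that holds for associative and for Lie algebras
  (\<open>idempotent_isotropic_ideal_zero\<close>): an ideal \<open>N = N\<^sup>2\<close> on which \<open>\<kappa>\<close> vanishes is zero.
  Consequently the form of a \<open>\<gg>\<close>-simple algebra is nondegenerate.

  A \<open>\<gg>\<close>-simple algebra is simple (\<open>stably_simple_imp_simple\<close>): for an ideal \<open>I\<close>, nondegeneracy gives
  \<open>A = I \<oplus> I\<^sup>\<bottom>\<close>, then \<open>A = A\<^sup>2\<close> gives \<open>I = I\<^sup>2\<close>, and a derivation maps \<open>I\<^sup>2\<close> into \<open>I\<close>.

  Codimensions are dimensions of spaces of functions: the \<open>n\<close>-th codimension is the dimension of
  the space of \<open>n\<close>-linear functions on \<open>A\<close> that are defined by \<open>P\<^sub>n\<close> or \<open>V\<^sub>n\<close>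
  (\<open>quotient_dim_eq_dim_image\<close>). Since an \<open>n\<close>-linear function is determined by its values on the
  \<open>d\<^sup>n\<close> tuples of basis vectors, it is at most \<open>d\<^sup>n d\<close>.

  If \<open>A\<close> is not \<open>\<gg>\<close>-simple, then it has nonzero invariant ideals \<open>I\<close> and \<open>J\<close> with \<open>I J = J I = 0\<close>
  that are equal or disjoint (\<open>not_stably_simple_annihilating_ideals\<close>). A multilinear function
  vanishes as soon as one argument lies in \<open>I\<close> and another one in \<open>J\<close>. With a basis that meets both
  ideals, all but about \<open>n d (d - 1)\<^sup>n\<^sup>-\<^sup>1\<close> basis tuples are irrelevant
  (\<open>dim_le_annihilating_ideals\<close>), and the codimensions grow no faster than these numbers times a constant.

  If \<open>A\<close> is simple, many independent ordinary multilinear functions have to be found. Jacobson density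
  yields a nonzero function that alternates in \<open>d\<close> variables (\<open>alternating_extend\<close>). When these
  variables carry a basis, applying an operator to them one after the other and adding up multiplies
  the function by the trace of the operator (\<open>alternating_trace\<close>). In this way the function can be
  multiplied by values of \<open>\<kappa>\<close> at new variables, and by antisymmetrization by Gram determinants of two
  columns of \<open>d\<close> new variables (\<open>alt_multilin_det_step\<close>). A lattice word with letters below \<open>d\<close>,
  each occurring equally often, arranges its positions into columns, one position for each letter.
  The product of the Gram determinants of paired columns does not vanish at the basis tuple spelled
  by the word itself, and vanishes at the tuple spelled by a lexicographically smaller lattice word
  (\<open>triangular_family\<close>). Hence the codimension is at least the number of these lattice words, whose
  exponential growth rate is \<open>d\<close> (\<open>card_lattice_words_ge\<close>, \<open>card_balanced_words_ge\<close>).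
\<close>

section \<open>Operators on a finite-dimensional space\<close>

lemma exists_maximal_nat:
  fixes m :: "'b \<Rightarrow> nat"
  assumes "P a" "\<And>x. P x \<Longrightarrow> m x \<le> b"
  obtains x where "P x" "\<And>y. P y \<Longrightarrow> m y \<le> m x"
  using ex_has_greatest_nat[of P a m "Suc b"] assms by (metis le_imp_less_Suc)

locale alg_closed_space = finite_dimensional_vector_space scale Basis
  for scale :: "'f::{alg_closed_field, field_char_0} \<Rightarrow> 'a::ab_group_add \<Rightarrow> 'a" and Basis
begin

sublocale endo: finite_dimensional_vector_space_pair scale Basis scale Basis ..

abbreviation lin :: "('a \<Rightarrow> 'a) \<Rightarrow> bool" where "lin \<equiv> Vector_Spaces.linear scale scale"

lemmas lin_add = endo.linear_add and lin_scale = endo.linear_scale and lin_zero = endo.linear_0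
  and lin_sum = endo.linear_sum and lin_diff = endo.linear_diff

lemma linI: "(\<And>x y. f (x + y) = f x + f y) \<Longrightarrow> (\<And>c x. f (scale c x) = scale c (f x)) \<Longrightarrow> lin f"
  by (simp add: Vector_Spaces.linear_iff vector_space_axioms)

lemma lin_comp: "lin f \<Longrightarrow> lin g \<Longrightarrow> lin (\<lambda>v. f (g v))"
  by (intro linI) (simp_all add: lin_add lin_scale)

lemma lin_eqI_basis:
  assumes "lin f" "lin g" "span B = UNIV" "\<And>b. b \<in> B \<Longrightarrow> f b = g b"
  shows "f v = g v"
  using endo.linear_eq_on[OF assms(1,2), of v B] assms(3,4) by simp

section \<open>Traces\<close>

definition trace_on :: "'a set \<Rightarrow> ('a \<Rightarrow> 'a) \<Rightarrow> 'f" where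
  "trace_on B f = (\<Sum>b\<in>B. representation B (f b) b)"

abbreviation tr :: "('a \<Rightarrow> 'a) \<Rightarrow> 'f" where "tr \<equiv> trace_on Basis"

lemma span_rep_sum:
  assumes "independent B" "span B = UNIV"
  shows "(\<Sum>b\<in>B. scale (representation B v b) b) = v"
  using sum_representation_eq[of B v B] assms finiteI_independent by auto

lemma rep_lin:
  assumes B: "independent B" "span B = UNIV" and f: "lin f" and C: "independent C" "span C = UNIV"
  shows "representation C (f v) c = (\<Sum>b\<in>B. representation B v b * representation C (f b) c)"
proof -
  have "representation C (f v) c = representation C (f (\<Sum>b\<in>B. scale (representation B v b) b)) c"
    using span_rep_sum[OF B] by simp
  also have "\<dots> = representation C (\<Sum>b\<in>B. scale (representation B v b) (f b)) c"
    by (simp add: lin_sum[OF f] lin_scale[OF f])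
  also have "\<dots> = (\<Sum>b\<in>B. representation B v b * representation C (f b) c)"
    using C by (simp add: representation_sum representation_scale)
  finally show ?thesis .
qed

text \<open>Traces are read off from triangular bases, whereas \<open>tr\<close> refers to the fixed one.\<close>
lemma trace_on_basis_change:
  assumes B: "independent B" "span B = UNIV" and C: "independent C" "span C = UNIV" and f: "lin f"
  shows "trace_on B f = trace_on C f"
proof -
  have "trace_on B f = (\<Sum>b\<in>B. \<Sum>c\<in>C. representation C (f b) c * representation B c b)"
    unfolding trace_on_def
    by (intro sum.cong refl) (use rep_lin[OF C linear_id B, unfolded id_def] in blast)
  also have "\<dots> = (\<Sum>c\<in>C. \<Sum>b\<in>B. representation B c b * representation C (f b) c)"
    by (subst sum.swap) (simp add: mult.commute)
  also have "\<dots> = trace_on C f"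
    unfolding trace_on_def
    by (intro sum.cong refl) (rule rep_lin[OF B f C, symmetric])
  finally show ?thesis .
qed

lemma basis_UNIV: "independent Basis" "span Basis = UNIV"
  using independent_Basis span_Basis by auto

lemma tr_comm: assumes "lin f" "lin g" shows "tr (\<lambda>v. f (g v)) = tr (\<lambda>v. g (f v))"
proof -
  have "tr (\<lambda>v. f (g v)) = (\<Sum>b\<in>Basis. \<Sum>c\<in>Basis. representation Basis (g b) c * representation Basis (f c) b)"
    unfolding trace_on_def by (intro sum.cong refl) (rule rep_lin[OF basis_UNIV assms(1) basis_UNIV])
  also have "\<dots> = (\<Sum>c\<in>Basis. \<Sum>b\<in>Basis. representation Basis (f c) b * representation Basis (g b) c)"
    by (subst sum.swap) (simp add: mult.commute)
  also have "\<dots> = tr (\<lambda>v. g (f v))"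
    unfolding trace_on_def
    by (intro sum.cong refl) (rule rep_lin[OF basis_UNIV assms(2) basis_UNIV, symmetric])
  finally show ?thesis .
qed

lemma tr_add: "tr (\<lambda>v. f v + g v) = tr f + tr g"
  unfolding trace_on_def by (simp add: basis_UNIV representation_add sum.distrib)

lemma tr_scale: "tr (\<lambda>v. scale c (f v)) = c * tr f"
  unfolding trace_on_def by (simp add: basis_UNIV representation_scale sum_distrib_left)

lemma tr_diff: "tr (\<lambda>v. f v - g v) = tr f - tr g"
  unfolding trace_on_def by (simp add: basis_UNIV representation_diff sum_subtractf)

lemma tr_zero: "tr (\<lambda>v. 0) = 0"
  unfolding trace_on_def by (simp add: representation_zero)

section \<open>Polynomials in an operator\<close>

definition op_poly :: "('a \<Rightarrow> 'a) \<Rightarrow> 'f poly \<Rightarrow> 'a \<Rightarrow> 'a" where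
  "op_poly \<phi> p v = (\<Sum>i\<le>degree p. scale (coeff p i) ((\<phi> ^^ i) v))"

lemma op_poly_bound: "degree p \<le> n \<Longrightarrow> op_poly \<phi> p v = (\<Sum>i\<le>n. scale (coeff p i) ((\<phi> ^^ i) v))"
  unfolding op_poly_def by (rule sum.mono_neutral_left) (auto simp: coeff_eq_0)

lemma op_poly_0 [simp]: "op_poly \<phi> 0 v = 0"
  by (simp add: op_poly_def)

lemma op_poly_add: "op_poly \<phi> (p + q) v = op_poly \<phi> p v + op_poly \<phi> q v"
proof -
  let ?n = "max (degree p) (degree q)"
  have "degree (p + q) \<le> ?n" by (rule degree_add_le_max)
  then have "op_poly \<phi> (p + q) v = (\<Sum>i\<le>?n. scale (coeff (p + q) i) ((\<phi> ^^ i) v))"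
    by (rule op_poly_bound)
  also have "\<dots> = op_poly \<phi> p v + op_poly \<phi> q v"
    unfolding op_poly_bound[OF max.cobounded1[of "degree p" "degree q"]]
      op_poly_bound[OF max.cobounded2[of "degree q" "degree p"]]
    by (simp add: scale_left_distrib sum.distrib)
  finally show ?thesis .
qed

lemma op_poly_smult: "op_poly \<phi> (Polynomial.smult c p) v = scale c (op_poly \<phi> p v)"
  using op_poly_bound[OF degree_smult_le, of \<phi> c p v]
  by (simp add: op_poly_def[of \<phi> p] scale_sum_right)

lemma op_poly_sum: "op_poly \<phi> (\<Sum>i\<in>I. p i) v = (\<Sum>i\<in>I. op_poly \<phi> (p i) v)"
  by (induction I rule: infinite_finite_induct) (simp_all add: op_poly_add)

context
  fixes \<phi> assumes phi: "lin \<phi>"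
begin

lemma op_poly_pCons [simp]: "op_poly \<phi> (pCons c p) v = scale c v + \<phi> (op_poly \<phi> p v)"
proof -
  have "degree (pCons c p) \<le> Suc (degree p)" by (rule degree_pCons_le)
  then have "op_poly \<phi> (pCons c p) v =
      scale c v + (\<Sum>i\<le>degree p. scale (coeff p i) (\<phi> ((\<phi> ^^ i) v)))"
    using op_poly_bound[of "pCons c p" "Suc (degree p)" \<phi> v]
    unfolding sum.atMost_Suc_shift by simp
  then show ?thesis by (simp add: op_poly_def lin_sum[OF phi] lin_scale[OF phi])
qed

lemma lin_op_poly: "lin (op_poly \<phi> p)"
proof (induction p)
  case (pCons c p)
  show ?case
  proof (rule linI)
    fix x y k
    show "op_poly \<phi> (pCons c p) (x + y) = op_poly \<phi> (pCons c p) x + op_poly \<phi> (pCons c p) y"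
      by (simp add: lin_add[OF phi] lin_add[OF pCons.IH] scale_right_distrib)
    show "op_poly \<phi> (pCons c p) (scale k x) = scale k (op_poly \<phi> (pCons c p) x)"
      by (simp add: lin_scale[OF phi] lin_scale[OF pCons.IH] scale_right_distrib mult.commute)
  qed
qed (rule linI, simp_all)

lemma op_poly_mult: "op_poly \<phi> (p * q) v = op_poly \<phi> p (op_poly \<phi> q v)"
  by (induction p) (simp_all add: op_poly_add op_poly_smult)

lemma op_poly_1 [simp]: "op_poly \<phi> 1 v = v"
  using op_poly_pCons[of 1 0 v] by (simp add: lin_zero[OF phi] one_pCons[symmetric])

lemma op_poly_monom: "op_poly \<phi> (monom c i) v = scale c ((\<phi> ^^ i) v)"
  by (induction i) (simp_all add: monom_0 monom_Suc lin_zero[OF phi] lin_scale[OF phi])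

lemma op_poly_linear_power:
  "op_poly \<phi> ([:- l, 1:] ^ k) v = ((\<lambda>w. \<phi> w - scale l w) ^^ k) v"
  by (induction k) (simp_all add: op_poly_mult lin_zero[OF phi] del: mult_pCons_left)

text \<open>
  The \<open>dimension + 1\<close> vectors \<open>(\<phi> ^^ i) v\<close> are dependent, and a dependence is a polynomial in \<open>\<phi>\<close>
  that kills \<open>v\<close>.
\<close>
lemma annihilating_poly: "\<exists>p. p \<noteq> 0 \<and> op_poly \<phi> p v = 0"
proof (cases "inj_on (\<lambda>i. (\<phi> ^^ i) v) {..dimension}")
  case True
  let ?S = "(\<lambda>i. (\<phi> ^^ i) v) ` {..dimension}"
  have "card ?S = Suc dimension" using True by (simp add: card_image)
  then have "dependent ?S"
    using independent_card_le_dim[of ?S UNIV] dim_subset_UNIV[of UNIV] by force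
  then obtain u where u: "\<exists>w\<in>?S. u w \<noteq> 0" "(\<Sum>w\<in>?S. scale (u w) w) = 0"
    by (auto simp: dependent_finite)
  let ?p = "\<Sum>i\<le>dimension. monom (u ((\<phi> ^^ i) v)) i"
  from u(1) obtain i where i: "i \<le> dimension" "u ((\<phi> ^^ i) v) \<noteq> 0" by auto
  have "coeff ?p i = u ((\<phi> ^^ i) v)"
    using i by (simp add: coeff_sum sum.delta)
  then have "?p \<noteq> 0" using i by auto
  moreover have "op_poly \<phi> ?p v = 0"
    using u(2) True by (simp add: op_poly_sum op_poly_monom sum.reindex)
  ultimately show ?thesis by blast
next
  case False
  then obtain i j where ij: "i \<noteq> j" "(\<phi> ^^ i) v = (\<phi> ^^ j) v" by (auto simp: inj_on_def)
  let ?p = "monom 1 i + Polynomial.smult (- 1) (monom (1::'f) j)"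
  have "coeff ?p i = 1" using ij by simp
  then have "?p \<noteq> 0" by (metis coeff_0 zero_neq_one)
  moreover have "op_poly \<phi> ?p v = 0" using ij by (simp only: op_poly_add op_poly_smult op_poly_monom) simp
  ultimately show ?thesis by blast
qed

text \<open>
  Modulo \<open>X - l\<close>, the polynomial \<open>q\<close> is the nonzero constant \<open>c = q(l)\<close>. As \<open>c - q\<close> is a multiple of
  \<open>X - l\<close>, its \<open>k\<close>-th power is a multiple of \<open>(X - l)\<^sup>k\<close>, while it differs from \<open>c\<^sup>k\<close> by a multiple of \<open>q\<close>.
\<close>
lemma poly_bezout:
  fixes q :: "'f poly"
  assumes "poly q l \<noteq> 0"
  shows "\<exists>\<alpha> \<beta>. 1 = \<alpha> * q + \<beta> * [:- l, 1:] ^ k"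
proof -
  define r c where "r = [:- l, 1:]" and "c = [:poly q l:]"
  have "r dvd q - c" by (simp add: r_def c_def poly_eq_0_iff_dvd[symmetric])
  then obtain s where "q - c = r * s" by (elim dvdE)
  then have c: "c - r * (- s) = q" by (simp add: algebra_simps)
  have "c - r * (- s) dvd c ^ k - (r * (- s)) ^ k"
    by (metis power_diff_sumr2 dvd_triv_left)
  then obtain t where "c ^ k - (r * (- s)) ^ k = q * t" unfolding c by (elim dvdE)
  then have e: "c ^ k = t * q + (- s) ^ k * r ^ k"
    by (simp add: power_mult_distrib[symmetric] algebra_simps)
  have "c ^ k = [:poly q l ^ k:]" by (simp add: c_def poly_const_pow)
  then have "1 = Polynomial.smult (inverse (poly q l ^ k)) (c ^ k)" using assms by (simp add: one_pCons)
  also have "\<dots> = Polynomial.smult (inverse (poly q l ^ k)) t * q + Polynomial.smult (inverse (poly q l ^ k)) ((- s) ^ k) * r ^ k"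
    unfolding e by (simp add: Polynomial.smult_add_right)
  finally show ?thesis unfolding r_def by blast
qed

section \<open>Generalized eigenspaces\<close>

definition gen_eigenspace :: "'f \<Rightarrow> 'a set" where
  "gen_eigenspace l = {v. \<exists>k. op_poly \<phi> ([:- l, 1:] ^ k) v = 0}"

lemma gen_eigenspace_op_poly:
  assumes "v \<in> gen_eigenspace l"
  shows "op_poly \<phi> p v \<in> gen_eigenspace l"
proof -
  obtain k where k: "op_poly \<phi> ([:- l, 1:] ^ k) v = 0" using assms by (auto simp: gen_eigenspace_def)
  have "op_poly \<phi> ([:- l, 1:] ^ k) (op_poly \<phi> p v) = op_poly \<phi> (p * [:- l, 1:] ^ k) v"
    by (simp only: op_poly_mult[symmetric] mult.commute)
  also have "\<dots> = 0" by (simp only: op_poly_mult k lin_zero[OF lin_op_poly])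
  finally show ?thesis by (auto simp: gen_eigenspace_def)
qed

lemma gen_eigenspace_pow_mono:
  assumes "op_poly \<phi> ([:- l, 1:] ^ k) v = 0" "k \<le> m"
  shows "op_poly \<phi> ([:- l, 1:] ^ m) v = 0"
proof -
  have "[:- l, 1:] ^ m = [:- l, 1:] ^ (m - k) * [:- l, 1:] ^ k"
    using assms(2) by (simp add: power_add[symmetric])
  then have "op_poly \<phi> ([:- l, 1:] ^ m) v = op_poly \<phi> ([:- l, 1:] ^ (m - k)) (op_poly \<phi> ([:- l, 1:] ^ k) v)"
    by (simp only: op_poly_mult)
  then show ?thesis by (simp only: assms lin_zero[OF lin_op_poly])
qed

lemma subspace_gen_eigenspace: "subspace (gen_eigenspace l)"
proof (rule subspaceI)
  show "0 \<in> gen_eigenspace l" by (auto simp: gen_eigenspace_def lin_zero[OF lin_op_poly])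
  fix x y assume "x \<in> gen_eigenspace l" "y \<in> gen_eigenspace l"
  then obtain k m where "op_poly \<phi> ([:- l, 1:] ^ k) x = 0" "op_poly \<phi> ([:- l, 1:] ^ m) y = 0"
    by (auto simp: gen_eigenspace_def)
  then have "op_poly \<phi> ([:- l, 1:] ^ (max k m)) x = 0" "op_poly \<phi> ([:- l, 1:] ^ (max k m)) y = 0"
    by (auto elim: gen_eigenspace_pow_mono)
  then have "op_poly \<phi> ([:- l, 1:] ^ (max k m)) (x + y) = 0" by (simp add: lin_add[OF lin_op_poly])
  then show "x + y \<in> gen_eigenspace l" by (auto simp: gen_eigenspace_def)
next
  fix c x assume "x \<in> gen_eigenspace l"
  then show "scale c x \<in> gen_eigenspace l"
    by (auto simp: gen_eigenspace_def lin_scale[OF lin_op_poly])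
qed

text \<open>
  By the Bezout identity, \<open>q(\<phi>)\<close> is invertible on the generalized eigenspaces of all eigenvalues
  that are not roots of \<open>q\<close>.
\<close>
lemma gen_eigenspace_inj:
  assumes "u \<in> gen_eigenspace l" "poly q l \<noteq> 0" "op_poly \<phi> q u = 0"
  shows "u = 0"
proof -
  obtain k where k: "op_poly \<phi> ([:- l, 1:] ^ k) u = 0" using assms by (auto simp: gen_eigenspace_def)
  obtain \<alpha> \<beta> where "1 = \<alpha> * q + \<beta> * [:- l, 1:] ^ k" using poly_bezout[OF assms(2)] by blast
  then have "op_poly \<phi> 1 u = op_poly \<phi> (\<alpha> * q + \<beta> * [:- l, 1:] ^ k) u" by simp
  then show ?thesis using k assms(3) by (simp add: op_poly_add op_poly_mult lin_zero[OF lin_op_poly])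
qed

lemma gen_eigenspaces_independent:
  assumes "finite M" "\<And>m. m \<in> M \<Longrightarrow> v m \<in> gen_eigenspace m" "(\<Sum>m\<in>M. v m) = 0"
  shows "\<forall>m\<in>M. v m = (0::'a)"
  using assms
proof (induction M arbitrary: v rule: finite_induct)
  case (insert l M)
  obtain k where k: "op_poly \<phi> ([:- l, 1:] ^ k) (v l) = 0"
    using insert.prems(1)[of l] by (auto simp: gen_eigenspace_def)
  let ?p = "[:- l, 1:] ^ k"
  have "op_poly \<phi> ?p (\<Sum>m\<in>insert l M. v m) = 0" by (simp only: insert.prems lin_zero[OF lin_op_poly])
  then have "(\<Sum>m\<in>M. op_poly \<phi> ?p (v m)) = 0"
    using insert.hyps k by (simp add: lin_add[OF lin_op_poly] lin_sum[OF lin_op_poly])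
  then have 0: "\<forall>m\<in>M. op_poly \<phi> ?p (v m) = 0"
    using insert.prems(1) by (intro insert.IH) (auto intro: gen_eigenspace_op_poly)
  have z: "v m = 0" if "m \<in> M" for m
  proof (rule gen_eigenspace_inj)
    show "v m \<in> gen_eigenspace m" using that insert.prems by auto
    show "op_poly \<phi> ?p (v m) = 0" using 0 that by auto
    show "poly ?p m \<noteq> 0" using that insert.hyps by (auto simp: poly_power)
  qed
  then have "(\<Sum>m\<in>M. v m) = 0" by simp
  then show ?case using z insert.prems(2) insert.hyps by simp
qed simp

text \<open>
  Let \<open>l\<close> be a root of \<open>p = (X - l)\<^sup>k q\<close> of multiplicity \<open>k\<close>. The Bezout identity splits \<open>v\<close> into a
  part killed by \<open>(X - l)\<^sup>k\<close>, which is a generalized eigenvector, and a part killed by \<open>q\<close>, which has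
  smaller degree than \<open>p\<close>.
\<close>
lemma annihilated_in_span:
  "p \<noteq> 0 \<Longrightarrow> op_poly \<phi> p v = 0 \<Longrightarrow> v \<in> span (\<Union>l. gen_eigenspace l)"
proof (induction "degree p" arbitrary: p v rule: less_induct)
  case less
  show ?case
  proof (cases "degree p = 0")
    case True
    then obtain c where c: "p = [:c:]" by (rule degree_eq_zeroE)
    then have "v = 0" using less.prems by (simp add: lin_zero[OF phi])
    then show ?thesis by (simp add: span_zero)
  next
    case False
    then obtain l where l: "poly p l = 0" using alg_closed_imp_poly_has_root[of p] by auto
    obtain q where q: "p = [:- l, 1:] ^ Polynomial.order l p * q" "\<not> [:- l, 1:] dvd q"
      using order_decomp[OF less.prems(1)] by blast
    define k where "k = Polynomial.order l p"
    have p: "p = [:- l, 1:] ^ k * q" unfolding k_def by (rule q(1))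
    have "k > 0" using l less.prems(1) by (simp add: k_def order_root)
    moreover have "q \<noteq> 0" using less.prems(1) p by (metis mult_zero_right)
    ultimately have dq: "degree q < degree p"
      unfolding p by (subst degree_mult_eq) (auto simp: degree_power_eq)
    have "poly q l \<noteq> 0" using q(2) by (simp add: poly_eq_0_iff_dvd)
    then obtain \<alpha> \<beta> where ab: "1 = \<alpha> * q + \<beta> * [:- l, 1:] ^ k" using poly_bezout by blast
    let ?w = "op_poly \<phi> (\<beta> * [:- l, 1:] ^ k) v" and ?u = "op_poly \<phi> (\<alpha> * q) v"
    have uw: "op_poly \<phi> 1 v = ?u + ?w" using arg_cong[OF ab, of "\<lambda>p. op_poly \<phi> p v"] by (simp only: op_poly_add)
    have u: "?u \<in> gen_eigenspace l"
    proof -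
      have "op_poly \<phi> ([:- l, 1:] ^ k) ?u = op_poly \<phi> ([:- l, 1:] ^ k * (\<alpha> * q)) v"
        by (simp only: op_poly_mult)
      also have "[:- l, 1:] ^ k * (\<alpha> * q) = \<alpha> * p"
        unfolding p by (simp only: mult_ac)
      also have "op_poly \<phi> (\<alpha> * p) v = 0" using less.prems by (simp only: op_poly_mult lin_zero[OF lin_op_poly])
      finally show ?thesis by (auto simp: gen_eigenspace_def)
    qed
    have w: "?w \<in> span (\<Union>l. gen_eigenspace l)"
    proof (rule less.hyps[OF dq \<open>q \<noteq> 0\<close>])
      have "op_poly \<phi> q ?w = op_poly \<phi> (q * (\<beta> * [:- l, 1:] ^ k)) v"
        by (simp only: op_poly_mult)
      also have "q * (\<beta> * [:- l, 1:] ^ k) = \<beta> * p"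
        unfolding p by (simp only: mult_ac)
      also have "op_poly \<phi> (\<beta> * p) v = 0" using less.prems by (simp only: op_poly_mult lin_zero[OF lin_op_poly])
      finally show "op_poly \<phi> q ?w = 0" .
    qed
    have "?u + ?w \<in> span (\<Union>l. gen_eigenspace l)"
      by (rule span_add[OF span_base w]) (use u in blast)
    then show ?thesis unfolding uw[symmetric] op_poly_1 .
  qed
qed

lemma span_gen_eigenspaces: "span (\<Union>l. gen_eigenspace l) = UNIV"
  using annihilating_poly annihilated_in_span by blast

text \<open>
  An order-free version of the triangular form: the diagonal entries of \<open>\<phi>\<close> in this basis are the
  eigenvalues, so they determine traces. Take a largest independent set \<open>B\<close> of generalized
  eigenvectors such that \<open>\<phi> b\<close> is \<open>l b\<close> times \<open>b\<close> modulo the span of the others. If a generalized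
  eigenvector \<open>v\<close> for \<open>m\<close> were outside its span, the last of the vectors \<open>(\<phi> - m)\<^sup>k v\<close> outside the
  span could be added to \<open>B\<close>.
\<close>
lemma triangular_basis:
  "\<exists>B l. independent B \<and> span B = UNIV \<and>
     (\<forall>b\<in>B. b \<in> gen_eigenspace (l b) \<and> representation B (\<phi> b) b = l b)"
proof -
  define P where "P B \<longleftrightarrow> independent B \<and>
     (\<exists>l. \<forall>b\<in>B. b \<in> gen_eigenspace (l b) \<and> \<phi> b - scale (l b) b \<in> span (B - {b}))" for B
  have "P {}" by (simp add: P_def independent_empty)
  moreover have "card B \<le> dimension" if "P B" for B
    using that by (metis P_def dim_subset_UNIV independent_card_le_dim subset_UNIV le_trans)
  ultimately obtain B where B: "P B" "\<And>B'. P B' \<Longrightarrow> card B' \<le> card B"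
    using exists_maximal_nat[of P "{}" card dimension] by blast
  then obtain l where ind: "independent B" and l: "\<And>b. b \<in> B \<Longrightarrow> b \<in> gen_eigenspace (l b)"
    "\<And>b. b \<in> B \<Longrightarrow> \<phi> b - scale (l b) b \<in> span (B - {b})" by (auto simp: P_def)
  have "span B = UNIV"
  proof (rule ccontr)
    assume ne: "span B \<noteq> UNIV"
    have "\<exists>m v. v \<in> gen_eigenspace m \<and> v \<notin> span B"
    proof (rule ccontr)
      assume "\<not> ?thesis"
      then have "(\<Union>l. gen_eigenspace l) \<subseteq> span B" by auto
      then have "span (\<Union>l. gen_eigenspace l) \<subseteq> span B" by (rule span_minimal) simp
      then show False using ne span_gen_eigenspaces by auto
    qed
    then obtain m v where v: "v \<in> gen_eigenspace m" "v \<notin> span B" by blast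
    let ?N = "\<lambda>k. op_poly \<phi> ([:- m, 1:] ^ k) v"
    obtain k where "?N k = 0" using v by (auto simp: gen_eigenspace_def)
    then have ex: "\<exists>k. ?N k \<in> span B" by (metis span_zero)
    define j where "j = (LEAST k. ?N k \<in> span B)"
    have j: "?N j \<in> span B" unfolding j_def using ex by (rule LeastI_ex)
    have "j \<noteq> 0" using j v by (metis power_0 op_poly_1)
    then obtain i where i: "j = Suc i" by (cases j) auto
    have i': "?N i \<notin> span B" using not_less_Least[of i "\<lambda>k. ?N k \<in> span B"] i j_def by auto
    let ?b = "?N i"
    have ji: "\<phi> ?b - scale m ?b \<in> span B"
      using j unfolding i op_poly_linear_power by simp
    have fin: "finite B" using ind by (rule finiteI_independent)
    have nB: "?b \<notin> B" using i' span_base by blast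
    have "P (insert ?b B)"
      unfolding P_def
    proof (intro conjI exI[of _ "l(?b := m)"] ballI)
      show "independent (insert ?b B)" using ind i' by (simp add: independent_insert)
      fix b assume b: "b \<in> insert ?b B"
      show "b \<in> gen_eigenspace ((l(?b := m)) b)"
        using b l v nB by (auto intro: gen_eigenspace_op_poly)
      show "\<phi> b - scale ((l(?b := m)) b) b \<in> span (insert ?b B - {b})"
      proof (cases "b = ?b")
        case True then show ?thesis using ji nB by simp
      next
        case False
        then have "b \<in> B" using b by auto
        then have "\<phi> b - scale (l b) b \<in> span (B - {b})" by (rule l)
        also have "\<dots> \<subseteq> span (insert ?b B - {b})" by (rule span_mono) auto
        finally show ?thesis using False by simp
      qed
    qed
    then have "card (insert ?b B) \<le> card B" by (rule B)
    then show False using nB fin by simp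
  qed
  moreover have "representation B (\<phi> b) b = l b" if b: "b \<in> B" for b
  proof -
    let ?u = "\<phi> b - scale (l b) b"
    have "representation B ?u b = representation (B - {b}) ?u b"
      using representation_extend[OF ind l(2)[OF b]] by auto
    also have "\<dots> = 0" using representation_ne_zero[of "B - {b}" ?u b] by auto
    finally show ?thesis using ind \<open>span B = UNIV\<close> b
      by (simp add: representation_diff representation_scale representation_basis)
  qed
  ultimately show ?thesis using ind l by blast
qed

lemma gen_eigenspace_eigenvector:
  assumes "b \<in> gen_eigenspace l" "b \<noteq> 0"
  shows "\<exists>v. v \<noteq> 0 \<and> \<phi> v = scale l v"
proof -
  let ?N = "\<lambda>k. op_poly \<phi> ([:- l, 1:] ^ k) b"
  define j where "j = (LEAST k. ?N k = 0)"
  have j: "?N j = 0" unfolding j_def by (rule LeastI_ex) (use assms in \<open>auto simp: gen_eigenspace_def\<close>)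
  then have "j \<noteq> 0" using assms by (metis power_0 op_poly_1)
  then obtain i where i: "j = Suc i" by (cases j) auto
  have "?N i \<noteq> 0" using not_less_Least[of i "\<lambda>k. ?N k = 0"] i j_def by auto
  moreover have "\<phi> (?N i) = scale l (?N i)" using j unfolding i op_poly_linear_power by simp
  ultimately show ?thesis by blast
qed

lemma exists_eigenvector:
  assumes "\<exists>v::'a. v \<noteq> 0"
  shows "\<exists>l v. v \<noteq> 0 \<and> \<phi> v = scale l v"
proof -
  obtain B l where B: "independent B" "span B = UNIV" "\<forall>b\<in>B. b \<in> gen_eigenspace (l b)"
    using triangular_basis by blast
  have "B \<noteq> {}" using B(2) assms by auto
  then obtain b where "b \<in> B" by auto
  moreover then have "b \<noteq> 0" using B(1) dependent_zero by metis
  ultimately show ?thesis using gen_eigenspace_eigenvector[of b "l b"] B(3) by auto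
qed

lemma tr_nilpotent:
  assumes "\<And>v. \<exists>k. (\<phi> ^^ k) v = 0"
  shows "tr \<phi> = 0"
proof -
  obtain B l where B: "independent B" "span B = UNIV"
    "\<forall>b\<in>B. b \<in> gen_eigenspace (l b) \<and> representation B (\<phi> b) b = l b"
    using triangular_basis by blast
  have "l b = 0" if "b \<in> B" for b
  proof (rule ccontr)
    assume nz: "l b \<noteq> 0"
    have "b \<noteq> 0" using B(1) dependent_zero that by metis
    moreover have "b \<in> gen_eigenspace (l b)" using B(3) that by blast
    ultimately obtain v where v: "v \<noteq> 0" "\<phi> v = scale (l b) v"
      using gen_eigenspace_eigenvector by metis
    have "(\<phi> ^^ k) v = scale (l b ^ k) v" for k
      by (induction k) (simp_all add: lin_scale[OF phi] v(2) mult.commute)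
    then show False using assms[of v] v(1) nz by auto
  qed
  then have "trace_on B \<phi> = 0" using B(3) by (simp add: trace_on_def)
  then show ?thesis using trace_on_basis_change[OF B(1,2) basis_UNIV phi] by simp
qed

end

end

section \<open>Associative and Lie algebras\<close>

locale fd_algebra = alg_closed_space scale Basis + bilinear_algebra scale mul
  for scale :: "'f::{alg_closed_field, field_char_0} \<Rightarrow> 'a::ab_group_add \<Rightarrow> 'a" and Basis and mul

text \<open>
  Most of the argument is common to both kinds of algebras: in both of them the trace form below is
  invariant, and the square of an ideal is an ideal.
\<close>
locale assoc_or_lie_algebra = fd_algebra scale Basis mul
  for scale :: "'f::{alg_closed_field, field_char_0} \<Rightarrow> 'a::ab_group_add \<Rightarrow> 'a" and Basis and mul +
  assumes assoc_or_lie: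
    "(\<forall>x y z. mul (mul x y) z = mul x (mul y z)) \<or>
     (\<forall>x. mul x x = 0) \<and> (\<forall>x y z. mul x (mul y z) + mul y (mul z x) + mul z (mul x y) = 0)"
begin

lemmas mul_simps = mul_right.add mul_left.add mul_right.scale mul_left.scale mul_right.diff mul_left.diff
  mul_right.neg mul_left.neg mul_right.zero mul_left.zero

lemma lin_mul: "lin (mul x)" by (rule linear_mul_right)

lemma lie_bracket_rules:
  assumes self: "\<And>x. mul x x = 0"
    and jac: "\<And>x y z. mul x (mul y z) + mul y (mul z x) + mul z (mul x y) = 0"
  shows "mul x y = - mul y x" "mul (mul x y) z = mul x (mul y z) - mul y (mul x z)"
proof -
  have anti: "mul x y = - mul y x" for x y
  proof -
    have "mul (x + y) (x + y) = mul x x + mul y x + (mul x y + mul y y)"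
      by (simp only: mul_simps)
    then have "mul y x + mul x y = 0" by (simp add: self)
    then show ?thesis by (simp add: eq_neg_iff_add_eq_0 add.commute)
  qed
  show "mul x y = - mul y x" by (rule anti)
  have 1: "mul (mul x y) z = - mul z (mul x y)" and 2: "mul y (mul z x) = - mul y (mul x z)"
    using anti[of "mul x y" z] anti[of z x] by (simp_all add: mul_right.neg)
  show "mul (mul x y) z = mul x (mul y z) - mul y (mul x z)"
    using jac[of x y z] unfolding 1 2 by (simp add: algebra_simps add_eq_0_iff)
qed

lemma assoc_lie_cases:
  obtains (assoc) "\<And>x y z. mul (mul x y) z = mul x (mul y z)"
  | (lie) "\<And>x y. mul x y = - mul y x" "\<And>x y z. mul (mul x y) z = mul x (mul y z) - mul y (mul x z)"
proof (cases "\<forall>x y z. mul (mul x y) z = mul x (mul y z)")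
  case True
  then show ?thesis using assoc by blast
next
  case False
  then have "mul x x = 0" "mul x (mul y z) + mul y (mul z x) + mul z (mul x y) = 0" for x y z
    using assoc_or_lie by blast+
  from lie[OF lie_bracket_rules[OF this]] show ?thesis .
qed

section \<open>The trace form\<close>

text \<open>The Killing form if the algebra is a Lie algebra.\<close>
definition form :: "'a \<Rightarrow> 'a \<Rightarrow> 'f" where
  "form x y = tr (\<lambda>v. mul x (mul y v))"

lemma form_add_left: "form (x + y) z = form x z + form y z"
  by (simp add: form_def mul_simps tr_add)
lemma form_scale_left: "form (scale c x) z = c * form x z"
  by (simp add: form_def mul_simps tr_scale)
lemma form_sym: "form x y = form y x"
  unfolding form_def by (rule tr_comm) (rule lin_mul)+
lemma form_add_right: "form z (x + y) = form z x + form z y"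
  by (simp add: form_sym[of z] form_add_left)
lemma form_scale_right: "form z (scale c x) = c * form z x"
  by (simp add: form_sym[of z] form_scale_left)
lemma form_zero [simp]: "form 0 z = 0" "form z 0 = 0"
  using form_scale_left[of 0 0 z] form_scale_right[of z 0 0] by simp_all

lemma form_invariant: "form (mul x y) z = form x (mul y z)"
proof (cases rule: assoc_lie_cases)
  case assoc
  then show ?thesis by (simp add: form_def)
next
  case lie
  have "tr (\<lambda>v. mul y (mul x (mul z v))) = tr (\<lambda>v. mul x (mul z (mul y v)))"
    by (rule tr_comm) (auto intro: lin_mul lin_comp)
  then show ?thesis unfolding form_def lie(2) by (simp add: tr_diff mul_simps)
qed

definition derivation :: "('a \<Rightarrow> 'a) \<Rightarrow> bool" where
  "derivation D \<longleftrightarrow> lin D \<and> (\<forall>x y. D (mul x y) = mul (D x) y + mul x (D y))"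

text \<open>Left multiplication by \<open>D x\<close> is the commutator of \<open>D\<close> with left multiplication by \<open>x\<close>.\<close>
lemma form_derivation:
  assumes "derivation D"
  shows "form (D x) y = - form x (D y)"
proof -
  have D: "lin D" "mul (D x) y = D (mul x y) - mul x (D y)" for x y
    using assms by (auto simp: derivation_def)
  have "tr (\<lambda>v. D (mul x (mul y v))) = tr (\<lambda>v. mul x (mul y (D v)))"
    by (rule tr_comm) (auto intro: lin_mul lin_comp D)
  then show ?thesis unfolding form_def D(2) by (simp add: tr_diff mul_simps)
qed

section \<open>Ideals stable under derivations\<close>

text \<open>
  The set \<open>\<D>\<close> of maps is empty for ordinary ideals, and consists of the derivations or of all operators
  of \<open>U(\<gg>)\<close> for invariant ideals.
\<close>
definition stable_ideal :: "('a \<Rightarrow> 'a) set \<Rightarrow> 'a set \<Rightarrow> bool" where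
  "stable_ideal \<D> I \<longleftrightarrow> two_sided_ideal scale mul I \<and> (\<forall>D\<in>\<D>. \<forall>x\<in>I. D x \<in> I)"

definition ideal_square :: "'a set \<Rightarrow> 'a set" where
  "ideal_square N = span {mul x y | x y. x \<in> N \<and> y \<in> N}"

definition orthogonal_complement :: "'a set \<Rightarrow> 'a set" where
  "orthogonal_complement I = {x. \<forall>y\<in>I. form x y = 0}"

lemma stable_idealD:
  assumes "stable_ideal \<D> I"
  shows "subspace I" "x \<in> I \<Longrightarrow> mul a x \<in> I" "x \<in> I \<Longrightarrow> mul x a \<in> I" "D \<in> \<D> \<Longrightarrow> x \<in> I \<Longrightarrow> D x \<in> I"
  using assms by (auto simp: stable_ideal_def two_sided_ideal_def)

lemma stable_idealI:
  assumes "subspace I" "\<And>a x. x \<in> I \<Longrightarrow> mul a x \<in> I" "\<And>a x. x \<in> I \<Longrightarrow> mul x a \<in> I"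
    "\<And>D x. D \<in> \<D> \<Longrightarrow> x \<in> I \<Longrightarrow> D x \<in> I"
  shows "stable_ideal \<D> I"
  using assms by (auto simp: stable_ideal_def two_sided_ideal_def)

lemma stable_ideal_antimono: "stable_ideal \<D> I \<Longrightarrow> \<D>' \<subseteq> \<D> \<Longrightarrow> stable_ideal \<D>' I"
  by (auto simp: stable_ideal_def)

lemma stable_ideal_UNIV: "stable_ideal \<D> UNIV"
  by (intro stable_idealI) auto

lemma stable_ideal_Int: "stable_ideal \<D> I \<Longrightarrow> stable_ideal \<D> J \<Longrightarrow> stable_ideal \<D> (I \<inter> J)"
  by (intro stable_idealI subspace_inter) (auto dest: stable_idealD)

lemma lin_image_span_subset:
  assumes "lin f" "\<And>x. x \<in> S \<Longrightarrow> f x \<in> span T" "x \<in> span S"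
  shows "f x \<in> span T"
  using assms(3)
  by (induction rule: span_induct_alt)
     (auto simp: lin_zero[OF assms(1)] lin_add[OF assms(1)] lin_scale[OF assms(1)] span_zero span_add span_scale assms(2))

lemma ideal_square_mem: "x \<in> N \<Longrightarrow> y \<in> N \<Longrightarrow> mul x y \<in> ideal_square N"
  unfolding ideal_square_def by (rule span_base) auto

lemma ideal_square_subset:
  assumes "stable_ideal \<D> N" shows "ideal_square N \<subseteq> N"
  unfolding ideal_square_def
  by (rule span_minimal) (use assms in \<open>auto dest: stable_idealD\<close>)

lemma stable_ideal_square:
  assumes N: "stable_ideal \<D> N" and D: "\<And>D. D \<in> \<D> \<Longrightarrow> derivation D"
  shows "stable_ideal \<D> (ideal_square N)"
proof (rule stable_idealI)
  show "subspace (ideal_square N)" by (simp add: ideal_square_def)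
  fix a
  have 1: "mul a (mul x y) \<in> ideal_square N \<and> mul (mul x y) a \<in> ideal_square N"
    if "x \<in> N" "y \<in> N" for x y
  proof (cases rule: assoc_lie_cases)
    case assoc
    then show ?thesis using that N
      by (metis ideal_square_mem stable_idealD(2,3))
  next
    case lie
    have "mul (mul x y) a = mul x (mul y a) - mul y (mul x a)" by (rule lie)
    also have "\<dots> \<in> ideal_square N" using that N
      unfolding ideal_square_def
      by (intro span_diff) (auto intro!: span_base dest: stable_idealD)
    finally have 2: "mul (mul x y) a \<in> ideal_square N" .
    moreover have "mul a (mul x y) = - mul (mul x y) a" by (rule lie)
    ultimately show ?thesis unfolding ideal_square_def by (simp add: span_neg)
  qed
  fix x assume x: "x \<in> ideal_square N"
  show "mul a x \<in> ideal_square N" using x unfolding ideal_square_def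
    by (rule lin_image_span_subset[OF linear_mul_right, rotated]) (use 1 in \<open>auto simp: ideal_square_def\<close>)
  show "mul x a \<in> ideal_square N" using x unfolding ideal_square_def
    by (rule lin_image_span_subset[OF linear_mul_left, rotated]) (use 1 in \<open>auto simp: ideal_square_def\<close>)
  fix D assume DD: "D \<in> \<D>"
  show "D x \<in> ideal_square N" using x unfolding ideal_square_def
  proof (rule lin_image_span_subset[rotated 2])
    show "lin D" using D[OF DD] by (simp add: derivation_def)
    fix z assume "z \<in> {mul x y | x y. x \<in> N \<and> y \<in> N}"
    then obtain x y where xy: "z = mul x y" "x \<in> N" "y \<in> N" by blast
    then have "D z = mul (D x) y + mul x (D y)" using D[OF DD] by (simp add: derivation_def)
    also have "\<dots> \<in> span {mul x y | x y. x \<in> N \<and> y \<in> N}"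
      using xy DD N by (intro span_add span_base) (auto dest: stable_idealD)
    finally show "D z \<in> span {mul x y | x y. x \<in> N \<and> y \<in> N}" .
  qed
qed

lemma stable_ideal_orthogonal_complement:
  assumes N: "stable_ideal \<D> N" and D: "\<And>D. D \<in> \<D> \<Longrightarrow> derivation D"
  shows "stable_ideal \<D> (orthogonal_complement N)"
proof (rule stable_idealI)
  show "subspace (orthogonal_complement N)"
    by (rule subspaceI) (auto simp: orthogonal_complement_def form_add_left form_scale_left)
  fix a x assume x: "x \<in> orthogonal_complement N"
  show "mul x a \<in> orthogonal_complement N"
    using x N by (auto simp: orthogonal_complement_def form_invariant dest: stable_idealD)
  have "form (mul a x) y = form x (mul y a)" for y
    by (metis form_invariant form_sym)
  then show "mul a x \<in> orthogonal_complement N"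
    using x N by (auto simp: orthogonal_complement_def dest: stable_idealD)
next
  fix E x assume "E \<in> \<D>" "x \<in> orthogonal_complement N"
  then show "E x \<in> orthogonal_complement N"
    using N by (auto simp: orthogonal_complement_def form_derivation[OF D] dest: stable_idealD)
qed

section \<open>Idempotent ideals on which the trace form vanishes\<close>

text \<open>
  Regard the field as a vector space over the rationals. Applied to eigenvalues, such a functional
  gives rational numbers, for which a vanishing sum of squares has only zero terms.
\<close>
lemma rational_functional:
  assumes "(l::'f) \<noteq> 0"
  shows "\<exists>g :: 'f \<Rightarrow> rat. (\<forall>x y. g (x + y) = g x + g y) \<and> (\<forall>q x. g (of_rat q * x) = q * g x) \<and> g l = 1"
proof -
  interpret Q: vector_space "\<lambda>q (x::'f). of_rat q * x"
    by unfold_locales (simp_all add: of_rat_add of_rat_mult algebra_simps)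
  interpret R: vector_space "(*) :: rat \<Rightarrow> rat \<Rightarrow> rat"
    by unfold_locales (simp_all add: algebra_simps)
  interpret QR: vector_space_pair "\<lambda>q (x::'f). of_rat q * x" "(*) :: rat \<Rightarrow> rat \<Rightarrow> rat" ..
  have "Q.independent {l}" using assms by (simp add: Q.dependent_single)
  then obtain g where g: "Vector_Spaces.linear (\<lambda>q (x::'f). of_rat q * x) (*) g" "\<forall>x\<in>{l}. g x = 1"
    using QR.linear_independent_extend[of "{l}" "\<lambda>_. 1"] by blast
  show ?thesis
    by (rule exI[of _ g]) (use g QR.linear_add[OF g(1)] QR.linear_scale[OF g(1)] in auto)
qed

context
  fixes \<phi> B l and g :: "'f \<Rightarrow> rat"
  assumes phi: "lin \<phi>" and B: "independent B" "span B = UNIV"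
    and l: "\<forall>b\<in>B. b \<in> gen_eigenspace \<phi> (l b) \<and> representation B (\<phi> b) b = l b"
begin

text \<open>The operator that multiplies the generalized eigenspace of \<open>\<phi>\<close> for \<open>m\<close> by \<open>g m\<close>.\<close>
definition scaled_eigen :: "'a \<Rightarrow> 'a" where
  "scaled_eigen = endo.construct B (\<lambda>b. scale (of_rat (g (l b))) b)"

lemma lin_scaled_eigen: "lin scaled_eigen"
  unfolding scaled_eigen_def by (rule endo.linear_construct[OF B(1)])

lemma scaled_eigen_basis: "b \<in> B \<Longrightarrow> scaled_eigen b = scale (of_rat (g (l b))) b"
  unfolding scaled_eigen_def by (rule endo.construct_basis[OF B(1)])

text \<open>
  Since generalized eigenspaces are independent, a generalized eigenvector for \<open>m\<close> is a combination of
  those basis vectors that have the eigenvalue \<open>m\<close>.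
\<close>
lemma scaled_eigen_gen_eigenspace:
  assumes v: "v \<in> gen_eigenspace \<phi> m"
  shows "scaled_eigen v = scale (of_rat (g m)) v"
proof -
  have fin: "finite B" using B finiteI_independent by auto
  define M where "M = insert m (l ` B)"
  define w where "w k = (\<Sum>b\<in>{b\<in>B. l b = k}. scale (representation B v b) b)" for k
  have w: "w k \<in> gen_eigenspace \<phi> k" for k
    unfolding w_def using l
    by (intro subspace_sum subspace_scale subspace_gen_eigenspace[OF phi]) auto
  have "finite M" using fin by (simp add: M_def)
  have wM: "(\<Sum>k\<in>M. w k) = v"
  proof -
    have "(\<Sum>k\<in>M. w k) = (\<Sum>b\<in>B. scale (representation B v b) b)"
      unfolding w_def by (rule sum.group[OF fin \<open>finite M\<close>]) (auto simp: M_def)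
    then show ?thesis using span_rep_sum[OF B] by simp
  qed
  have "(\<Sum>k\<in>M. w k - (if k = m then v else 0)) = 0"
    using \<open>finite M\<close> wM by (simp add: sum_subtractf sum.delta M_def)
  then have "\<forall>k\<in>M. w k - (if k = m then v else 0) = 0"
    using w v \<open>finite M\<close>
    by (intro gen_eigenspaces_independent[OF phi]) (auto intro!: subspace_diff subspace_gen_eigenspace[OF phi])
  then have "v = w m" by (auto simp: M_def)
  moreover have "scaled_eigen (w m) = scale (of_rat (g m)) (w m)"
    unfolding w_def using lin_scaled_eigen
    by (simp add: lin_sum lin_scale scaled_eigen_basis scale_sum_right mult.commute)
  ultimately show ?thesis by simp
qed

lemma tr_scaled_eigen: "tr (\<lambda>v. \<phi> (scaled_eigen v)) = (\<Sum>b\<in>B. of_rat (g (l b)) * l b)"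
proof -
  have "tr (\<lambda>v. \<phi> (scaled_eigen v)) = trace_on B (\<lambda>v. \<phi> (scaled_eigen v))"
    using trace_on_basis_change[OF basis_UNIV B lin_comp[OF phi lin_scaled_eigen]] by simp
  also have "\<dots> = (\<Sum>b\<in>B. of_rat (g (l b)) * l b)"
    unfolding trace_on_def using B l
    by (intro sum.cong) (auto simp: scaled_eigen_basis lin_scale[OF phi] representation_scale)
  finally show ?thesis .
qed

end

text \<open>
  For \<open>v\<close> and \<open>w\<close> in these eigenspaces,
  \<open>(\<phi> - (a + b)) (v w) = ((\<phi> - a) v) w + v ((\<phi> - b) w)\<close>, so an exponent that kills \<open>v w\<close> is the sum of
  those that kill \<open>v\<close> and \<open>w\<close>.
\<close>
lemma gen_eigenspace_mul_derivation:
  assumes phi: "derivation \<phi>" and v: "v \<in> gen_eigenspace \<phi> a" and w: "w \<in> gen_eigenspace \<phi> b"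
  shows "mul v w \<in> gen_eigenspace \<phi> (a + b)"
proof -
  have lphi: "lin \<phi>" and der: "\<phi> (mul x y) = mul (\<phi> x) y + mul x (\<phi> y)" for x y
    using phi by (auto simp: derivation_def)
  let ?N = "\<lambda>m k. op_poly \<phi> ([:- m, 1:] ^ k)"
  have Suc: "?N m (Suc k) x = ?N m k (\<phi> x - scale m x)" for m k x
    by (simp only: op_poly_linear_power[OF lphi] funpow_Suc_right comp_def)
  have "k + m \<le> n \<Longrightarrow> ?N a k v = 0 \<Longrightarrow> ?N b m w = 0 \<Longrightarrow> ?N (a + b) n (mul v w) = 0" for n k m v w
  proof (induction n arbitrary: k m v w)
    case 0
    then show ?case by (simp add: op_poly_1[OF lphi] mul_simps)
  next
    case (Suc n)
    show ?case
    proof (cases "k = 0 \<or> m = 0")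
      case True
      then have "mul v w = 0" using Suc.prems by (auto simp: op_poly_1[OF lphi] mul_simps)
      then show ?thesis by (simp only: lin_zero[OF lin_op_poly[OF lphi]])
    next
      case False
      then obtain k' m' where km: "k = Suc k'" "m = Suc m'" by (metis not0_implies_Suc)
      let ?v = "\<phi> v - scale a v" and ?w = "\<phi> w - scale b w"
      have 1: "?N a k' ?v = 0" and 2: "?N b m' ?w = 0"
        using Suc.prems(2,3) unfolding km by (simp_all only: \<open>\<And>m k x. ?N m (Suc k) x = ?N m k (\<phi> x - scale m x)\<close>)
      have "\<phi> (mul v w) - scale (a + b) (mul v w) = mul ?v w + mul v ?w"
        by (simp add: der mul_simps scale_left_distrib algebra_simps)
      then have "?N (a + b) (Suc n) (mul v w) = ?N (a + b) n (mul ?v w + mul v ?w)"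
        by (simp only: \<open>\<And>m k x. ?N m (Suc k) x = ?N m k (\<phi> x - scale m x)\<close>)
      also have "\<dots> = ?N (a + b) n (mul ?v w) + ?N (a + b) n (mul v ?w)"
        by (rule lin_add[OF lin_op_poly[OF lphi]])
      also have "?N (a + b) n (mul ?v w) = 0"
        using Suc.prems km 1 by (intro Suc.IH[of k' m]) auto
      also have "?N (a + b) n (mul v ?w) = 0"
        using Suc.prems km 2 by (intro Suc.IH[of k m']) auto
      finally show ?thesis by simp
    qed
  qed
  then show ?thesis using v w unfolding gen_eigenspace_def[OF lphi] by blast
qed

text \<open>
  The argument of Cartan's criterion. If \<open>l b0 \<noteq> 0\<close> is an eigenvalue of left multiplication \<open>\<phi>\<close> by \<open>x\<close>,
  choose a rational functional \<open>g\<close> with \<open>g (l b0) = 1\<close> and let \<open>\<delta>\<close> act on the generalized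
  eigenspaces by the images of the eigenvalues under \<open>g\<close>. Then \<open>tr (T y \<delta>) = 0\<close> for all \<open>y\<close> in \<open>N = N\<^sup>2\<close>: for
  \<open>y = a b\<close>, the operator \<open>\<delta>\<close> commutes with right multiplications in the associative case and is a
  derivation in the Lie case, and both times the trace becomes a value of the form at an element
  of \<open>N\<close>, where it vanishes by invariance. For \<open>y = x\<close> this says \<open>\<Sum> g(\<lambda>) \<lambda> = 0\<close>, summed over the
  eigenvalues, and applying \<open>g\<close> gives \<open>\<Sum> g(\<lambda>)\<^sup>2 = 0\<close>, contrary to the choice of \<open>g\<close>.
\<close>
lemma idempotent_isotropic_nilpotent:
  assumes N: "stable_ideal {} N" "ideal_square N = N" and iso: "\<And>x y. x \<in> N \<Longrightarrow> y \<in> N \<Longrightarrow> form x y = 0"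
    and x: "x \<in> N"
  shows "\<exists>k. (mul x ^^ k) v = 0"
proof -
  have N0: "form x y = 0" if "x \<in> N" for x y
  proof -
    have "x \<in> span {mul x y | x y. x \<in> N \<and> y \<in> N}"
      using that N(2) by (simp add: ideal_square_def)
    then show ?thesis
    proof (induction rule: span_induct_alt)
      case (step c z w)
      then obtain a b where ab: "z = mul a b" "a \<in> N" "b \<in> N" by blast
      then have "form z y = 0" using iso[of a "mul b y"] N(1)
        by (simp add: form_invariant stable_idealD)
      then show ?case using step by (simp add: form_add_left form_scale_left)
    qed simp
  qed
  let ?\<phi> = "mul x"
  obtain B l where B: "independent B" "span B = UNIV"
    "\<forall>b\<in>B. b \<in> gen_eigenspace ?\<phi> (l b) \<and> representation B (?\<phi> b) b = l b"
    using triangular_basis[OF lin_mul] by blast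
  have fin: "finite B" using B finiteI_independent by auto
  have l0: "l b0 = 0" if b0: "b0 \<in> B" for b0
  proof (rule ccontr)
    assume "l b0 \<noteq> 0"
    from rational_functional[OF this] obtain g :: "'f \<Rightarrow> rat" where g:
      "\<And>x y. g (x + y) = g x + g y" "\<And>q x. g (of_rat q * x) = q * g x" "g (l b0) = 1" by blast
    define \<delta> where "\<delta> = scaled_eigen B l g"
    note d = lin_mul[of x] B
    have ld: "lin \<delta>" unfolding \<delta>_def by (rule lin_scaled_eigen[OF d])
    have dE: "\<delta> v = scale (of_rat (g m)) v" if "v \<in> gen_eigenspace ?\<phi> m" for v m
      unfolding \<delta>_def by (rule scaled_eigen_gen_eigenspace[OF d that])
    have "tr (\<lambda>v. mul y (\<delta> v)) = 0" if "y \<in> N" for y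
    proof -
      have prod: "tr (\<lambda>v. mul (mul a b) (\<delta> v)) = 0" if ab: "a \<in> N" "b \<in> N" for a b
      proof (cases rule: assoc_lie_cases)
        case assoc
        have Ex: "op_poly ?\<phi> p (mul v w) = mul (op_poly ?\<phi> p v) w" for p v w
          by (induction p) (simp_all add: op_poly_pCons[OF lin_mul] mul_simps assoc)
        have d1: "\<delta> (mul v w) = mul (\<delta> v) w" for v w
        proof (rule lin_eqI_basis[OF _ _ B(2), where f = "\<lambda>v. \<delta> (mul v w)" and g = "\<lambda>v. mul (\<delta> v) w"])
          show "lin (\<lambda>v. \<delta> (mul v w))" by (rule lin_comp[OF ld linear_mul_left])
          show "lin (\<lambda>v. mul (\<delta> v) w)" using lin_comp[OF linear_mul_left ld] .
          fix b assume "b \<in> B"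
          then have b: "b \<in> gen_eigenspace ?\<phi> (l b)" using B by blast
          then have "mul b w \<in> gen_eigenspace ?\<phi> (l b)"
            unfolding gen_eigenspace_def[OF lin_mul] mem_Collect_eq Ex by (metis mul_left.zero)
          then show "\<delta> (mul b w) = mul (\<delta> b) w" using b by (simp add: dE mul_simps)
        qed
        have "tr (\<lambda>v. mul a (mul b (\<delta> v))) = tr (\<lambda>v. \<delta> (mul a (mul b v)))"
          by (rule tr_comm) (auto intro: lin_mul lin_comp ld)
        also have "\<dots> = form (\<delta> a) b" by (simp add: form_def d1)
        also have "\<dots> = 0" using N0[OF ab(2), of "\<delta> a"] form_sym[of b "\<delta> a"] by simp
        finally show ?thesis by (simp add: assoc)
      next
        case lie
        have der: "derivation ?\<phi>"
        proof -
          have "mul x (mul y z) = mul (mul x y) z + mul y (mul x z)" for y z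
            using lie(2)[of x y z] by simp
          then show ?thesis by (simp add: derivation_def lin_mul)
        qed
        have d1: "\<delta> (mul v w) = mul (\<delta> v) w + mul v (\<delta> w)" for v w
        proof (rule lin_eqI_basis[OF _ _ B(2), where f = "\<lambda>v. \<delta> (mul v w)"
              and g = "\<lambda>v. mul (\<delta> v) w + mul v (\<delta> w)"])
          show "lin (\<lambda>v. \<delta> (mul v w))" by (rule lin_comp[OF ld linear_mul_left])
          show "lin (\<lambda>v. mul (\<delta> v) w + mul v (\<delta> w))"
            by (rule linI) (simp_all add: lin_add[OF ld] lin_scale[OF ld] mul_simps algebra_simps)
          fix b assume b: "b \<in> B"
          show "\<delta> (mul b w) = mul (\<delta> b) w + mul b (\<delta> w)"
          proof (rule lin_eqI_basis[OF _ _ B(2), where f = "\<lambda>w. \<delta> (mul b w)"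
                and g = "\<lambda>w. mul (\<delta> b) w + mul b (\<delta> w)"])
            show "lin (\<lambda>w. \<delta> (mul b w))" by (rule lin_comp[OF ld lin_mul])
            show "lin (\<lambda>w. mul (\<delta> b) w + mul b (\<delta> w))"
              by (rule linI) (simp_all add: lin_add[OF ld] lin_scale[OF ld] mul_simps algebra_simps)
            fix c assume c: "c \<in> B"
            have bc: "b \<in> gen_eigenspace ?\<phi> (l b)" "c \<in> gen_eigenspace ?\<phi> (l c)" using B b c by auto
            from gen_eigenspace_mul_derivation[OF der this]
            show "\<delta> (mul b c) = mul (\<delta> b) c + mul b (\<delta> c)"
              using bc by (simp add: dE mul_simps g of_rat_add scale_left_distrib)
          qed
        qed
        have "tr (\<lambda>v. mul b (mul a (\<delta> v))) = tr (\<lambda>v. mul a (\<delta> (mul b v)))"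
          by (rule tr_comm) (auto intro: lin_mul lin_comp ld)
        then have "tr (\<lambda>v. mul (mul a b) (\<delta> v)) = tr (\<lambda>v. mul a (mul b (\<delta> v)) - mul a (\<delta> (mul b v)))"
          by (simp add: lie(2) tr_diff)
        also have "\<dots> = tr (\<lambda>v. scale (- 1) (mul a (mul (\<delta> b) v)))"
          by (simp add: d1 mul_simps)
        also have "\<dots> = 0" using N0[OF ab(1)] by (subst tr_scale) (simp add: form_def[symmetric])
        finally show ?thesis .
      qed
      have "y \<in> span {mul x y | x y. x \<in> N \<and> y \<in> N}"
        using that N(2) by (simp add: ideal_square_def)
      then show ?thesis
      proof (induction rule: span_induct_alt)
        case base
        then show ?case by (simp add: mul_simps tr_zero)
      next
        case (step c z w)
        then show ?case using prod by (auto simp: mul_simps tr_add tr_scale)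
      qed
    qed
    from this[OF x] have "(\<Sum>b\<in>B. of_rat (g (l b)) * l b) = 0"
      using tr_scaled_eigen[OF d, of g] by (simp add: \<delta>_def)
    moreover have g0: "g 0 = 0" using g(1)[of 0 0] by simp
    moreover have "g (\<Sum>b\<in>B. of_rat (g (l b)) * l b) = (\<Sum>b\<in>B. g (l b) * g (l b))"
      using fin by (induction B rule: finite_induct) (simp_all add: g0 g)
    ultimately have "(\<Sum>b\<in>B. g (l b) * g (l b)) = 0" by simp
    then have "g (l b0) * g (l b0) = 0"
      using fin b0 by (subst (asm) sum_nonneg_eq_0_iff) auto
    then show False by (simp add: g(3))
  qed
  have "B \<subseteq> gen_eigenspace ?\<phi> 0" using B(3) l0 by force
  then have "span B \<subseteq> gen_eigenspace ?\<phi> 0"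
    by (rule span_minimal) (rule subspace_gen_eigenspace[OF lin_mul])
  then have "v \<in> gen_eigenspace ?\<phi> 0" using B by auto
  then obtain k where "op_poly ?\<phi> ([:- 0, 1:] ^ k) v = 0" by (auto simp: gen_eigenspace_def[OF lin_mul])
  then have "(?\<phi> ^^ k) v = 0" unfolding op_poly_linear_power[OF lin_mul] by simp
  then show ?thesis by blast
qed

text \<open>
  Engel's theorem for a subalgebra \<open>K\<close> that acts on the quotient \<open>V / U\<close>; the induction also needs
  the action of a subalgebra on \<open>K\<close> modulo that subalgebra. For a maximal proper
  subalgebra \<open>L\<close> of \<open>K\<close>, induction applied to \<open>K / L\<close> gives \<open>z\<close> in \<open>K - L\<close> with \<open>[L, z] \<subseteq> L\<close>, so
  \<open>K = L + F z\<close> by maximality. Induction applied to \<open>V / U\<close> gives vectors killed by \<open>L\<close>, and \<open>z\<close>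
  maps such vectors to such vectors; the last one in the chain \<open>v, z v, z (z v), \<dots>\<close> outside \<open>U\<close> is
  killed by \<open>K\<close>.
\<close>
lemma engel:
  assumes lie: "\<And>x y. mul x y = - mul y x" "\<And>x y z. mul (mul x y) z = mul x (mul y z) - mul y (mul x z)"
  shows "subspace K \<Longrightarrow> (\<And>x y. x \<in> K \<Longrightarrow> y \<in> K \<Longrightarrow> mul x y \<in> K) \<Longrightarrow>
    (\<And>x v. x \<in> K \<Longrightarrow> \<exists>k. (mul x ^^ k) v = 0) \<Longrightarrow>
    subspace U \<Longrightarrow> subspace V \<Longrightarrow> U \<subset> V \<Longrightarrow>
    (\<And>x v. x \<in> K \<Longrightarrow> v \<in> U \<Longrightarrow> mul x v \<in> U) \<Longrightarrow> (\<And>x v. x \<in> K \<Longrightarrow> v \<in> V \<Longrightarrow> mul x v \<in> V) \<Longrightarrow>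
    \<exists>v\<in>V - U. \<forall>x\<in>K. mul x v \<in> U"
proof (induction "dim K" arbitrary: K U V rule: less_induct)
  case less
  note K = less.prems(1-3) and UV = less.prems(4-8)
  show ?case
  proof (cases "K = {0}")
    case True
    then show ?thesis using UV subspace_0[OF UV(1)] by (auto simp: mul_simps)
  next
    case False
    define P where "P L \<longleftrightarrow> subspace L \<and> L \<subset> K \<and> (\<forall>x\<in>L. \<forall>y\<in>L. mul x y \<in> L)" for L
    have P0: "P {0}" using False subspace_0[OF K(1)] by (auto simp: P_def mul_simps subspace_single_0)
    obtain L where L: "P L" "\<And>L'. P L' \<Longrightarrow> dim L' \<le> dim L"
      using exists_maximal_nat[of P "{0}" dim, OF P0 dim_subset_UNIV] by blast
    then have L': "subspace L" "L \<subset> K" "\<And>x y. x \<in> L \<Longrightarrow> y \<in> L \<Longrightarrow> mul x y \<in> L" by (auto simp: P_def)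
    have dL: "dim L < dim K"
      using L' K(1) by (metis dim_psubset span_eq_iff)
    obtain z where z: "z \<in> K - L" "\<forall>x\<in>L. mul x z \<in> L"
      using less.hyps[OF dL L'(1,3) _ L'(1) K(1) L'(2)] L' K by blast
    obtain v where v: "v \<in> V - U" "\<forall>x\<in>L. mul x v \<in> U"
      using less.hyps[OF dL L'(1,3) _ UV(1-3)] UV(4,5) K L' by blast
    have W: "mul x (mul z w) \<in> U" if "w \<in> V" "\<forall>x\<in>L. mul x w \<in> U" "x \<in> L" for w x
    proof -
      have "mul x (mul z w) = mul (mul x z) w + mul z (mul x w)" using lie(2)[of x z w] by simp
      then show ?thesis using that z UV by (auto intro!: subspace_add)
    qed
    have Wk: "(mul z ^^ k) v \<in> V \<and> (\<forall>x\<in>L. mul x ((mul z ^^ k) v) \<in> U)" for k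
      by (induction k) (use v z W UV(5) in auto)
    obtain k where "(mul z ^^ k) v = 0" using K(3) z by blast
    then have ex: "\<exists>k. (mul z ^^ k) v \<in> U" using subspace_0[OF UV(1)] by metis
    define j where "j = (LEAST k. (mul z ^^ k) v \<in> U)"
    have j: "(mul z ^^ j) v \<in> U" unfolding j_def using ex by (rule LeastI_ex)
    then have "j \<noteq> 0" using v by (metis DiffD2 funpow_0)
    then obtain i where i: "j = Suc i" by (cases j) auto
    let ?w = "(mul z ^^ i) v"
    have w: "?w \<notin> U" using not_less_Least[of i "\<lambda>k. (mul z ^^ k) v \<in> U"] i j_def by auto
    have zw: "mul z ?w \<in> U" using j i by simp
    \<comment> \<open>Otherwise this span would be a proper subalgebra larger than \<open>L\<close>.\<close>
    have "span (insert z L) = K"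
    proof (rule ccontr)
      assume ne: "span (insert z L) \<noteq> K"
      have sub: "span (insert z L) \<subseteq> K" by (rule span_minimal[OF _ K(1)]) (use z(1) L'(2) in blast)
      have "\<exists>c. \<exists>u\<in>L. y = u + scale c z" if yz: "y \<in> span (insert z L)" for y
      proof -
        obtain c where "y - scale c z \<in> span L" using yz unfolding span_insert by blast
        then have "y - scale c z \<in> L" using L'(1) span_eq_iff by blast
        then show ?thesis by (metis diff_add_cancel)
      qed
      note rep = this
      have zz: "mul z z = 0"
      proof -
        have "mul z z + mul z z = 0" using lie(1)[of z z] by (simp add: eq_neg_iff_add_eq_0)
        then have "scale 2 (mul z z) = 0" by (metis one_add_one scale_left_distrib scale_one)
        then show ?thesis by simp
      qed
      have closed: "mul x y \<in> span (insert z L)" if xy: "x \<in> span (insert z L)" "y \<in> span (insert z L)" for x y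
      proof -
        obtain c u where x: "u \<in> L" "x = u + scale c z" using rep[OF xy(1)] by blast
        obtain e w where y: "w \<in> L" "y = w + scale e z" using rep[OF xy(2)] by blast
        have zL: "mul z w \<in> L" using z(2) y(1) lie(1)[of z w] L'(1) by (simp add: subspace_neg)
        have "mul x y = mul u w + scale e (mul u z) + scale c (mul z w)"
          by (simp add: x y mul_simps zz)
        moreover have "mul u w + scale e (mul u z) + scale c (mul z w) \<in> L"
          using x(1) y(1) z(2) L' zL by (intro subspace_add[OF L'(1)] subspace_scale[OF L'(1)]) auto
        ultimately show ?thesis using span_superset[of "insert z L"] by auto
      qed
      have "P (span (insert z L))"
        unfolding P_def using sub ne by (intro conjI psubsetI subspace_span ballI closed)
      then have "dim (span (insert z L)) \<le> dim L" by (rule L)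
      moreover have "L \<subset> span (insert z L)" using z span_superset[of "insert z L"] by auto
      then have "dim L < dim (span (insert z L))"
        using L'(1) by (metis dim_psubset span_eq_iff span_span)
      ultimately show False by simp
    qed
    moreover have "mul x ?w \<in> U" if "x \<in> span (insert z L)" for x
      using that
    proof (induction rule: span_induct_alt)
      case (step c x y)
      then show ?case using zw Wk[of i] UV(1)
        by (auto simp: mul_simps intro!: subspace_add subspace_scale)
    qed (simp add: mul_simps subspace_0[OF UV(1)])
    ultimately show ?thesis using w Wk[of i] by blast
  qed
qed

text \<open>
  All left multiplications by elements of \<open>N\<close> are nilpotent. Let \<open>U\<close> be a maximal proper subspace of \<open>N\<close>
  that is stable under them; \<open>N = N\<^sup>2\<close> means that \<open>N\<close> does not map \<open>N\<close> into \<open>U\<close>. In the Lie case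
  Engel's theorem gives \<open>v\<close> outside \<open>U\<close> with \<open>N v \<subseteq> U\<close>, and then \<open>U + F v = N\<close> is mapped into \<open>U\<close>.
  In the associative case \<open>U + N v = N\<close> for some \<open>v\<close> outside \<open>U\<close>, hence \<open>v\<close> is congruent to \<open>y v\<close>
  modulo \<open>U\<close> for some \<open>y\<close> in \<open>N\<close>; iterating, \<open>v\<close> is congruent to \<open>y\<^sup>k v = 0\<close>.
\<close>
lemma idempotent_isotropic_ideal_zero:
  assumes N: "stable_ideal {} N" "ideal_square N = N" and iso: "\<And>x y. x \<in> N \<Longrightarrow> y \<in> N \<Longrightarrow> form x y = 0"
  shows "N = {0}"
proof (rule ccontr)
  assume ne: "N \<noteq> {0}"
  have nil: "\<exists>k. (mul x ^^ k) v = 0" if "x \<in> N" for x v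
    by (rule idempotent_isotropic_nilpotent[OF N iso that])
  have sN: "subspace N" by (rule stable_idealD(1)[OF N(1)])
  define P where "P U \<longleftrightarrow> subspace U \<and> U \<subset> N \<and> (\<forall>x\<in>N. \<forall>u\<in>U. mul x u \<in> U)" for U
  have P0: "P {0}" using ne subspace_0[OF sN] by (auto simp: P_def mul_simps subspace_single_0)
  obtain U where U: "P U" "\<And>L'. P L' \<Longrightarrow> dim L' \<le> dim U"
    using exists_maximal_nat[of P "{0}" dim, OF P0 dim_subset_UNIV] by blast
  then have U': "subspace U" "U \<subset> N" "\<And>x u. x \<in> N \<Longrightarrow> u \<in> U \<Longrightarrow> mul x u \<in> U" by (auto simp: P_def)
  have max: "U' = N" if "subspace U'" "U \<subset> U'" "U' \<subseteq> N" "\<And>x u. x \<in> N \<Longrightarrow> u \<in> U' \<Longrightarrow> mul x u \<in> U'" for U'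
  proof (rule ccontr)
    assume "U' \<noteq> N"
    then have "P U'" using that by (auto simp: P_def)
    then have "dim U' \<le> dim U" by (rule U)
    moreover have "dim U < dim U'" using that U'(1) by (metis dim_psubset span_eq_iff)
    ultimately show False by simp
  qed
  have notall: "\<not> (\<forall>x\<in>N. \<forall>y\<in>N. mul x y \<in> U)"
  proof
    assume "\<forall>x\<in>N. \<forall>y\<in>N. mul x y \<in> U"
    then have "ideal_square N \<subseteq> U" unfolding ideal_square_def using U'(1) by (intro span_minimal) auto
    then show False using N U' by auto
  qed
  show False
  proof (cases rule: assoc_lie_cases)
    case assoc
    obtain x v where xv: "x \<in> N" "v \<in> N" "mul x v \<notin> U" using notall by blast
    define M where "M = {u + w | u w. u \<in> U \<and> w \<in> (\<lambda>y. mul y v) ` N}"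
    have M: "u + mul y v \<in> M" if "u \<in> U" "y \<in> N" for u y
      unfolding M_def using that by blast
    have "subspace ((\<lambda>y. mul y v) ` N)"
      by (rule endo.linear_subspace_image[OF linear_mul_left sN])
    then have sM: "subspace M" unfolding M_def using U'(1) by (rule subspace_sums[rotated])
    have "U \<subseteq> M"
    proof
      fix u assume "u \<in> U"
      from M[OF this subspace_0[OF sN]] show "u \<in> M" by (simp add: mul_simps)
    qed
    moreover have "mul x v \<in> M"
      using M[OF subspace_0[OF U'(1)] xv(1)] by simp
    ultimately have "U \<subset> M" using xv(3) by blast
    have "M = N"
    proof (rule max[OF sM \<open>U \<subset> M\<close>])
      show "M \<subseteq> N"
      proof
        fix z assume "z \<in> M"
        then obtain a b where "z = a + mul b v" "a \<in> U" "b \<in> N" unfolding M_def by blast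
        then show "z \<in> N" using U'(2) stable_idealD(2)[OF N(1) xv(2)] subspace_add[OF sN] by blast
      qed
      fix y u assume y: "y \<in> N" and "u \<in> M"
      then obtain a b where ab: "u = a + mul b v" "a \<in> U" "b \<in> N" unfolding M_def by blast
      have "mul y u = mul y a + mul (mul y b) v" by (simp add: ab(1) mul_simps assoc)
      also have "\<dots> \<in> M" by (intro M U'(3) stable_idealD(2)[OF N(1)] y ab)
      finally show "mul y u \<in> M" .
    qed
    then have vM: "v \<in> M" using xv(2) by simp
    have "\<exists>u\<in>U. \<exists>y\<in>N. z = u + mul y v" if "z \<in> M" for z
      using that unfolding M_def by blast
    from this[OF vM] obtain u where u: "u \<in> U" "\<exists>y\<in>N. v = u + mul y v" by (rule bexE)
    from u(2) obtain y where y: "y \<in> N" "v = u + mul y v" by (rule bexE)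
    note uy = y(2) u(1) y(1)
    have "v - (mul y ^^ k) v \<in> U" for k
    proof (induction k)
      case (Suc k)
      have "mul y (v - (mul y ^^ k) v) + u \<in> U"
        by (rule subspace_add[OF U'(1) U'(3)[OF uy(3) Suc] uy(2)])
      moreover have "mul y (v - (mul y ^^ k) v) + u = (u + mul y v) - (mul y ^^ Suc k) v"
        by (simp add: mul_right.diff)
      ultimately show ?case using uy(1) by metis
    qed (simp add: subspace_0[OF U'(1)])
    moreover obtain k where "(mul y ^^ k) v = 0" using nil[OF uy(3)] by blast
    ultimately have "v \<in> U" by (metis diff_zero)
    then show False using xv U' by blast
  next
    case lie
    obtain v where v: "v \<in> N - U" "\<forall>x\<in>N. mul x v \<in> U"
      using engel[OF lie sN _ nil U'(1) sN U'(2) U'(3)] stable_idealD(2)[OF N(1)] by blast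
    have rep: "\<exists>c. \<exists>u\<in>U. y = u + scale c v" if yz: "y \<in> span (insert v U)" for y
    proof -
      obtain c where "y - scale c v \<in> span U" using yz unfolding span_insert by blast
      then have "y - scale c v \<in> U" using U'(1) span_eq_iff by blast
      then show ?thesis by (metis diff_add_cancel)
    qed
    have in_U: "mul x y \<in> U" if "x \<in> N" "y \<in> span (insert v U)" for x y
      using rep[OF that(2)] that(1) v U'
      by (auto simp: mul_simps intro!: subspace_add subspace_scale)
    have "span (insert v U) = N"
    proof (rule max)
      show "U \<subset> span (insert v U)" using v span_superset[of "insert v U"] by auto
      show "span (insert v U) \<subseteq> N" by (rule span_minimal) (use v U'(2) sN in auto)
      show "mul x u \<in> span (insert v U)" if "x \<in> N" "u \<in> span (insert v U)" for x u
        using in_U[OF that] span_superset[of "insert v U"] by auto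
    qed simp
    then show False using notall in_U by blast
  qed
qed

end

section \<open>Simplicity and the trace form\<close>

context assoc_or_lie_algebra
begin

text \<open>
  The squares \<open>K\<close>, \<open>K\<^sup>2\<close>, \<open>(K\<^sup>2)\<^sup>2\<close>, \<dots> strictly decrease as long as they are nonzero, because an idempotent
  isotropic ideal is zero. The last nonzero one has square zero.
\<close>
lemma isotropic_ideal_contains_square_zero:
  assumes "\<And>D. D \<in> \<D> \<Longrightarrow> derivation D"
  shows "stable_ideal \<D> K \<Longrightarrow> K \<noteq> {0} \<Longrightarrow> (\<And>x y. x \<in> K \<Longrightarrow> y \<in> K \<Longrightarrow> form x y = 0) \<Longrightarrow>
    \<exists>Z. stable_ideal \<D> Z \<and> Z \<noteq> {0} \<and> (\<forall>x\<in>Z. \<forall>y\<in>Z. mul x y = 0)"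
proof (induction "dim K" arbitrary: K rule: less_induct)
  case less
  note K = less.prems
  have sq: "stable_ideal \<D> (ideal_square K)" by (rule stable_ideal_square[OF K(1) assms])
  have sub: "ideal_square K \<subseteq> K" by (rule ideal_square_subset[OF K(1)])
  have ne: "ideal_square K \<noteq> K"
  proof
    assume "ideal_square K = K"
    then have "K = {0}"
      using idempotent_isotropic_ideal_zero[OF stable_ideal_antimono[OF K(1)]] K(3) by blast
    then show False using K(2) by simp
  qed
  show ?case
  proof (cases "ideal_square K = {0}")
    case True
    then have "\<forall>x\<in>K. \<forall>y\<in>K. mul x y = 0" using ideal_square_mem by blast
    then show ?thesis using K by blast
  next
    case False
    have "dim (ideal_square K) < dim K"
    proof (rule dim_psubset)
      show "span (ideal_square K) \<subset> span K"
        using sub ne stable_idealD(1)[OF sq] stable_idealD(1)[OF K(1)] by (metis span_eq_iff psubsetI)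
    qed
    then show ?thesis using False sq sub K(3) by (intro less.hyps[of "ideal_square K"]) auto
  qed
qed

text \<open>The operator \<open>T z T x\<close> maps the algebra into \<open>Z\<close>, hence its square is zero.\<close>
lemma square_zero_ideal_in_radical:
  assumes Z: "stable_ideal \<D> Z" "\<And>x y. x \<in> Z \<Longrightarrow> y \<in> Z \<Longrightarrow> mul x y = 0" and z: "z \<in> Z"
  shows "form z x = 0"
  unfolding form_def
proof (rule tr_nilpotent)
  show "lin (\<lambda>v. mul z (mul x v))" by (rule lin_comp[OF lin_mul lin_mul])
  fix v
  have "mul z (mul x (mul z (mul x v))) = 0"
    by (rule Z(2)[OF z stable_idealD(2)[OF Z(1) stable_idealD(3)[OF Z(1) z]]])
  then have "((\<lambda>v. mul z (mul x v)) ^^ 2) v = 0" by (simp add: numeral_2_eq_2)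
  then show "\<exists>k. ((\<lambda>v. mul z (mul x v)) ^^ k) v = 0" by blast
qed

text \<open>
  For a basis \<open>B\<close> of \<open>I\<close>, the map \<open>\<psi> x = \<Sum> \<kappa>(x, b) b\<close> has kernel \<open>I\<^sup>\<bottom>\<close>. It is injective on \<open>I\<close>, hence
  maps \<open>I\<close> onto \<open>I\<close>, and every value \<open>\<psi> x\<close> is also attained on \<open>I\<close>.
\<close>
lemma orthogonal_decomposition:
  assumes I: "subspace I" "I \<inter> orthogonal_complement I = {0}"
  shows "\<exists>y\<in>I. x - y \<in> orthogonal_complement I"
proof -
  obtain B where B: "B \<subseteq> I" "independent B" "span B = I"
    using basis_subspace_exists[OF I(1)] by metis
  have fin: "finite B" using B(2) by (rule finiteI_independent)
  define \<psi> where "\<psi> x = (\<Sum>b\<in>B. scale (form x b) b)" for x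
  have lpsi: "lin \<psi>"
    by (rule linI) (simp_all add: \<psi>_def form_add_left form_scale_left scale_left_distrib
      sum.distrib scale_sum_right)
  have orth: "x \<in> orthogonal_complement I" if "\<psi> x = 0" for x
  proof -
    have 0: "form x b = 0" if "b \<in> B" for b
      using \<open>\<psi> x = 0\<close> B(2) fin that unfolding \<psi>_def dependent_finite[OF fin] by blast
    have "form x y = 0" if "y \<in> span B" for y
      using that by (induction rule: span_induct_alt) (simp_all add: form_add_right form_scale_right 0)
    then show ?thesis using B(3) by (simp add: orthogonal_complement_def)
  qed
  have psi_I: "\<psi> x \<in> I" for x
    unfolding \<psi>_def using B(1) by (intro subspace_sum[OF I(1)] subspace_scale[OF I(1)]) auto
  have inj: "inj_on \<psi> (span I)"
  proof (rule inj_onI)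
    fix x y assume xy: "x \<in> span I" "y \<in> span I" "\<psi> x = \<psi> y"
    then have "\<psi> (x - y) = 0" by (simp add: lin_diff[OF lpsi])
    then have "x - y \<in> orthogonal_complement I" by (rule orth)
    moreover have "x - y \<in> I" using xy I(1) by (metis span_diff span_eq_iff)
    ultimately have "x - y \<in> {0}" using I(2) by blast
    then show "x = y" by simp
  qed
  have im: "\<psi> ` I = I"
  proof (rule subspace_dim_equal[OF endo.linear_subspace_image[OF lpsi I(1)] I(1)])
    show "\<psi> ` I \<subseteq> I" using psi_I by auto
    show "dim I \<le> dim (\<psi> ` I)" using endo.dim_image_eq[OF lpsi inj] by simp
  qed
  have "\<psi> x \<in> \<psi> ` I" unfolding im by (rule psi_I)
  then obtain y where y: "\<psi> x = \<psi> y" "y \<in> I" by (rule imageE)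
  then have "\<psi> (x - y) = 0" by (simp add: lin_diff[OF lpsi])
  then show ?thesis using y orth by blast
qed

text \<open>Simplicity for \<open>\<D> = {}\<close>, and \<open>\<gg>\<close>-simplicity for the set \<open>\<D>\<close> of operators by which \<open>\<gg>\<close> acts.\<close>
definition stably_simple :: "('a \<Rightarrow> 'a) set \<Rightarrow> bool" where
  "stably_simple \<D> \<longleftrightarrow> ideal_square UNIV \<noteq> {0} \<and> (\<forall>I. stable_ideal \<D> I \<longrightarrow> I = {0} \<or> I = UNIV)"

text \<open>
  The radical of the form is an invariant ideal. If it were the whole algebra, which equals its
  square, the algebra would be zero.
\<close>
lemma stably_simple_nondegenerate:
  assumes D: "\<And>D. D \<in> \<D> \<Longrightarrow> derivation D" and S: "stably_simple \<D>" and x: "\<And>y. form x y = 0"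
  shows "x = 0"
proof -
  have "stable_ideal \<D> (orthogonal_complement UNIV)"
    by (rule stable_ideal_orthogonal_complement[OF stable_ideal_UNIV D])
  then have "orthogonal_complement UNIV = {0} \<or> orthogonal_complement UNIV = UNIV"
    using S unfolding stably_simple_def by blast
  moreover have "orthogonal_complement UNIV \<noteq> UNIV"
  proof
    assume "orthogonal_complement UNIV = UNIV"
    then have 0: "form x y = 0" for x y by (auto simp: orthogonal_complement_def)
    have "stable_ideal \<D> (ideal_square UNIV)" by (rule stable_ideal_square[OF stable_ideal_UNIV D])
    then have sq: "ideal_square UNIV = UNIV" using S unfolding stably_simple_def by blast
    have "(UNIV :: 'a set) = {0}"
      by (rule idempotent_isotropic_ideal_zero[OF stable_ideal_UNIV sq 0])
    then show False using sq S unfolding stably_simple_def by simp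
  qed
  ultimately have "orthogonal_complement UNIV = {0}" by blast
  then show ?thesis using x unfolding orthogonal_complement_def by auto
qed

text \<open>
  An ordinary ideal \<open>I\<close> is shown to be invariant. If \<open>I \<inter> I\<^sup>\<bottom>\<close> were nonzero, it would contain a
  nonzero ideal of square zero, which lies in the radical of the form; but the form is nondegenerate.
  So \<open>A = I \<oplus> I\<^sup>\<bottom>\<close> with \<open>I I\<^sup>\<bottom> = I\<^sup>\<bottom> I = 0\<close>, and \<open>A = A\<^sup>2\<close> implies \<open>I = I\<^sup>2\<close>. Derivations
  map \<open>I\<^sup>2\<close> into \<open>I\<close>.
\<close>
lemma stably_simple_imp_simple:
  assumes D: "\<And>D. D \<in> \<D> \<Longrightarrow> derivation D" and S: "stably_simple \<D>"
  shows "stably_simple {}"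
  unfolding stably_simple_def
proof (intro conjI allI impI)
  show ne: "ideal_square UNIV \<noteq> {0}" using S by (simp add: stably_simple_def)
  fix I assume I: "stable_ideal {} I"
  let ?J = "orthogonal_complement I"
  have J: "stable_ideal {} ?J" by (rule stable_ideal_orthogonal_complement[OF I]) simp
  note sI = stable_idealD(1)[OF I] and sJ = stable_idealD(1)[OF J]
  have IJ: "I \<inter> ?J = {0}"
  proof (rule ccontr)
    assume "I \<inter> ?J \<noteq> {0}"
    moreover have "form x y = 0" if "x \<in> I \<inter> ?J" "y \<in> I \<inter> ?J" for x y
      using that by (auto simp: orthogonal_complement_def)
    ultimately obtain Z where Z: "stable_ideal {} Z" "Z \<noteq> {0}" "\<forall>x\<in>Z. \<forall>y\<in>Z. mul x y = 0"
      using isotropic_ideal_contains_square_zero[of "{}", OF _ stable_ideal_Int[OF I J]] by blast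
    then obtain z where z: "z \<in> Z" "z \<noteq> 0" using subspace_0[OF stable_idealD(1)[OF Z(1)]] by blast
    have "form z y = 0" for y
      by (rule square_zero_ideal_in_radical[OF Z(1) _ z(1)]) (use Z(3) in blast)
    then show False using stably_simple_nondegenerate[OF D S] z(2) by blast
  qed
  have decomp: "\<exists>y\<in>I. x - y \<in> ?J" for x by (rule orthogonal_decomposition[OF sI IJ])
  have prod0: "mul x y = 0 \<and> mul y x = 0" if "x \<in> I" "y \<in> ?J" for x y
    using IJ that stable_idealD(2,3)[OF I] stable_idealD(2,3)[OF J] by blast
  have sqU: "ideal_square UNIV = UNIV"
    using S stable_ideal_square[OF stable_ideal_UNIV D] unfolding stably_simple_def by blast
  have sqI: "x \<in> ideal_square I" if "x \<in> I" for x
  proof -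
    have "\<exists>a\<in>ideal_square I. z - a \<in> ?J" if "z \<in> span {mul x y | x y. x \<in> UNIV \<and> y \<in> UNIV}" for z
      using that
    proof (induction rule: span_induct_alt)
      case base
      show ?case by (rule bexI[of _ 0]) (simp_all add: ideal_square_def span_zero subspace_0[OF sJ])
    next
      case (step c w z)
      then obtain a where a: "a \<in> ideal_square I" "z - a \<in> ?J" by blast
      obtain u v where w: "w = mul u v" using step by blast
      obtain u' where u': "u' \<in> I" "u - u' \<in> ?J" using decomp by blast
      obtain v' where v': "v' \<in> I" "v - v' \<in> ?J" using decomp by blast
      have "w - mul u' v' = mul (u - u') v + mul u' (v - v')" by (simp add: w mul_simps)
      also have "\<dots> \<in> ?J"
        by (intro subspace_add[OF sJ] stable_idealD(2)[OF J] stable_idealD(3)[OF J] u' v')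
      finally have wJ: "w - mul u' v' \<in> ?J" .
      have "scale c w + z - (scale c (mul u' v') + a) = scale c (w - mul u' v') + (z - a)"
        by (simp add: scale_right_diff_distrib)
      also have "\<dots> \<in> ?J" by (intro subspace_add[OF sJ] subspace_scale[OF sJ] wJ a)
      finally have "scale c w + z - (scale c (mul u' v') + a) \<in> ?J" .
      moreover have "scale c (mul u' v') + a \<in> ideal_square I"
        using a(1) ideal_square_mem[OF u'(1) v'(1)] unfolding ideal_square_def
        by (intro span_add span_scale)
      ultimately show ?case by blast
    qed
    moreover have "x \<in> span {mul x y | x y. x \<in> UNIV \<and> y \<in> UNIV}"
      using sqU by (simp add: ideal_square_def)
    ultimately obtain a where a: "a \<in> ideal_square I" "x - a \<in> ?J" by blast
    then have "x - a \<in> I" using that ideal_square_subset[OF I] subspace_diff[OF sI] by blast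
    then have "x - a = 0" using IJ a by blast
    then show ?thesis using a by simp
  qed
  have "stable_ideal \<D> I"
  proof (rule stable_idealI[OF sI stable_idealD(2)[OF I] stable_idealD(3)[OF I]])
    fix E x assume E: "E \<in> \<D>" and "x \<in> I"
    then have xs: "x \<in> span {mul x y | x y. x \<in> I \<and> y \<in> I}" using sqI by (simp add: ideal_square_def)
    have Ez: "E z \<in> span I" if z: "z \<in> {mul x y | x y. x \<in> I \<and> y \<in> I}" for z
    proof -
      obtain x y where "z = mul x y" "x \<in> I" "y \<in> I" using z by blast
      then have "E z = mul (E x) y + mul x (E y)" using D[OF E] by (simp add: derivation_def)
      also have "\<dots> \<in> I" using \<open>x \<in> I\<close> \<open>y \<in> I\<close>
        by (intro subspace_add[OF sI] stable_idealD(2)[OF I] stable_idealD(3)[OF I])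
      finally show ?thesis by (rule span_base)
    qed
    have "lin E" using D[OF E] by (simp add: derivation_def)
    from lin_image_span_subset[OF this Ez xs] show "E x \<in> I" using sI by (metis span_eq_iff)
  qed
  then show "I = {0} \<or> I = UNIV" using S unfolding stably_simple_def by blast
qed

text \<open>
  If \<open>A\<^sup>2 = 0\<close>, both ideals can be \<open>A\<close>. Otherwise, for a proper nonzero invariant ideal \<open>I\<close>, either \<open>I\<close> and \<open>J = I\<^sup>\<bottom>\<close> are complementary, or their
  isotropic intersection contains an invariant ideal of square zero, which serves as both \<open>I\<close>
  and \<open>J\<close>.
\<close>
lemma not_stably_simple_annihilating_ideals:
  assumes D: "\<And>D. D \<in> \<D> \<Longrightarrow> derivation D" and S: "\<not> stably_simple \<D>" and ne: "\<exists>a::'a. a \<noteq> 0"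
  obtains I J where "stable_ideal \<D> I" "stable_ideal \<D> J" "I \<noteq> {0}" "J \<noteq> {0}" "I = J \<or> I \<inter> J = {0}"
    "\<And>x y. x \<in> I \<Longrightarrow> y \<in> J \<Longrightarrow> mul x y = 0 \<and> mul y x = 0"
proof (cases "ideal_square UNIV = {0}")
  case True
  have "mul x y = 0" for x y using ideal_square_mem[of x UNIV y] True by auto
  then show ?thesis using that[OF stable_ideal_UNIV stable_ideal_UNIV] ne by auto
next
  case False
  then obtain I where I: "stable_ideal \<D> I" "I \<noteq> {0}" "I \<noteq> UNIV" using S unfolding stably_simple_def by blast
  let ?J = "orthogonal_complement I"
  have J: "stable_ideal \<D> ?J" by (rule stable_ideal_orthogonal_complement[OF I(1) D])
  show ?thesis
  proof (cases "I \<inter> ?J = {0}")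
    case True
    obtain x where "x \<notin> I" using I(3) by blast
    obtain y where y: "y \<in> I" "x - y \<in> ?J"
      using orthogonal_decomposition[OF stable_idealD(1)[OF I(1)] True] by blast
    then have "x - y \<noteq> 0" using \<open>x \<notin> I\<close> by auto
    then have "?J \<noteq> {0}" using y by blast
    moreover have "mul x y = 0 \<and> mul y x = 0" if "x \<in> I" "y \<in> ?J" for x y
      using True that stable_idealD(2,3)[OF I(1)] stable_idealD(2,3)[OF J] by blast
    ultimately show ?thesis using that[OF I(1) J I(2)] True by blast
  next
    case False
    have "form x y = 0" if "x \<in> I \<inter> ?J" "y \<in> I \<inter> ?J" for x y
      using that by (auto simp: orthogonal_complement_def)
    then obtain Z where Z: "stable_ideal \<D> Z" "Z \<noteq> {0}" "\<forall>x\<in>Z. \<forall>y\<in>Z. mul x y = 0"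
      using isotropic_ideal_contains_square_zero[OF D stable_ideal_Int[OF I(1) J] False] by blast
    then show ?thesis using that[OF Z(1) Z(1) Z(2) Z(2)] by blast
  qed
qed

end

context assoc_or_lie_algebra
begin

section \<open>Multilinear polynomial functions\<close>

text \<open>
  The functions \<open>f a\<close> of \<open>a\<close> that are given by polynomials linear in each of the variables \<open>a i\<close> with
  \<open>i \<in> S\<close>, where operators from \<open>Ops\<close> may be applied to the variables. With the identity alone these
  are the ordinary multilinear polynomials, with the operators of \<open>U(\<gg>)\<close> the differential ones.
\<close>
inductive multilin :: "('a \<Rightarrow> 'a) set \<Rightarrow> nat set \<Rightarrow> ((nat \<Rightarrow> 'a) \<Rightarrow> 'a) \<Rightarrow> bool" for Ops where
  var: "\<phi> \<in> Ops \<Longrightarrow> multilin Ops {i} (\<lambda>a. \<phi> (a i))"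
| prod: "multilin Ops S f \<Longrightarrow> multilin Ops T g \<Longrightarrow> S \<inter> T = {} \<Longrightarrow> multilin Ops (S \<union> T) (\<lambda>a. mul (f a) (g a))"
| add: "multilin Ops S f \<Longrightarrow> multilin Ops S g \<Longrightarrow> multilin Ops S (\<lambda>a. f a + g a)"
| scale: "multilin Ops S f \<Longrightarrow> multilin Ops S (\<lambda>a. scale c (f a))"

lemma multilin_cong: "multilin Ops S f \<Longrightarrow> (\<And>i. i \<in> S \<Longrightarrow> a i = b i) \<Longrightarrow> f a = f b"
proof (induction rule: multilin.induct)
  case (prod S f T g)
  have "f a = f b" "g a = g b" by (rule prod.IH; simp add: prod.prems)+
  then show ?case by simp
qed auto

lemma multilin_upd: "multilin Ops S f \<Longrightarrow> i \<notin> S \<Longrightarrow> f (a(i := v)) = f a"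
  by (rule multilin_cong) auto

lemma multilin_finite: "multilin Ops S f \<Longrightarrow> finite S \<and> S \<noteq> {}"
  by (induction rule: multilin.induct) auto

lemma multilin_lin:
  assumes "multilin Ops S f" "\<And>\<phi>. \<phi> \<in> Ops \<Longrightarrow> lin \<phi>" "i \<in> S"
  shows "lin (\<lambda>v. f (a(i := v)))"
  using assms(1,3)
proof (induction rule: multilin.induct)
  case (var \<phi> j)
  then show ?case using assms(2)[of \<phi>] by simp
next
  case (prod S f T g)
  show ?case
  proof (cases "i \<in> S")
    case True
    then have "i \<notin> T" using prod.hyps by auto
    then have g: "g (a(i := v)) = g a" for v using multilin_upd[OF prod.hyps(2)] by blast
    show ?thesis unfolding g by (rule lin_comp[OF linear_mul_left prod.IH(1)[OF True]])
  next
    case False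
    then have "i \<in> T" using prod.prems by auto
    have f: "f (a(i := v)) = f a" for v using multilin_upd[OF prod.hyps(1) False] by blast
    show ?thesis unfolding f by (rule lin_comp[OF lin_mul prod.IH(2)[OF \<open>i \<in> T\<close>]])
  qed
next
  case (add S f g)
  from add.IH(1)[OF add.prems] add.IH(2)[OF add.prems] show ?case
    by (rule endo.linear_compose_add)
next
  case (scale S f c)
  from scale.IH[OF scale.prems] show ?case by (rule endo.linear_compose_scale_right)
qed

lemma multilin_ideal:
  assumes "multilin Ops S f" "stable_ideal Ops I" "p \<in> S" "a p \<in> I"
  shows "f a \<in> I"
  using assms(1,3,4)
proof (induction rule: multilin.induct)
  case (var \<phi> i)
  then show ?case using stable_idealD(4)[OF assms(2)] by auto
next
  case (prod S f T g)
  then show ?case using stable_idealD(2,3)[OF assms(2)] by blast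
next
  case (add S f g)
  then show ?case using subspace_add[OF stable_idealD(1)[OF assms(2)]] by blast
next
  case (scale S f c)
  then show ?case using subspace_scale[OF stable_idealD(1)[OF assms(2)]] by blast
qed

text \<open>
  At the product where the variables \<open>p\<close> and \<open>q\<close> come together, one factor lies in \<open>I\<close> and the other
  one in \<open>J\<close>.
\<close>
lemma multilin_annihilating_ideals:
  assumes "multilin Ops S f" "stable_ideal Ops I" "stable_ideal Ops J"
    and IJ: "\<And>x y. x \<in> I \<Longrightarrow> y \<in> J \<Longrightarrow> mul x y = 0 \<and> mul y x = 0"
    and "p \<in> S" "q \<in> S" "p \<noteq> q" "a p \<in> I" "a q \<in> J"
  shows "f a = 0"
  using assms(1,5-9)
proof (induction rule: multilin.induct)
  case (prod S f T g)
  note fI = multilin_ideal[OF prod.hyps(1), where a = a] and gI = multilin_ideal[OF prod.hyps(2), where a = a]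
  consider "p \<in> S" "q \<in> S" | "p \<in> T" "q \<in> T" | "p \<in> S" "q \<in> T" | "p \<in> T" "q \<in> S"
    using prod.prems by blast
  then show ?case
  proof cases
    case 1
    have "f a = 0" by (rule prod.IH(1)[OF 1 prod.prems(3-5)])
    then show ?thesis by (simp add: mul_left.zero)
  next
    case 2
    have "g a = 0" by (rule prod.IH(2)[OF 2 prod.prems(3-5)])
    then show ?thesis by (simp add: mul_right.zero)
  next
    case 3
    show ?thesis
      using IJ[OF fI[OF assms(2) 3(1) prod.prems(4)] gI[OF assms(3) 3(2) prod.prems(5)]] by (rule conjunct1)
  next
    case 4
    show ?thesis
      using IJ[OF gI[OF assms(2) 4(1) prod.prems(4)] fI[OF assms(3) 4(2) prod.prems(5)]] by (rule conjunct2)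
  qed
qed auto

abbreviation pmultilin :: "nat set \<Rightarrow> ((nat \<Rightarrow> 'a) \<Rightarrow> 'a) \<Rightarrow> bool" where
  "pmultilin \<equiv> multilin {\<lambda>v. v}"

lemma pmultilin_var: "pmultilin {i} (\<lambda>a. a i)"
  using multilin.var[of "\<lambda>v. v" "{\<lambda>v. v}" i] by simp

lemma pmultilin_lin: "pmultilin S f \<Longrightarrow> i \<in> S \<Longrightarrow> lin (\<lambda>v. f (a(i := v)))"
  by (rule multilin_lin) (auto intro: linI)

lemma multilin_sum:
  assumes "finite I" "I \<noteq> {}" "\<And>i. i \<in> I \<Longrightarrow> multilin Ops S (f i)"
  shows "multilin Ops S (\<lambda>a. \<Sum>i\<in>I. f i a)"
  using assms
proof (induction I rule: finite_ne_induct)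
  case (insert i I)
  then have "multilin Ops S (\<lambda>a. f i a + (\<Sum>i\<in>I. f i a))"
    by (intro multilin.add) auto
  then show ?case using insert.hyps by simp
qed simp

lemma pmultilin_rename:
  "pmultilin S f \<Longrightarrow> inj_on \<pi> S \<Longrightarrow> pmultilin (\<pi> ` S) (\<lambda>a. f (\<lambda>i. a (\<pi> i)))"
proof (induction rule: multilin.induct)
  case (var \<phi> i)
  then show ?case using pmultilin_var[of "\<pi> i"] by simp
next
  case (prod S f T g)
  then have "\<pi> ` S \<inter> \<pi> ` T = {}" by (auto simp: inj_on_def)
  then show ?case using prod unfolding image_Un by (intro multilin.prod) (auto simp: inj_on_Un)
next
  case (add S f g)
  then show ?case by (intro multilin.add) auto
next
  case (scale S f c)
  then show ?case by (intro multilin.scale) auto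
qed

lemma pmultilin_subst:
  assumes f: "pmultilin S f" and i: "i \<in> S" and g: "pmultilin T g" and "T \<inter> (S - {i}) = {}"
  shows "pmultilin ((S - {i}) \<union> T) (\<lambda>a. f (a(i := g a)))"
  using f i assms(4)
proof (induction rule: multilin.induct)
  case (var \<phi> j)
  then show ?case using g by simp
next
  case (prod S1 f1 S2 f2)
  show ?case
  proof (cases "i \<in> S1")
    case True
    then have n: "i \<notin> S2" using prod.hyps by auto
    have e: "f2 (a(i := g a)) = f2 a" for a by (rule multilin_upd[OF prod.hyps(2) n])
    have "pmultilin (((S1 - {i}) \<union> T) \<union> S2) (\<lambda>a. mul (f1 (a(i := g a))) (f2 a))"
    proof (rule multilin.prod[OF prod.IH(1)[OF True] prod.hyps(2)])
      show "T \<inter> (S1 - {i}) = {}" "(S1 - {i} \<union> T) \<inter> S2 = {}"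
        using prod.prems(2) prod.hyps(3) n by blast+
    qed
    moreover have "((S1 - {i}) \<union> T) \<union> S2 = (S1 \<union> S2 - {i}) \<union> T" using n by auto
    ultimately show ?thesis unfolding e by (simp only:)
  next
    case False
    then have n: "i \<in> S2" using prod.prems by auto
    have e: "f1 (a(i := g a)) = f1 a" for a by (rule multilin_upd[OF prod.hyps(1) False])
    have "pmultilin (S1 \<union> ((S2 - {i}) \<union> T)) (\<lambda>a. mul (f1 a) (f2 (a(i := g a))))"
    proof (rule multilin.prod[OF prod.hyps(1) prod.IH(2)[OF n]])
      show "T \<inter> (S2 - {i}) = {}" "S1 \<inter> (S2 - {i} \<union> T) = {}"
        using prod.prems(2) prod.hyps(3) False by blast+
    qed
    moreover have "S1 \<union> ((S2 - {i}) \<union> T) = (S1 \<union> S2 - {i}) \<union> T" using False by auto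
    ultimately show ?thesis unfolding e by (simp only:)
  qed
next
  case (add S f1 f2)
  then show ?case by (intro multilin.add) auto
next
  case (scale S f c)
  then show ?case by (intro multilin.scale) auto
qed

section \<open>Alternating functions\<close>

definition alternating :: "nat \<Rightarrow> ((nat \<Rightarrow> 'a) \<Rightarrow> 'a) \<Rightarrow> bool" where
  "alternating k f \<longleftrightarrow> (\<forall>a i j. i < k \<longrightarrow> j < k \<longrightarrow> i \<noteq> j \<longrightarrow> a i = a j \<longrightarrow> f a = 0)"

lemma alternatingD: "alternating k f \<Longrightarrow> i < k \<Longrightarrow> j < k \<Longrightarrow> i \<noteq> j \<Longrightarrow> a i = a j \<Longrightarrow> f a = 0"
  unfolding alternating_def by blast

lemma alternating_swap:
  assumes alt: "alternating k f" and ml: "pmultilin S f" and ij: "i < k" "j < k" "i \<noteq> j" "i \<in> S" "j \<in> S"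
  shows "f (a(i := u, j := v)) = - f (a(i := v, j := u))"
proof -
  have li: "lin (\<lambda>x. f (b(i := x)))" and lj: "lin (\<lambda>x. f (b(j := x)))" for b
    using pmultilin_lin[OF ml] ij by auto
  have tw: "b(i := x, j := y) = b(j := y, i := x)" for b x y using ij by (simp add: fun_upd_twist)
  have z: "f (a(i := x, j := x)) = 0" for x
    by (rule alternatingD[OF alt ij(1,2,3)]) (use ij in simp)
  have 1: "f (a(i := x, j := u + v)) = f (a(i := x, j := u)) + f (a(i := x, j := v))" for x
    by (rule lin_add[OF lj])
  have 2: "f (a(i := u + v, j := y)) = f (a(i := u, j := y)) + f (a(i := v, j := y))" for y
    unfolding tw by (rule lin_add[OF li])
  have "f (a(i := u + v, j := u + v)) = 0" by (rule z)
  then have "f (a(i := u, j := v)) + f (a(i := v, j := u)) = 0"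
    unfolding 1 2 by (simp add: z add.commute)
  then show ?thesis by (rule eq_neg_iff_add_eq_0[THEN iffD2])
qed

text \<open>
  Applying an operator to one alternating variable after the other and adding up preserves
  alternation: if \<open>a i = a j\<close>, only the terms \<open>i\<close> and \<open>j\<close> survive, and they cancel.
\<close>
lemma alternating_sum_upd:
  assumes alt: "alternating k f" and ml: "pmultilin S f" and S: "{..<k} \<subseteq> S"
    and ij: "i < k" "j < k" "i \<noteq> j" and a: "a i = a j"
  shows "(\<Sum>l<k. f (a(l := g (a l)))) = 0"
proof -
  have zero: "f (a(l := g (a l))) = 0" if "l < k" "l \<noteq> i" "l \<noteq> j" for l
    by (rule alternatingD[OF alt ij]) (use that a in simp)
  have "(\<Sum>l<k. f (a(l := g (a l)))) = (\<Sum>l\<in>{i, j}. f (a(l := g (a l))))"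
    using ij zero by (intro sum.mono_neutral_right) auto
  also have "\<dots> = f (a(i := g (a i))) + f (a(j := g (a j)))"
    by (subst sum.insert) (use ij(3) in simp_all)
  finally have 1: "(\<Sum>l<k. f (a(l := g (a l)))) = f (a(i := g (a i))) + f (a(j := g (a j)))" .
  have e: "a(i := g (a i)) = a(i := g (a i), j := a i)" "a(j := g (a j)) = a(i := a i, j := g (a i))"
    using ij(3) a by (intro ext; simp)+
  have "f (a(i := g (a i))) = f (a(i := g (a i), j := a i))" by (rule arg_cong[OF e(1)])
  also have "\<dots> = - f (a(i := a i, j := g (a i)))"
    by (rule alternating_swap[OF alt ml ij]) (use ij S in auto)
  also have "f (a(i := a i, j := g (a i))) = f (a(j := g (a j)))" by (rule arg_cong[OF e(2)[symmetric]])
  finally have "f (a(i := g (a i))) = - f (a(j := g (a j)))" .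
  then show ?thesis using 1 by (simp only: left_minus)
qed

end

locale enumerated_algebra = assoc_or_lie_algebra scale Basis mul
  for scale :: "'f::{alg_closed_field, field_char_0} \<Rightarrow> 'a::ab_group_add \<Rightarrow> 'a" and Basis and mul +
  fixes bs :: "nat \<Rightarrow> 'a"
  assumes bs: "bij_betw bs {..<card Basis} Basis"
begin

abbreviation d where "d \<equiv> card Basis"

lemma bs_sum: "(\<Sum>i<d. h (bs i)) = (\<Sum>b\<in>Basis. h b)"
  by (rule sum.reindex_bij_betw[OF bs])

text \<open>
  Expand \<open>B b\<^sub>i\<close> in the basis: the component along \<open>b\<^sub>j\<close> with \<open>j \<noteq> i\<close> repeats an argument, so only the
  diagonal entries of \<open>B\<close> contribute.
\<close>
lemma alternating_trace:
  assumes alt: "alternating d f" and ml: "pmultilin S f" and S: "{..<d} \<subseteq> S"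
    and a: "\<And>i. i < d \<Longrightarrow> a i = bs i" and B: "lin B"
  shows "(\<Sum>i<d. f (a(i := B (a i)))) = scale (tr B) (f a)"
proof -
  have "f (a(i := B (a i))) = scale (representation Basis (B (bs i)) (bs i)) (f a)" if i: "i < d" for i
  proof -
    have l: "lin (\<lambda>v. f (a(i := v)))" using pmultilin_lin[OF ml] i S by auto
    let ?r = "representation Basis (B (bs i))"
    have "B (a i) = (\<Sum>j<d. scale (?r (bs j)) (bs j))"
      using span_rep_sum[OF basis_UNIV, of "B (bs i)"] bs_sum[of "\<lambda>b. scale (?r b) b"] a[OF i] by simp
    then have "f (a(i := B (a i))) = (\<Sum>j<d. scale (?r (bs j)) (f (a(i := bs j))))"
      by (simp add: lin_sum[OF l] lin_scale[OF l])
    also have "\<dots> = (\<Sum>j<d. if j = i then scale (?r (bs i)) (f a) else 0)"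
    proof (rule sum.cong[OF refl])
      fix j assume "j \<in> {..<d}"
      then have j: "j < d" by simp
      show "scale (?r (bs j)) (f (a(i := bs j))) = (if j = i then scale (?r (bs i)) (f a) else 0)"
      proof (cases "j = i")
        case True
        have "a(i := bs i) = a" using a[OF i] by auto
        then show ?thesis using True by simp
      next
        case False
        have "f (a(i := bs j)) = 0"
          by (rule alternatingD[OF alt i j]) (use False a[OF j] in auto)
        then show ?thesis using False by simp
      qed
    qed
    also have "\<dots> = scale (?r (bs i)) (f a)" using i by (simp add: sum.delta)
    finally show ?thesis .
  qed
  then have "(\<Sum>i<d. f (a(i := B (a i)))) = (\<Sum>i<d. scale (representation Basis (B (bs i)) (bs i)) (f a))"
    by simp
  also have "\<dots> = scale (\<Sum>i<d. representation Basis (B (bs i)) (bs i)) (f a)"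
    by (simp add: scale_sum_left)
  also have "(\<Sum>i<d. representation Basis (B (bs i)) (bs i)) = tr B"
    unfolding trace_on_def by (rule bs_sum)
  finally show ?thesis .
qed

text \<open>
  By the trace formula this multiplies \<open>f\<close> by the trace form of the variables \<open>z\<close> and \<open>w\<close> as long as
  the variables below \<open>d\<close> carry the basis.
\<close>
definition form_step :: "nat \<Rightarrow> nat \<Rightarrow> ((nat \<Rightarrow> 'a) \<Rightarrow> 'a) \<Rightarrow> ((nat \<Rightarrow> 'a) \<Rightarrow> 'a)" where
  "form_step z w f = (\<lambda>a. \<Sum>i<d. f (a(i := mul (a z) (mul (a w) (a i)))))"

text \<open>The variables below \<open>d\<close> are reserved for the basis.\<close>
definition alt_multilin :: "nat set \<Rightarrow> ((nat \<Rightarrow> 'a) \<Rightarrow> 'a) \<Rightarrow> bool" where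
  "alt_multilin S f \<longleftrightarrow> pmultilin S f \<and> alternating d f \<and> {..<d} \<subseteq> S"

lemma alt_multilin_form_step:
  assumes f: "alt_multilin S f" and zw: "z \<notin> S" "w \<notin> S" "z \<noteq> w" and d0: "d > 0"
  shows "alt_multilin (S \<union> {z, w}) (form_step z w f)"
proof -
  have ml: "pmultilin S f" and alt: "alternating d f" and S: "{..<d} \<subseteq> S" using f by (auto simp: alt_multilin_def)
  have "pmultilin (S \<union> {z, w}) (\<lambda>a. f (a(i := mul (a z) (mul (a w) (a i)))))" if i: "i < d" for i
  proof -
    have iS: "i \<in> S" using i S by auto
    have "pmultilin ({z} \<union> ({w} \<union> {i})) (\<lambda>a. mul (a z) (mul (a w) (a i)))"
      using zw iS by (intro multilin.prod pmultilin_var) auto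
    from pmultilin_subst[OF ml iS this]
    have "pmultilin (S - {i} \<union> ({z} \<union> ({w} \<union> {i}))) (\<lambda>a. f (a(i := mul (a z) (mul (a w) (a i)))))"
      using zw by auto
    moreover have "S - {i} \<union> ({z} \<union> ({w} \<union> {i})) = S \<union> {z, w}" using iS by auto
    ultimately show ?thesis by simp
  qed
  then have "pmultilin (S \<union> {z, w}) (form_step z w f)"
    unfolding form_step_def using d0 by (intro multilin_sum) auto
  moreover have "alternating d (form_step z w f)"
    unfolding alternating_def form_step_def
  proof (intro allI impI)
    fix a :: "nat \<Rightarrow> 'a" and i j assume "i < d" "j < d" "i \<noteq> j" "a i = a j"
    then show "(\<Sum>i<d. f (a(i := mul (a z) (mul (a w) (a i))))) = 0"
      by (rule alternating_sum_upd[OF alt ml S, where g = "\<lambda>v. mul (a z) (mul (a w) v)"])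
  qed
  ultimately show ?thesis using S by (auto simp: alt_multilin_def)
qed

lemma form_step_value:
  assumes f: "alt_multilin S f" and a: "\<And>i. i < d \<Longrightarrow> a i = bs i"
  shows "form_step z w f a = scale (form (a z) (a w)) (f a)"
  unfolding form_step_def form_def
  by (rule alternating_trace[OF _ _ _ a])
     (use f in \<open>auto simp: alt_multilin_def intro: lin_comp[OF lin_mul lin_mul]\<close>)

primrec form_steps :: "nat \<Rightarrow> (nat \<Rightarrow> nat) \<Rightarrow> (nat \<Rightarrow> nat) \<Rightarrow> ((nat \<Rightarrow> 'a) \<Rightarrow> 'a) \<Rightarrow> ((nat \<Rightarrow> 'a) \<Rightarrow> 'a)" where
  "form_steps 0 z w f = f"
| "form_steps (Suc k) z w f = form_step (z k) (w k) (form_steps k z w f)"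

lemma alt_multilin_form_steps:
  assumes "alt_multilin S f" "inj_on z {..<k}" "inj_on w {..<k}" "z ` {..<k} \<inter> w ` {..<k} = {}"
    "(z ` {..<k} \<union> w ` {..<k}) \<inter> S = {}" "d > 0"
  shows "alt_multilin (S \<union> z ` {..<k} \<union> w ` {..<k}) (form_steps k z w f) \<and>
    (\<forall>a. (\<forall>i<d. a i = bs i) \<longrightarrow> form_steps k z w f a = scale (\<Prod>i<k. form (a (z i)) (a (w i))) (f a))"
  using assms
proof (induction k)
  case (Suc k)
  let ?S = "S \<union> z ` {..<k} \<union> w ` {..<k}"
  have IH: "alt_multilin ?S (form_steps k z w f)"
    "\<And>a. (\<forall>i<d. a i = bs i) \<Longrightarrow> form_steps k z w f a = scale (\<Prod>i<k. form (a (z i)) (a (w i))) (f a)"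
    using Suc by (auto simp: lessThan_Suc)
  have "z k \<notin> ?S" "w k \<notin> ?S" "z k \<noteq> w k" using Suc.prems by (auto simp: lessThan_Suc)
  note g = alt_multilin_form_step[OF IH(1) this \<open>d > 0\<close>]
  have "?S \<union> {z k, w k} = S \<union> z ` {..<Suc k} \<union> w ` {..<Suc k}" by (auto simp: lessThan_Suc)
  then have "alt_multilin (S \<union> z ` {..<Suc k} \<union> w ` {..<Suc k}) (form_steps (Suc k) z w f)" using g by simp
  moreover have "form_steps (Suc k) z w f a = scale (\<Prod>i<Suc k. form (a (z i)) (a (w i))) (f a)"
    if a: "\<forall>i<d. a i = bs i" for a
    using form_step_value[OF IH(1), of a "z k" "w k"] a IH(2)[OF a] by (simp add: mult.commute)
  ultimately show ?case by blast
qed simp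

end

section \<open>Lattice words\<close>

definition positions :: "nat list \<Rightarrow> nat \<Rightarrow> nat list" where
  "positions w j = filter (\<lambda>p. w ! p = j) [0..<length w]"

text \<open>The position of the \<open>i\<close>-th letter \<open>j\<close>, counted from \<open>0\<close>.\<close>
definition occ :: "nat list \<Rightarrow> nat \<Rightarrow> nat \<Rightarrow> nat" where
  "occ w j i = positions w j ! i"

lemma length_positions: "length (positions w j) = count_list w j"
proof -
  have "count_list w j = length (filter (\<lambda>x. x = j) (map ((!) w) [0..<length w]))"
    unfolding map_nth count_list_eq_length_filter by (metis (mono_tags, lifting) filter_cong)
  then show ?thesis by (simp add: positions_def filter_map comp_def)
qed

lemma positions_take:
  assumes "k \<le> length w"
  shows "positions w j = positions (take k w) j @ filter (\<lambda>p. w ! p = j) [k..<length w]"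
proof -
  have "[0..<length w] = [0..<k] @ [k..<length w]" using assms
    by (metis le_add_diff_inverse upt_add_eq_append zero_le)
  then have "positions w j = filter (\<lambda>p. w ! p = j) [0..<k] @ filter (\<lambda>p. w ! p = j) [k..<length w]"
    unfolding positions_def by simp
  moreover have "filter (\<lambda>p. w ! p = j) [0..<k] = positions (take k w) j"
    unfolding positions_def using assms by (intro filter_cong) auto
  ultimately show ?thesis by simp
qed

lemma occ_props:
  assumes "i < count_list w j"
  shows "occ w j i < length w" "w ! occ w j i = j"
proof -
  have "occ w j i \<in> set (positions w j)"
    unfolding occ_def using assms by (intro nth_mem) (simp add: length_positions)
  then show "occ w j i < length w" "w ! occ w j i = j" by (auto simp: positions_def)
qed

lemma occ_less_iff:
  assumes i: "i < count_list w j" and k: "k \<le> length w"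
  shows "occ w j i < k \<longleftrightarrow> i < count_list (take k w) j"
proof (cases "i < count_list (take k w) j")
  case True
  have "occ w j i = occ (take k w) j i"
    unfolding occ_def positions_take[OF k] using True by (simp add: nth_append length_positions)
  also have "\<dots> < length (take k w)" by (rule occ_props[OF True])
  finally show ?thesis using True k by simp
next
  case False
  let ?r = "filter (\<lambda>p. w ! p = j) [k..<length w]"
  have "occ w j i = ?r ! (i - count_list (take k w) j)"
    unfolding occ_def positions_take[OF k] using False by (simp add: nth_append length_positions)
  moreover have "i - count_list (take k w) j < length ?r"
    using i False length_positions[of w j] unfolding positions_take[OF k]
    by (simp add: length_positions)
  ultimately have "occ w j i \<in> set ?r" by (metis nth_mem)
  then show ?thesis using False by auto
qed

lemma occ_surj:
  assumes "p < length w"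
  shows "\<exists>i<count_list w (w ! p). occ w (w ! p) i = p"
proof -
  have "p \<in> set (positions w (w ! p))" using assms by (simp add: positions_def)
  then show ?thesis unfolding occ_def by (metis in_set_conv_nth length_positions)
qed

lemma occ_inj:
  assumes "i < count_list w j" "i' < count_list w j'" "occ w j i = occ w j' i'"
  shows "j = j' \<and> i = i'"
proof -
  have j: "j = j'" using occ_props(2)[OF assms(1)] occ_props(2)[OF assms(2)] assms(3) by simp
  moreover have "distinct (positions w j)" by (simp add: positions_def)
  ultimately show ?thesis using assms unfolding occ_def
    by (metis length_positions nth_eq_iff_index_eq)
qed

text \<open>
  Lattice words (ballot sequences) encode standard Young tableaux: \<open>occ w j i\<close> is the entry in row \<open>j\<close>
  and column \<open>i\<close>. Those in \<open>lattice_words d c\<close> encode the rectangular tableaux with \<open>d\<close> rows and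
  \<open>c\<close> columns.
\<close>
definition lattice_word :: "nat \<Rightarrow> nat list \<Rightarrow> bool" where
  "lattice_word d w \<longleftrightarrow>
     (\<forall>k\<le>length w. \<forall>j. Suc j < d \<longrightarrow> count_list (take k w) (Suc j) \<le> count_list (take k w) j)"

definition lattice_words :: "nat \<Rightarrow> nat \<Rightarrow> nat list set" where
  "lattice_words d c = {w. set w \<subseteq> {..<d} \<and> (\<forall>j<d. count_list w j = c) \<and> lattice_word d w}"

lemma lattice_word_mono:
  assumes "lattice_word d w" "k \<le> length w" "j \<le> j'" "j' < d"
  shows "count_list (take k w) j' \<le> count_list (take k w) j"
  using assms(3,4)
proof (induction j' rule: dec_induct)
  case (step n)
  then have "count_list (take k w) (Suc n) \<le> count_list (take k w) n"
    using assms(1,2) unfolding lattice_word_def by blast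
  then show ?case using step by simp
qed simp

lemma lattice_words_length: "w \<in> lattice_words d c \<Longrightarrow> length w = d * c"
  using sum_count_set[of w "{..<d}"] by (simp add: lattice_words_def)

lemma finite_lattice_words: "finite (lattice_words d c)"
proof (rule finite_subset)
  show "lattice_words d c \<subseteq> {w. set w \<subseteq> {..<d} \<and> length w = d * c}"
    using lattice_words_length by (auto simp: lattice_words_def)
qed (simp add: finite_lists_length_eq)

text \<open>The columns of the tableau are increasing.\<close>
lemma lattice_words_occ:
  assumes w: "w \<in> lattice_words d c" and "j < j'" "j' < d" "i < c"
  shows "occ w j i < occ w j' i"
proof -
  have i: "i < count_list w j" "i < count_list w j'" and lat: "lattice_word d w"
    using assms by (auto simp: lattice_words_def)
  let ?k = "Suc (occ w j' i)"
  have k: "?k \<le> length w" using occ_props(1)[OF i(2)] by simp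
  have "i < count_list (take ?k w) j'" using occ_less_iff[OF i(2) k] by simp
  also have "\<dots> \<le> count_list (take ?k w) j"
    by (rule lattice_word_mono[OF lat k]) (use assms in auto)
  finally have "occ w j i < ?k" using occ_less_iff[OF i(1) k] by simp
  moreover have "occ w j i \<noteq> occ w j' i" using occ_inj[OF i] assms(2) by auto
  ultimately show ?thesis by simp
qed

text \<open>
  Let \<open>p\<close> be the first position at which \<open>w\<close> and \<open>w'\<close> differ, and let it hold the \<open>i\<close>-th letter \<open>j\<close> of \<open>w\<close>.
  For a smaller letter \<open>j'\<close>, the \<open>i\<close>-th \<open>j'\<close> of \<open>w\<close> lies to the left of \<open>p\<close>, where \<open>w'\<close> agrees
  with \<open>w\<close>. As \<open>w'\<close> has distinct letters on column \<open>i\<close> of \<open>w\<close>, its letter at \<open>p\<close> cannot be \<open>j'\<close>,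
  so it is larger than \<open>j\<close>.
\<close>
lemma lattice_words_triangular:
  assumes w: "w \<in> lattice_words d c" and w': "length w' = d * c"
    and inj: "\<And>i. i < c \<Longrightarrow> inj_on (\<lambda>j. w' ! occ w j i) {..<d}"
  shows "w = w' \<or> (w, w') \<in> lexn less_than (d * c)"
proof (rule disjCI)
  assume "\<not> (w, w') \<in> lexn less_than (d * c)"
  show "w = w'"
  proof (rule ccontr)
    assume "w \<noteq> w'"
    have lw: "length w = d * c" by (rule lattice_words_length[OF w])
    then have ex: "\<exists>p. p < d * c \<and> w ! p \<noteq> w' ! p" using \<open>w \<noteq> w'\<close> w' by (metis nth_equalityI)
    define p where "p = (LEAST p. p < d * c \<and> w ! p \<noteq> w' ! p)"
    have p: "p < d * c" "w ! p \<noteq> w' ! p" using LeastI_ex[OF ex] by (auto simp: p_def)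
    have below: "w ! q = w' ! q" if "q < p" for q
      using not_less_Least[of q "\<lambda>p. p < d * c \<and> w ! p \<noteq> w' ! p"] that p by (auto simp: p_def)
    define j where "j = w ! p"
    have jd: "j < d" using w p lw unfolding lattice_words_def j_def by (metis (mono_tags, lifting) lessThan_iff mem_Collect_eq nth_mem subsetD)
    obtain i where i: "i < count_list w j" "occ w j i = p" using occ_surj[of p w] p lw j_def by auto
    have ic: "i < c" using i jd w by (auto simp: lattice_words_def)
    have "\<not> w' ! p < j"
    proof
      assume lt: "w' ! p < j"
      let ?j = "w' ! p"
      have "i < count_list w ?j" using ic lt jd w by (auto simp: lattice_words_def)
      moreover have "occ w ?j i < p" using lattice_words_occ[OF w lt jd ic] i by simp
      ultimately have "w' ! occ w ?j i = ?j" using below occ_props(2) by metis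
      then have "w' ! occ w ?j i = w' ! occ w j i" using i by simp
      then have "?j = j" using inj_onD[OF inj[OF ic], of ?j j] lt jd by simp
      then show False using lt by simp
    qed
    then have "j < w' ! p" using p j_def by simp
    have "w = take p w @ j # drop (Suc p) w" unfolding j_def using p lw by (simp add: id_take_nth_drop)
    moreover have "w' = take p w @ (w' ! p) # drop (Suc p) w'"
    proof -
      have "take p w = take p w'" using below p lw w' by (intro nth_take_lemma) auto
      then show ?thesis using p w' by (simp add: id_take_nth_drop)
    qed
    ultimately have "(w, w') \<in> lexn less_than (d * c)"
      unfolding lexn_conv using lw w' \<open>j < w' ! p\<close> by blast
    then show False using \<open>\<not> (w, w') \<in> lexn less_than (d * c)\<close> by simp
  qed
qed

section \<open>Counting lattice words\<close>

definition balanced_words :: "nat \<Rightarrow> nat \<Rightarrow> nat list set" where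
  "balanced_words d b = {w. set w \<subseteq> {..<d} \<and> (\<forall>j<d. count_list w j = b)}"

lemma balanced_words_length: "w \<in> balanced_words d b \<Longrightarrow> length w = d * b"
  using sum_count_set[of w "{..<d}"] by (simp add: balanced_words_def)

lemma finite_balanced_words: "finite (balanced_words d b)"
proof (rule finite_subset)
  show "balanced_words d b \<subseteq> {w. set w \<subseteq> {..<d} \<and> length w = d * b}"
    using balanced_words_length by (auto simp: balanced_words_def)
qed (simp add: finite_lists_length_eq)

text \<open>The lattice condition for the continuation \<open>w\<close> of a word that contains \<open>h j\<close> letters \<open>j\<close>.\<close>
definition climbs :: "nat \<Rightarrow> (nat \<Rightarrow> nat) \<Rightarrow> nat list \<Rightarrow> bool" where
  "climbs d h w \<longleftrightarrow> (\<forall>k\<le>length w. \<forall>j. Suc j < d \<longrightarrow>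
     h (Suc j) + count_list (take k w) (Suc j) \<le> h j + count_list (take k w) j)"

lemma climbs_append:
  assumes "climbs d h u" "climbs d (\<lambda>j. h j + count_list u j) v"
  shows "climbs d h (u @ v)"
  unfolding climbs_def
proof (intro allI impI)
  fix k j assume k: "k \<le> length (u @ v)" and j: "Suc j < d"
  show "h (Suc j) + count_list (take k (u @ v)) (Suc j) \<le> h j + count_list (take k (u @ v)) j"
  proof (cases "k \<le> length u")
    case True
    then show ?thesis using assms(1) j by (simp add: climbs_def)
  next
    case False
    then have "k - length u \<le> length v" using k by simp
    from assms(2)[unfolded climbs_def, rule_format, OF this j] show ?thesis
      using False by (simp add: add.assoc)
  qed
qed

lemma count_list_take_le: "count_list (take k w) j \<le> count_list w j"
  by (metis append_take_drop_id count_list_append le_add1)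

lemma sorted_count_take:
  assumes "sorted w" "count_list (take k w) j' > 0" "j < j'"
  shows "count_list (take k w) j = count_list w j"
proof -
  have "sorted (take k w @ drop k w)" using assms(1) by simp
  moreover have "j' \<in> set (take k w)" using assms(2) by (metis count_list_0_iff less_numeral_extra(3))
  ultimately have "j \<notin> set (drop k w)" using assms(3) unfolding sorted_append by force
  then have "count_list (drop k w) j = 0" by simp
  then show ?thesis by (metis add.right_neutral append_take_drop_id count_list_append)
qed

text \<open>First \<open>m 0\<close> letters \<open>0\<close>, then \<open>m 1\<close> letters \<open>1\<close>, and so on.\<close>
definition staircase :: "nat \<Rightarrow> (nat \<Rightarrow> nat) \<Rightarrow> nat list" where
  "staircase d m = sorted_list_of_multiset (\<Sum>j<d. replicate_mset (m j) j)"

lemma staircase_count: "count_list (staircase d m) j = (if j < d then m j else 0)"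
proof -
  have "count_list (staircase d m) j = count (\<Sum>j<d. replicate_mset (m j) j) j"
    unfolding staircase_def by (metis count_mset mset_sorted_list_of_multiset)
  also have "\<dots> = (\<Sum>i<d. if i = j then m i else 0)"
    by (simp add: count_sum)
  finally show ?thesis by (simp add: sum.delta)
qed

lemma staircase_set: "set (staircase d m) \<subseteq> {..<d}"
proof
  fix j assume "j \<in> set (staircase d m)"
  then have "count_list (staircase d m) j \<noteq> 0" by (simp add: count_list_0_iff)
  then show "j \<in> {..<d}" by (simp add: staircase_count split: if_splits)
qed

lemma sorted_staircase: "sorted (staircase d m)"
  by (simp add: staircase_def)

lemma climbs_staircase:
  assumes "\<And>j. Suc j < d \<Longrightarrow> h (Suc j) \<le> h j" "\<And>j. Suc j < d \<Longrightarrow> h (Suc j) + m (Suc j) \<le> h j + m j"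
  shows "climbs d h (staircase d m)"
  unfolding climbs_def
proof (intro allI impI)
  fix k j assume j: "Suc j < d"
  let ?t = "take k (staircase d m)"
  show "h (Suc j) + count_list ?t (Suc j) \<le> h j + count_list ?t j"
  proof (cases "count_list ?t (Suc j) = 0")
    case True
    then show ?thesis using assms(1)[OF j] by simp
  next
    case False
    then have "count_list ?t j = m j"
      using sorted_count_take[OF sorted_staircase, of k d m "Suc j" j] j by (simp add: staircase_count)
    moreover have "count_list ?t (Suc j) \<le> m (Suc j)"
      using count_list_take_le[of k "staircase d m" "Suc j"] j by (simp add: staircase_count)
    ultimately show ?thesis using assms(2)[OF j] by simp
  qed
qed

lemma count_concat_balanced:
  "set bl \<subseteq> balanced_words d b \<Longrightarrow> j < d \<Longrightarrow> count_list (concat bl) j = length bl * b"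
  by (induction bl) (auto simp: balanced_words_def)

text \<open>
  A lead of \<open>b\<close> of each letter over the next one absorbs every prefix of a block with \<open>b\<close> copies of each
  letter, and is restored at the end of the block.
\<close>
lemma climbs_concat_balanced:
  assumes "set bl \<subseteq> balanced_words d b" "\<And>j. Suc j < d \<Longrightarrow> h (Suc j) + b \<le> h j"
  shows "climbs d h (concat bl)"
  using assms
proof (induction bl arbitrary: h)
  case Nil
  then show ?case by (auto simp: climbs_def dest: add_leD1)
next
  case (Cons w bl)
  have w: "count_list w j = b" if "j < d" for j using Cons.prems(1) that by (auto simp: balanced_words_def)
  have "climbs d h w"
    unfolding climbs_def
  proof (intro allI impI)
    fix k j assume j: "Suc j < d"
    have "count_list (take k w) (Suc j) \<le> b" using count_list_take_le[of k w "Suc j"] w[OF j] by simp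
    then show "h (Suc j) + count_list (take k w) (Suc j) \<le> h j + count_list (take k w) j"
      using Cons.prems(2)[OF j] by simp
  qed
  moreover have "climbs d (\<lambda>j. h j + count_list w j) (concat bl)"
    by (rule Cons.IH) (use Cons.prems w in auto)
  ultimately show ?case using climbs_append by simp
qed

text \<open>
  A sorted prefix with \<open>(d - 1 - j) b\<close> letters \<open>j\<close> gives each letter a lead of \<open>b\<close> over the next one.
  Then \<open>T\<close> arbitrary balanced blocks may follow, and a sorted suffix with \<open>j b\<close> letters \<open>j\<close> equalizes the
  counts.
\<close>
lemma card_lattice_words_ge:
  "card (balanced_words d b) ^ T \<le> card (lattice_words d ((d - 1) * b + T * b))"
proof -
  let ?u = "staircase d (\<lambda>j. (d - 1 - j) * b)" and ?v = "staircase d (\<lambda>j. j * b)"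
  let ?BL = "{bl. set bl \<subseteq> balanced_words d b \<and> length bl = T}"
  let ?f = "\<lambda>bl. ?u @ concat bl @ ?v"
  have inj: "inj_on ?f ?BL"
  proof (rule inj_onI)
    fix x y assume x: "x \<in> ?BL" and y: "y \<in> ?BL" and e: "?f x = ?f y"
    then have "concat x = concat y" by simp
    moreover have "\<forall>(p, q)\<in>set (zip x y). length p = length q"
    proof clarify
      fix p q assume pq: "(p, q) \<in> set (zip x y)"
      have "set x \<subseteq> balanced_words d b" "set y \<subseteq> balanced_words d b" using x y by simp_all
      then have "p \<in> balanced_words d b" "q \<in> balanced_words d b"
        using set_zip_leftD[OF pq] set_zip_rightD[OF pq] by auto
      then show "length p = length q" by (simp add: balanced_words_length)
    qed
    ultimately show "x = y" using x y concat_eq_concat_iff[of x y] by simp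
  qed
  have sub: "?f ` ?BL \<subseteq> lattice_words d ((d - 1) * b + T * b)"
  proof
    fix w assume "w \<in> ?f ` ?BL"
    then obtain bl where bl: "set bl \<subseteq> balanced_words d b" "length bl = T" "w = ?f bl" by blast
    have "set (concat bl) \<subseteq> {..<d}" using bl(1) by (fastforce simp: balanced_words_def)
    then have "set w \<subseteq> {..<d}"
      unfolding bl(3) set_append by (intro Un_least staircase_set)
    moreover have "count_list w j = (d - 1) * b + T * b" if "j < d" for j
    proof -
      have "(d - 1 - j) * b + j * b = (d - 1) * b" using that by (simp add: add_mult_distrib[symmetric])
      then show ?thesis using that bl by (simp add: staircase_count count_concat_balanced)
    qed
    moreover have "lattice_word d w"
    proof -
      have "climbs d (\<lambda>_. 0) ?u"
        by (rule climbs_staircase) auto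
      moreover have "climbs d (\<lambda>j. 0 + count_list ?u j) (concat bl)"
      proof (rule climbs_concat_balanced[OF bl(1)])
        fix j assume "Suc j < d"
        then have "d - 1 - j = Suc (d - 1 - Suc j)" by simp
        then show "0 + count_list ?u (Suc j) + b \<le> 0 + count_list ?u j"
          using \<open>Suc j < d\<close> by (simp add: staircase_count)
      qed
      moreover have "climbs d (\<lambda>j. 0 + count_list ?u j + count_list (concat bl) j) ?v"
      proof (rule climbs_staircase)
        fix j assume "Suc j < d"
        then have "d - 1 - j = Suc (d - 1 - Suc j)" by simp
        then show "0 + count_list ?u (Suc j) + count_list (concat bl) (Suc j) \<le> 0 + count_list ?u j + count_list (concat bl) j"
          "0 + count_list ?u (Suc j) + count_list (concat bl) (Suc j) + Suc j * b
            \<le> 0 + count_list ?u j + count_list (concat bl) j + j * b"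
          using \<open>Suc j < d\<close> bl by (simp_all add: staircase_count count_concat_balanced)
      qed
      ultimately have "climbs d (\<lambda>_. 0) w"
        unfolding bl(3) by (intro climbs_append) auto
      then show ?thesis by (simp add: climbs_def lattice_word_def)
    qed
    ultimately show "w \<in> lattice_words d ((d - 1) * b + T * b)" by (auto simp: lattice_words_def)
  qed
  have "card (balanced_words d b) ^ T = card ?BL"
    by (rule card_lists_length_eq[OF finite_balanced_words, symmetric])
  also have "\<dots> = card (?f ` ?BL)" by (rule card_image[OF inj, symmetric])
  also have "\<dots> \<le> card (lattice_words d ((d - 1) * b + T * b))"
    by (rule card_mono[OF finite_lattice_words sub])
  finally show ?thesis .
qed

text \<open>The quotient \<open>c! / b\<^sup>c\<close> is least at \<open>c = b\<close>, since increasing \<open>c\<close> by one multiplies it by \<open>(c + 1) / b\<close>.\<close>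
lemma fact_power_le: "fact b * b ^ c \<le> fact c * (b ^ b :: nat)"
proof (cases "b \<le> c")
  case True
  then show ?thesis
  proof (induction c rule: dec_induct)
    case (step n)
    have "fact b * b ^ Suc n = b * (fact b * b ^ n)" by simp
    also have "\<dots> \<le> Suc n * (fact n * b ^ b)" by (rule mult_le_mono[OF _ step.IH]) (use step.hyps in simp)
    finally show ?case by (simp add: algebra_simps)
  qed simp
next
  case False
  then have "c \<le> b" by simp
  then show ?thesis
  proof (induction c rule: inc_induct)
    case (step n)
    have "b * (fact b * b ^ n) = fact b * b ^ Suc n" by simp
    also have "\<dots> \<le> fact (Suc n) * b ^ b" by (rule step.IH)
    also have "\<dots> = Suc n * (fact n * b ^ b)" by (simp add: algebra_simps)
    also have "\<dots> \<le> b * (fact n * b ^ b)" by (rule mult_le_mono1) (use step.hyps in simp)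
    finally show ?case using step.hyps by simp
  qed simp
qed

text \<open>Among the multinomial coefficients of given degree, the one with equal parts is largest.\<close>
lemma prod_fact_ge:
  assumes "(\<Sum>j<d. m j) = d * b"
  shows "(fact b :: nat) ^ d \<le> (\<Prod>j<d. fact (m j))"
proof (cases "b = 0")
  case False
  have "(\<Prod>j<d. fact b * b ^ m j) \<le> (\<Prod>j<d. fact (m j) * (b ^ b :: nat))"
    by (intro prod_mono conjI fact_power_le) auto
  moreover have "(\<Prod>j<d. fact b * b ^ m j) = (fact b :: nat) ^ d * b ^ (d * b)"
    by (simp only: prod.distrib prod_constant card_lessThan power_sum[symmetric] assms)
  moreover have "(\<Prod>j<d. fact (m j) * (b ^ b :: nat)) = (\<Prod>j<d. fact (m j)) * b ^ (d * b)"
    by (simp only: prod.distrib prod_constant card_lessThan power_mult[symmetric] mult.commute[of b d])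
  ultimately have "(fact b :: nat) ^ d * b ^ (d * b) \<le> (\<Prod>j<d. fact (m j)) * b ^ (d * b)" by simp
  moreover have "0 < b ^ (d * b)" using False by simp
  ultimately show ?thesis by (simp only: mult_le_cancel2)
next
  case True
  have "(1 :: nat) \<le> (\<Prod>j<d. fact (m j))" by (rule prod_ge_1) (rule fact_ge_1)
  then show ?thesis using True by simp
qed

text \<open>
  The words of length \<open>d b\<close> have at most \<open>(d b + 1)\<^sup>d\<close> different contents, and the
  balanced content is that of the most words.
\<close>
lemma card_balanced_words_ge: "d ^ (d * b) \<le> (d * b + 1) ^ d * card (balanced_words d b)"
proof -
  let ?L = "{w. set w \<subseteq> {..<d} \<and> length w = d * b}"
  have finL: "finite ?L" by (simp add: finite_lists_length_eq)
  have bal: "card (balanced_words d b) = fact (d * b) div fact b ^ d"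
  proof -
    let ?A = "\<Sum>j<d. replicate_mset b j"
    have cnt: "count ?A j = (if j < d then b else 0)" for j
      by (simp add: count_sum sum.delta)
    have "balanced_words d b = permutations_of_multiset ?A"
    proof (intro Set.set_eqI iffI)
      fix w assume w: "w \<in> balanced_words d b"
      have "count (mset w) j = count ?A j" for j
        using w unfolding cnt by (auto simp: balanced_words_def count_mset count_list_0_iff)
      then show "w \<in> permutations_of_multiset ?A"
        by (simp add: permutations_of_multiset_def multiset_eq_iff)
    next
      fix w assume "w \<in> permutations_of_multiset ?A"
      then have c: "count_list w j = (if j < d then b else 0)" for j
        by (metis cnt count_mset permutations_of_multisetD)
      then have "j < d" if "j \<in> set w" for j using that by (metis count_list_0_iff)
      then show "w \<in> balanced_words d b" using c by (auto simp: balanced_words_def)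
    qed
    moreover have "size ?A = d * b" by (simp add: size_multiset_sum)
    moreover have "(\<Prod>x\<in>set_mset ?A. fact (count ?A x)) = (fact b :: nat) ^ d"
    proof -
      have "(\<Prod>x\<in>set_mset ?A. fact (count ?A x)) = (\<Prod>x<d. fact (count ?A x) :: nat)"
        by (rule prod.mono_neutral_left) (auto simp: cnt not_in_iff simp flip: count_greater_zero_iff split: if_splits)
      also have "\<dots> = fact b ^ d" by (simp add: cnt)
      finally show ?thesis .
    qed
    ultimately show ?thesis by (simp add: card_permutations_of_multiset)
  qed
  have fibre: "card {w \<in> ?L. mset w = A} \<le> card (balanced_words d b)" if A: "A \<in> mset ` ?L" for A
  proof -
    have sA: "size A = d * b" "set_mset A \<subseteq> {..<d}" using A by auto
    have "(\<Sum>j<d. count A j) = d * b"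
      using sA sum.mono_neutral_left[of "{..<d}" "set_mset A" "count A"]
      by (simp add: size_multiset_overloaded_eq not_in_iff)
    then have "fact b ^ d \<le> (\<Prod>j<d. fact (count A j) :: nat)" by (rule prod_fact_ge)
    also have "\<dots> = (\<Prod>x\<in>set_mset A. fact (count A x))"
      by (rule prod.mono_neutral_right) (use sA in \<open>auto simp: not_in_iff\<close>)
    finally have le: "fact b ^ d \<le> (\<Prod>x\<in>set_mset A. fact (count A x) :: nat)" .
    have "card {w \<in> ?L. mset w = A} \<le> card (permutations_of_multiset A)"
      by (rule card_mono[OF finite_permutations_of_multiset]) (auto simp: permutations_of_multiset_def)
    also have "\<dots> = fact (d * b) div (\<Prod>x\<in>set_mset A. fact (count A x))"
      using sA by (simp add: card_permutations_of_multiset)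
    also have "\<dots> \<le> fact (d * b) div fact b ^ d"
      using le by (intro div_le_mono2) auto
    finally show ?thesis using bal by simp
  qed
  have msets: "card (mset ` ?L) \<le> (d * b + 1) ^ d"
  proof -
    let ?g = "\<lambda>A. restrict (count A) {..<d}"
    have "inj_on ?g (mset ` ?L)"
    proof (rule inj_onI)
      fix A B assume A: "A \<in> mset ` ?L" and B: "B \<in> mset ` ?L" and e: "?g A = ?g B"
      have "count A x = count B x" for x
      proof (cases "x < d")
        case True
        then show ?thesis using fun_cong[OF e, of x] by simp
      next
        case False
        then have "x \<notin># A" "x \<notin># B" using A B by auto
        then show ?thesis by (simp add: not_in_iff)
      qed
      then show "A = B" by (simp add: multiset_eq_iff)
    qed
    then have "card (mset ` ?L) = card (?g ` mset ` ?L)" by (simp add: card_image)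
    also have "\<dots> \<le> card (PiE {..<d} (\<lambda>_. {..d * b}))"
    proof (rule card_mono)
      show "?g ` mset ` ?L \<subseteq> PiE {..<d} (\<lambda>_. {..d * b})"
      proof (intro image_subsetI PiE_I)
        fix A j assume "A \<in> mset ` ?L"
        then have "size A = d * b" by auto
        then show "restrict (count A) {..<d} j \<in> {..d * b}" if "j \<in> {..<d}"
          using that count_le_size[of A j] by simp
      qed auto
    qed (auto intro: finite_PiE)
    also have "\<dots> = (d * b + 1) ^ d" by (simp add: card_PiE)
    finally show ?thesis .
  qed
  have "d ^ (d * b) = card ?L" by (simp add: card_lists_length_eq)
  also have "?L = (\<Union>A\<in>mset ` ?L. {w \<in> ?L. mset w = A})" by blast
  also have "card \<dots> \<le> (\<Sum>A\<in>mset ` ?L. card {w \<in> ?L. mset w = A})"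
    using finL by (intro card_UN_le) auto
  also have "\<dots> \<le> (\<Sum>A\<in>mset ` ?L. card (balanced_words d b))" by (intro sum_mono fibre)
  also have "\<dots> \<le> (d * b + 1) ^ d * card (balanced_words d b)" using msets by simp
  finally show ?thesis .
qed

context assoc_or_lie_algebra
begin

section \<open>Words in multiplications\<close>

text \<open>\<open>True\<close> stands for left and \<open>False\<close> for right multiplication.\<close>
primrec mult_word :: "(bool \<times> 'a) list \<Rightarrow> 'a \<Rightarrow> 'a" where
  "mult_word [] v = v"
| "mult_word (p # ws) v = (if fst p then mul (snd p) (mult_word ws v) else mul (mult_word ws v) (snd p))"

lemma mult_word_append: "mult_word (ws @ us) v = mult_word ws (mult_word us v)"
  by (induction ws) auto

lemma mult_word_add: "mult_word ws (u + v) = mult_word ws u + mult_word ws v"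
  by (induction ws) (auto simp: mul_simps)

lemma mult_word_scale: "mult_word ws (scale c v) = scale c (mult_word ws v)"
  by (induction ws) (auto simp: mul_simps)

lemma mult_word_zero [simp]: "mult_word ws 0 = 0"
  by (induction ws) (auto simp: mul_simps)

lemma pmultilin_mult_word:
  "pmultilin S f \<Longrightarrow> distinct (map snd vs) \<Longrightarrow> snd ` set vs \<inter> S = {} \<Longrightarrow>
    pmultilin (snd ` set vs \<union> S) (\<lambda>a. mult_word (map (\<lambda>p. (fst p, a (snd p))) vs) (f a))"
proof (induction vs)
  case (Cons p vs)
  obtain l j where p: "p = (l, j)" by (cases p)
  have IH: "pmultilin (snd ` set vs \<union> S) (\<lambda>a. mult_word (map (\<lambda>p. (fst p, a (snd p))) vs) (f a))"
    using Cons by auto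
  have dj: "{j} \<inter> (snd ` set vs \<union> S) = {}" using Cons.prems p by auto
  have e: "snd ` set (p # vs) \<union> S = {j} \<union> (snd ` set vs \<union> S)" using p by auto
  show ?case
  proof (cases l)
    case True
    then show ?thesis unfolding e using multilin.prod[OF pmultilin_var IH dj] p by simp
  next
    case False
    have "(snd ` set vs \<union> S) \<inter> {j} = {}" using dj by blast
    from multilin.prod[OF IH pmultilin_var this] have
      "pmultilin ({j} \<union> (snd ` set vs \<union> S)) (\<lambda>a. mul (mult_word (map (\<lambda>p. (fst p, a (snd p))) vs) (f a)) (a j))"
      by (simp only: Un_commute)
    then show ?thesis unfolding e using False p by simp
  qed
qed simp

section \<open>Density\<close>

context
  assumes simple: "stably_simple {}"
begin

lemma ideal_trivial:
  assumes "subspace U" "U \<noteq> {0}" "\<And>c u. u \<in> U \<Longrightarrow> mul c u \<in> U" "\<And>c u. u \<in> U \<Longrightarrow> mul u c \<in> U"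
  shows "U = UNIV"
proof -
  have "stable_ideal {} U" by (rule stable_idealI) (use assms in auto)
  then show ?thesis using simple assms(2) unfolding stably_simple_def by blast
qed

text \<open>Such an \<open>x\<close> lies in the radical of the trace form.\<close>
lemma mul_eq_0_imp:
  assumes "\<And>v. mul x v = 0" shows "x = 0"
proof (rule stably_simple_nondegenerate[OF _ simple])
  show "form x y = 0" for y unfolding form_def by (simp add: assms tr_zero)
qed simp

text \<open>Schur's lemma: an eigenspace of \<open>\<phi>\<close> is an ideal.\<close>
lemma scalar_commutant:
  assumes l: "lin \<phi>" and "\<And>c v. \<phi> (mul c v) = mul c (\<phi> v)" "\<And>c v. \<phi> (mul v c) = mul (\<phi> v) c"
  shows "\<exists>l. \<forall>v. \<phi> v = scale l v"
proof (cases "\<exists>v::'a. v \<noteq> 0")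
  case True
  obtain m v where v: "v \<noteq> 0" "\<phi> v = scale m v" using exists_eigenvector[OF l True] by blast
  have "{v. \<phi> v = scale m v} = UNIV"
  proof (rule ideal_trivial)
    show "subspace {v. \<phi> v = scale m v}"
      by (rule subspaceI)
         (simp_all add: lin_zero[OF l] lin_add[OF l] lin_scale[OF l] scale_right_distrib mult.commute)
    show "{v. \<phi> v = scale m v} \<noteq> {0}" using v by auto
    show "mul c u \<in> {v. \<phi> v = scale m v}" if "u \<in> {v. \<phi> v = scale m v}" for c u
      using that by (simp add: assms(2) mul_simps)
    show "mul u c \<in> {v. \<phi> v = scale m v}" if "u \<in> {v. \<phi> v = scale m v}" for c u
      using that by (simp add: assms(3) mul_simps)
  qed
  then show ?thesis by blast
next
  case False
  then have "x = y" for x y :: 'a by metis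
  then show ?thesis by blast
qed

text \<open>The submodule generated by the tuple \<open>v\<close>, where multiplications act on all components at once.\<close>
inductive_set word_module :: "(nat \<Rightarrow> 'a) \<Rightarrow> (nat \<Rightarrow> 'a) set" for v where
  gen: "(\<lambda>i. mult_word ws (v i)) \<in> word_module v"
| sum: "s \<in> word_module v \<Longrightarrow> t \<in> word_module v \<Longrightarrow> (\<lambda>i. s i + t i) \<in> word_module v"
| scl: "s \<in> word_module v \<Longrightarrow> (\<lambda>i. scale c (s i)) \<in> word_module v"

lemma word_module_self: "v \<in> word_module v"
  using word_module.gen[of "[]" v] by simp

lemma word_module_mult_word: "s \<in> word_module v \<Longrightarrow> (\<lambda>i. mult_word ws (s i)) \<in> word_module v"
proof (induction rule: word_module.induct)
  case (gen us)
  then show ?case using word_module.gen[of "ws @ us" v] by (simp add: mult_word_append)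
next
  case (sum s t)
  then show ?case using word_module.sum by (simp add: mult_word_add)
next
  case (scl s c)
  then show ?case using word_module.scl by (simp add: mult_word_scale)
qed

lemma word_module_diff:
  assumes "s \<in> word_module v" "t \<in> word_module v" shows "(\<lambda>i. s i - t i) \<in> word_module v"
  using word_module.sum[OF assms(1) word_module.scl[OF assms(2), of "- 1"]] by simp

lemma word_module_relation:
  assumes "\<And>i. i \<in> I \<Longrightarrow> lin (X i)" "\<And>ws. (\<Sum>i\<in>I. X i (mult_word ws (v i))) = 0"
  shows "s \<in> word_module v \<Longrightarrow> (\<Sum>i\<in>I. X i (s i)) = 0"
proof (induction rule: word_module.induct)
  case (sum s t)
  have "(\<Sum>i\<in>I. X i (s i + t i)) = (\<Sum>i\<in>I. X i (s i) + X i (t i))"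
    by (rule sum.cong[OF refl]) (use lin_add[OF assms(1)] in auto)
  then show ?case using sum by (simp add: sum.distrib)
next
  case (scl s c)
  have "(\<Sum>i\<in>I. X i (scale c (s i))) = (\<Sum>i\<in>I. scale c (X i (s i)))"
    by (rule sum.cong[OF refl]) (use lin_scale[OF assms(1)] in auto)
  then show ?case using scl by (simp add: scale_sum_right[symmetric])
qed (rule assms(2))

lemma word_module_component:
  assumes "v j \<noteq> 0" shows "\<exists>s\<in>word_module v. s j = x"
proof -
  let ?U = "{s j | s. s \<in> word_module v}"
  have U: "?U = UNIV"
  proof (rule ideal_trivial)
    show "subspace ?U"
    proof (rule subspaceI)
      show "0 \<in> ?U" using word_module.scl[OF word_module_self, of 0 v] by force
      show "x + y \<in> ?U" if "x \<in> ?U" "y \<in> ?U" for x y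
        using that word_module.sum by fastforce
      show "scale c x \<in> ?U" if "x \<in> ?U" for c x
        using that word_module.scl by fastforce
    qed
    show "?U \<noteq> {0}" using assms word_module_self by blast
    fix c u assume "u \<in> ?U"
    then obtain s where s: "s \<in> word_module v" "u = s j" by blast
    show "mul c u \<in> ?U"
      using word_module_mult_word[OF s(1), of "[(True, c)]"] s(2) by auto
    show "mul u c \<in> ?U"
      using word_module_mult_word[OF s(1), of "[(False, c)]"] s(2) by auto
  qed
  have "x \<in> ?U" unfolding U by (rule UNIV_I)
  then show ?thesis by blast
qed

text \<open>
  Jacobson density, in the form that a relation \<open>\<Sum> X\<^sub>i (W v\<^sub>i) = 0\<close> valid for all words \<open>W\<close> in
  multiplications, with linearly independent \<open>X\<^sub>i\<close>, forces all \<open>v\<^sub>i\<close> to vanish. Suppose \<open>v\<^sub>j \<noteq> 0\<close>. Every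
  element of the algebra is then the \<open>j\<close>-th component of a tuple in the module generated by \<open>v\<close>, and by
  induction this component determines the other ones. They depend on it by maps that commute with all
  multiplications, that is, by scalars \<open>l\<^sub>i\<close>. The relation becomes \<open>\<Sum> l\<^sub>i X\<^sub>i = 0\<close> with \<open>l\<^sub>j = 1\<close>,
  contrary to independence.
\<close>
lemma density:
  fixes I :: "nat set" and v :: "nat \<Rightarrow> 'a"
  assumes "finite I" "\<And>i. i \<in> I \<Longrightarrow> lin (X i)"
    "\<And>c. (\<And>v. (\<Sum>i\<in>I. scale (c i) (X i v)) = 0) \<Longrightarrow> \<forall>i\<in>I. c i = 0"
    "\<And>ws. (\<Sum>i\<in>I. X i (mult_word ws (v i))) = 0"
  shows "\<forall>i\<in>I. v i = 0"
  using assms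
proof (induction I arbitrary: v rule: finite_induct)
  case (insert j I)
  have ind: "\<forall>i\<in>I. c i = 0" if c: "\<And>v. (\<Sum>i\<in>I. scale (c i) (X i v)) = 0" for c
  proof -
    have "(\<Sum>i\<in>insert j I. scale ((c(j := 0)) i) (X i v)) = 0" for v
    proof -
      have "(\<Sum>i\<in>I. scale ((c(j := 0)) i) (X i v)) = (\<Sum>i\<in>I. scale (c i) (X i v))"
        using insert.hyps by (intro sum.cong) auto
      then show ?thesis using insert.hyps c by simp
    qed
    then have "\<forall>i\<in>insert j I. (c(j := 0)) i = 0" by (rule insert.prems(2))
    then show ?thesis using insert.hyps by (metis fun_upd_apply insertCI)
  qed
  have IH: "\<forall>i\<in>I. u i = 0" if "\<And>ws. (\<Sum>i\<in>I. X i (mult_word ws (u i))) = 0" for u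
    by (rule insert.IH[OF _ ind that]) (use insert.prems(1) in auto)
  show ?case
  proof (cases "v j = 0")
    case True
    have "(\<Sum>i\<in>I. X i (mult_word ws (v i))) = 0" for ws
      using insert.prems(3)[of ws] insert.hyps True insert.prems(1) by (simp add: lin_zero)
    then show ?thesis using IH True by blast
  next
    case False
    have X: "lin (X i)" if "i \<in> insert j I" for i using insert.prems(1) that by blast
    have rel: "(\<Sum>i\<in>insert j I. X i (s i)) = 0" if "s \<in> word_module v" for s
      using word_module_relation[OF X insert.prems(3) that] by blast
    have zero: "\<forall>i\<in>I. s i = 0" if s: "s \<in> word_module v" "s j = 0" for s
    proof (rule IH)
      fix ws
      show "(\<Sum>i\<in>I. X i (mult_word ws (s i))) = 0"
        using rel[OF word_module_mult_word[OF s(1), of ws]] s(2) insert.hyps by (simp add: lin_zero[OF X])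
    qed
    have "\<forall>x. \<exists>s. s \<in> word_module v \<and> s j = x"
      using word_module_component[where v = v and j = j, OF False] by blast
    then obtain t where tt: "\<forall>x. t x \<in> word_module v \<and> t x j = x" by (rule choice[THEN exE])
    have t: "t x \<in> word_module v" "t x j = x" for x using tt by blast+
    have uniq: "s i = t (s j) i" if "s \<in> word_module v" "i \<in> I" for s i
      using zero[OF word_module_diff[OF that(1) t(1)[of "s j"]]] t(2)[of "s j"] that(2) by auto
    have "\<exists>l. \<forall>x. t x i = scale l x" if i: "i \<in> I" for i
    proof (rule scalar_commutant)
      show "lin (\<lambda>x. t x i)"
      proof (rule linI)
        show "t (x + y) i = t x i + t y i" for x y
          using uniq[OF word_module.sum[OF t(1)[of x] t(1)[of y]] i] by (simp add: t(2))
        show "t (scale c x) i = scale c (t x i)" for c x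
          using uniq[OF word_module.scl[OF t(1)[of x]] i, of c] by (simp add: t(2))
      qed
      show "t (mul c x) i = mul c (t x i)" for c x
        using uniq[OF word_module_mult_word[OF t(1)[of x], of "[(True, c)]"] i] by (simp add: t(2))
      show "t (mul x c) i = mul (t x i) c" for c x
        using uniq[OF word_module_mult_word[OF t(1)[of x], of "[(False, c)]"] i] by (simp add: t(2))
    qed
    then obtain l where l: "\<And>i x. i \<in> I \<Longrightarrow> t x i = scale (l i) x" by metis
    have "(\<Sum>i\<in>insert j I. scale ((l(j := 1)) i) (X i x)) = 0" for x
    proof -
      have "(\<Sum>i\<in>insert j I. X i (t x i)) = (\<Sum>i\<in>insert j I. scale ((l(j := 1)) i) (X i x))"
      proof (rule sum.cong[OF refl])
        fix i assume i: "i \<in> insert j I"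
        show "X i (t x i) = scale ((l(j := 1)) i) (X i x)"
        proof (cases "i = j")
          case False
          then show ?thesis using i l[of i x] lin_scale[OF X[OF i]] by simp
        qed (simp add: t(2))
      qed
      then show ?thesis using rel[OF t(1)[of x]] by simp
    qed
    then have "\<forall>i\<in>insert j I. (l(j := 1)) i = 0" by (rule insert.prems(2))
    then have "(l(j := 1)) j = 0" by blast
    then show ?thesis by simp
  qed
qed simp

end

end

section \<open>Alternating functions on a simple algebra\<close>

context enumerated_algebra
begin

context
  assumes simple: "stably_simple {}"
begin

lemma bs_independent:
  assumes "(\<Sum>i<d. scale (c i) (bs i)) = 0" "i < d"
  shows "c i = 0"
proof -
  let ?g = "inv_into {..<d} bs"
  have inj: "inj_on bs {..<d}" using bs by (rule bij_betw_imp_inj_on)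
  have "(\<Sum>b\<in>Basis. scale (c (?g b)) b) = (\<Sum>i<d. scale (c (?g (bs i))) (bs i))"
    by (rule bs_sum[symmetric])
  also have "\<dots> = (\<Sum>i<d. scale (c i) (bs i))"
    by (intro sum.cong refl) (simp add: inv_into_f_f[OF inj])
  finally have "(\<Sum>b\<in>Basis. scale (c (?g b)) b) = 0" using assms(1) by simp
  then have "\<forall>b\<in>Basis. c (?g b) = 0"
  proof (rule contrapos_pp)
    assume n: "\<not> (\<forall>b\<in>Basis. c (?g b) = 0)"
    show "(\<Sum>b\<in>Basis. scale (c (?g b)) b) \<noteq> 0"
    proof
      assume "(\<Sum>b\<in>Basis. scale (c (?g b)) b) = 0"
      then have "dependent Basis"
        unfolding dependent_finite[OF finite_Basis]
        by (intro exI[of _ "\<lambda>b. c (?g b)"] conjI) (use n in blast)+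
      then show False using basis_UNIV(1) by blast
    qed
  qed
  moreover have "bs i \<in> Basis" using bs assms(2) by (auto simp: bij_betw_def)
  ultimately show ?thesis using inv_into_f_f[OF inj, of i] assms(2) by auto
qed

text \<open>Left multiplication is a faithful representation of a simple algebra.\<close>
lemma mul_bs_independent:
  assumes k: "k < d" and c: "\<And>v. (\<Sum>i\<le>k. scale (c i) (mul (bs i) v)) = 0"
  shows "\<forall>i\<in>{..k}. c i = 0"
proof
  fix i assume i: "i \<in> {..k}"
  have "mul (\<Sum>i\<le>k. scale (c i) (bs i)) v = 0" for v
    using c[of v] by (simp add: mul_left.sum mul_left.scale)
  then have "(\<Sum>i\<le>k. scale (c i) (bs i)) = 0" by (rule mul_eq_0_imp[OF simple])
  moreover have "(\<Sum>i<d. scale (if i \<le> k then c i else 0) (bs i)) = (\<Sum>i\<le>k. scale (c i) (bs i))"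
    using k by (intro sum.mono_neutral_cong_right) auto
  ultimately have "(\<Sum>i<d. scale (if i \<le> k then c i else 0) (bs i)) = 0" by simp
  from bs_independent[OF this, of i] show "c i = 0" using i k by simp
qed

text \<open>
  Put \<open>F\<^sub>k = f\<close>, and for \<open>i < k\<close> let \<open>F\<^sub>i\<close> be \<open>- f\<close> with \<open>a\<^sub>k\<close> substituted for \<open>a\<^sub>i\<close>. For every word \<open>W\<close> in
  multiplications, \<open>\<Sum> a\<^sub>i W F\<^sub>i(a)\<close> alternates in \<open>a\<^sub>0, \<dots>, a\<^sub>k\<close>: when two of these arguments agree, only
  their two terms survive, with opposite signs. The multipliers of \<open>W\<close> become new variables. Because
  left multiplications by basis vectors are independent and \<open>F\<^sub>k\<close> does not vanish at \<open>a\<close>, density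
  provides a word \<open>W\<close> for which the sum does not vanish at \<open>a\<close>.
\<close>
lemma alternating_extend:
  assumes k: "k < d" and f: "pmultilin S f" and S: "{..<k} \<subseteq> S" "S \<inter> {k..<d} = {}"
    and alt: "alternating k f" and a: "\<And>i. i < d \<Longrightarrow> a i = bs i" and fa: "f a \<noteq> 0"
  shows "\<exists>S' f' a'. pmultilin S' f' \<and> {..<Suc k} \<subseteq> S' \<and> S' \<inter> {Suc k..<d} = {} \<and>
    alternating (Suc k) f' \<and> (\<forall>i<d. a' i = bs i) \<and> f' a' \<noteq> 0"
proof -
  define F where "F i a = (if i = k then f a else - f (a(i := a k)))" for i a
  have kS: "k \<notin> S" using S k by auto
  have "\<exists>ws. (\<Sum>i\<le>k. mul (bs i) (mult_word ws (F i a))) \<noteq> 0"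
  proof (rule ccontr)
    assume "\<not> ?thesis"
    then have rel: "\<And>ws. (\<Sum>i\<le>k. mul (bs i) (mult_word ws (F i a))) = 0" by blast
    have "\<forall>i\<in>{..k}. F i a = 0"
      by (rule density[OF simple _ lin_mul mul_bs_independent[OF k] rel]) auto
    then have "F k a = 0" by simp
    then show False using fa by (simp add: F_def)
  qed
  then obtain ws where ws: "(\<Sum>i\<le>k. mul (bs i) (mult_word ws (F i a))) \<noteq> 0" by blast
  have finS: "finite S" using multilin_finite[OF f] by blast
  \<comment> \<open>The multipliers of the word become the variables \<open>m, m + 1, \<dots>\<close>, all of them new.\<close>
  obtain m where m: "\<And>x. x \<in> S \<union> {..d} \<Longrightarrow> x < m"
    using finite_nat_set_iff_bounded[of "S \<union> {..d}"] finS by auto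
  define vs where "vs = zip (map fst ws) [m..<m + length ws]"
  have vs2: "map snd vs = [m..<m + length ws]" and vs1: "map fst vs = map fst ws"
    by (simp_all add: vs_def)
  define J where "J = snd ` set vs"
  have "J = set (map snd vs)" by (simp add: J_def)
  then have J: "J = {m..<m + length ws}" unfolding vs2 by simp
  have JS: "J \<inter> S = {}" "J \<inter> {..d} = {}" using m unfolding J by force+
  define W where "W a v = mult_word (map (\<lambda>p. (fst p, a (snd p))) vs) v" for a v
  have W: "pmultilin (J \<union> T) (\<lambda>a. W a (g a))" if "pmultilin T g" "J \<inter> T = {}" for T g
    unfolding W_def J_def
    by (rule pmultilin_mult_word) (use that vs2 in \<open>auto simp: J_def\<close>)
  define g where "g a = (\<Sum>i\<le>k. mul (a i) (W a (F i a)))" for a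
  have ml: "pmultilin (J \<union> insert k S) g"
    unfolding g_def
  proof (rule multilin_sum)
    fix i assume i: "i \<in> {..k}"
    show "pmultilin (J \<union> insert k S) (\<lambda>a. mul (a i) (W a (F i a)))"
    proof (cases "i = k")
      case True
      have "pmultilin ({k} \<union> (J \<union> S)) (\<lambda>a. mul (a k) (W a (f a)))"
        by (rule multilin.prod[OF pmultilin_var W[OF f JS(1)]]) (use kS JS(2) k in auto)
      then show ?thesis using True by (simp add: F_def)
    next
      case False
      then have i': "i < k" "i \<in> S" using i S by auto
      have "pmultilin (S - {i} \<union> {k}) (\<lambda>a. f (a(i := a k)))"
        by (rule pmultilin_subst[OF f i'(2) pmultilin_var]) (use kS in auto)
      then have "pmultilin (S - {i} \<union> {k}) (\<lambda>a. scale (- 1) (f (a(i := a k))))"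
        by (rule multilin.scale)
      then have "pmultilin (J \<union> (S - {i} \<union> {k})) (\<lambda>a. W a (scale (- 1) (f (a(i := a k)))))"
        by (rule W) (use JS k in auto)
      then have "pmultilin ({i} \<union> (J \<union> (S - {i} \<union> {k}))) (\<lambda>a. mul (a i) (W a (scale (- 1) (f (a(i := a k))))))"
        by (rule multilin.prod[OF pmultilin_var]) (use JS i' k in auto)
      moreover have "{i} \<union> (J \<union> (S - {i} \<union> {k})) = J \<union> insert k S" using i' by auto
      ultimately show ?thesis using False by (simp add: F_def)
    qed
  qed auto
  have W0: "W a 0 = 0" and Wadd: "W a (u + v) = W a u + W a v" for a u v
    by (simp_all add: W_def mult_word_add)
  have pair: "g b = 0" if pq: "p \<le> k" "q \<le> k" "p \<noteq> q" "b p = b q" "F p b + F q b = 0"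
      "\<And>l. l \<le> k \<Longrightarrow> l \<noteq> p \<Longrightarrow> l \<noteq> q \<Longrightarrow> F l b = 0" for p q b
  proof -
    have "g b = (\<Sum>i\<in>{p, q}. mul (b i) (W b (F i b)))"
      unfolding g_def using pq by (intro sum.mono_neutral_right) (auto simp: W0 mul_right.zero)
    also have "\<dots> = mul (b p) (W b (F p b)) + mul (b q) (W b (F q b))" using pq(3) by simp
    also have "\<dots> = mul (b q) (W b (F p b + F q b))"
      unfolding pq(4) Wadd by (simp add: mul_right.add)
    also have "\<dots> = 0" unfolding pq(5) W0 by (rule mul_right.zero)
    finally show ?thesis .
  qed
  have lt_k: "g b = 0" if pq: "p < k" "q < k" "p \<noteq> q" "b p = b q" for p q b
  proof (rule pair)
    show "F l b = 0" if l: "l \<le> k" "l \<noteq> p" "l \<noteq> q" for l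
    proof (cases "l = k")
      case True
      then show ?thesis using alternatingD[OF alt pq] by (simp add: F_def)
    next
      case False
      have "f (b(l := b k)) = 0"
        by (rule alternatingD[OF alt pq(1,2,3)]) (use l pq in simp)
      then show ?thesis using False by (simp add: F_def)
    qed
    have e: "b(p := b k) = b(p := b k, q := b q)" "b(q := b k) = b(p := b q, q := b k)"
      using pq(3,4) by (intro ext; simp)+
    have "f (b(p := b k)) = f (b(p := b k, q := b q))" by (rule arg_cong[OF e(1)])
    also have "\<dots> = - f (b(p := b q, q := b k))"
      by (rule alternating_swap[OF alt f pq(1-3)]) (use pq S in auto)
    also have "f (b(p := b q, q := b k)) = f (b(q := b k))" by (rule arg_cong[OF e(2)[symmetric]])
    finally have swap: "f (b(p := b k)) = - f (b(q := b k))" .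
    have "p \<noteq> k" "q \<noteq> k" using pq by auto
    then have Fpq: "F p b = - f (b(p := b k))" "F q b = - f (b(q := b k))" by (simp_all only: F_def if_False)
    show "F p b + F q b = 0" unfolding Fpq swap by (simp only: minus_minus right_minus)
  qed (use pq in auto)
  have eq_k: "g b = 0" if p: "p < k" "b p = b k" for p b
  proof (rule pair[of p k])
    show "F l b = 0" if l: "l \<le> k" "l \<noteq> p" "l \<noteq> k" for l
    proof -
      have "f (b(l := b k)) = 0"
        by (rule alternatingD[OF alt, of l p]) (use l p in auto)
      then show ?thesis using l by (simp add: F_def)
    qed
    have "b(p := b k) = b" using p by auto
    then show "F p b + F k b = 0" using p(1) by (simp add: F_def)
  qed (use p in auto)
  have altg: "alternating (Suc k) g"
    unfolding alternating_def
  proof (intro allI impI)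
    fix b :: "nat \<Rightarrow> 'a" and p q assume pq: "p < Suc k" "q < Suc k" "p \<noteq> q" "b p = b q"
    consider "p < k" "q < k" | "p < k" "q = k" | "q < k" "p = k" using pq by linarith
    then show "g b = 0"
    proof cases
      case 1 then show ?thesis using lt_k pq(3,4) by blast
    next
      case 2 then show ?thesis using eq_k[of p b] pq(4) by simp
    next
      case 3 then show ?thesis using eq_k[of q b] pq(4) by simp
    qed
  qed
  define a' where "a' j = (if j \<in> J then snd (ws ! (j - m)) else a j)" for j
  have a'S: "a' i = a i" if "i \<in> S \<union> {..d}" for i
    using that JS by (auto simp: a'_def)
  have "map (\<lambda>p. (fst p, a' (snd p))) vs = ws"
  proof (rule nth_equalityI)
    show "length (map (\<lambda>p. (fst p, a' (snd p))) vs) = length ws" by (simp add: vs_def)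
    fix i assume "i < length (map (\<lambda>p. (fst p, a' (snd p))) vs)"
    then have "i < length ws" by (simp add: vs_def)
    then show "map (\<lambda>p. (fst p, a' (snd p))) vs ! i = ws ! i"
      by (simp add: vs_def a'_def J)
  qed
  then have Wa: "W a' v = mult_word ws v" for v by (simp add: W_def)
  have Fa: "F i a' = F i a" if "i \<le> k" for i
  proof -
    have "f a' = f a" by (rule multilin_cong[OF f]) (use a'S in auto)
    moreover have "f (a'(i := a' k)) = f (a(i := a k))"
      by (rule multilin_cong[OF f]) (use a'S k in auto)
    ultimately show ?thesis by (simp add: F_def)
  qed
  have a'bs: "a' i = bs i" if "i < d" for i using a'S[of i] a[OF that] that by simp
  have "g a' = (\<Sum>i\<le>k. mul (bs i) (mult_word ws (F i a)))"
    unfolding g_def using k by (intro sum.cong refl) (simp add: Wa Fa a'bs)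
  then have ga': "g a' \<noteq> 0" using ws by simp
  have sub: "{..<Suc k} \<subseteq> J \<union> insert k S" using S by (auto simp: lessThan_Suc)
  have disj: "(J \<union> insert k S) \<inter> {Suc k..<d} = {}" using JS S by auto
  show ?thesis
    by (rule exI[of _ "J \<union> insert k S"], rule exI[of _ g], rule exI[of _ a'])
       (intro conjI allI impI ml sub disj altg a'bs ga')
qed

lemma alternating_exists_upto:
  assumes "d > 0" "k \<le> d"
  shows "\<exists>S f a. pmultilin S f \<and> {..<k} \<subseteq> S \<and> S \<inter> {k..<d} = {} \<and>
    alternating k f \<and> (\<forall>i<d. a i = bs i) \<and> f a \<noteq> 0"
  using assms(2)
proof (induction k)
  case 0
  have "bs 0 \<in> Basis" using bs assms(1) by (auto simp: bij_betw_def)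
  then have nz: "bs 0 \<noteq> 0" using basis_UNIV(1) dependent_zero by metis
  define a where "a i = (if i < d then bs i else bs 0)" for i
  have "pmultilin {d} (\<lambda>a. a d)" by (rule pmultilin_var)
  moreover have "alternating 0 (\<lambda>a. a d)" by (simp add: alternating_def)
  moreover have "a d \<noteq> 0" "\<forall>i<d. a i = bs i" using nz by (simp_all add: a_def)
  ultimately show ?case
    by (intro exI[of _ "{d}"] exI[of _ "\<lambda>a. a d"] exI[of _ a]) auto
next
  case (Suc k)
  then obtain S f a where "pmultilin S f" "{..<k} \<subseteq> S" "S \<inter> {k..<d} = {}"
    "alternating k f" "\<forall>i<d. a i = bs i" "f a \<noteq> 0" by auto
  then show ?case using Suc.prems by (intro alternating_extend[of k S f a]) auto
qed

lemma alt_multilin_exists: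
  assumes "d > 0"
  shows "\<exists>S f a. alt_multilin S f \<and> (\<forall>i<d. a i = bs i) \<and> f a \<noteq> 0"
  using alternating_exists_upto[OF assms order.refl] unfolding alt_multilin_def by blast

text \<open>
  Multiplication by a new variable raises the degree by one, so that all large degrees occur and not
  only those in an arithmetic progression.
\<close>
lemma alt_multilin_pad:
  assumes f: "alt_multilin S f" "\<forall>i<d. a i = bs i" "f a \<noteq> 0"
  shows "\<exists>S' f' a'. alt_multilin S' f' \<and> (\<forall>i<d. a' i = bs i) \<and> f' a' \<noteq> 0 \<and> card S' = Suc (card S)"
proof -
  have ml: "pmultilin S f" and alt: "alternating d f" and S: "{..<d} \<subseteq> S" using f(1) by (auto simp: alt_multilin_def)
  have fin: "finite S" using multilin_finite[OF ml] by blast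
  then obtain k where k: "k \<notin> S" using ex_new_if_finite infinite_UNIV_nat by blast
  obtain y where y: "mul (f a) y \<noteq> 0" using mul_eq_0_imp[OF simple] f(3) by blast
  have "pmultilin (S \<union> {k}) (\<lambda>a. mul (f a) (a k))"
    by (rule multilin.prod[OF ml pmultilin_var]) (use k in auto)
  moreover have "alternating d (\<lambda>a. mul (f a) (a k))"
    using alt unfolding alternating_def by (metis mul_left.zero)
  ultimately have "alt_multilin (S \<union> {k}) (\<lambda>a. mul (f a) (a k))" using S by (auto simp: alt_multilin_def)
  moreover have "f (a(k := y)) = f a" by (rule multilin_upd[OF ml k])
  then have "mul (f (a(k := y))) ((a(k := y)) k) \<noteq> 0" using y by simp
  moreover have "\<forall>i<d. (a(k := y)) i = bs i" using f(2) k S by auto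
  moreover have "card (S \<union> {k}) = Suc (card S)" using fin k by simp
  ultimately show ?thesis by blast
qed

lemma alt_multilin_exists_card:
  assumes "d > 0"
  shows "\<exists>N. \<forall>n\<ge>N. \<exists>S f a. alt_multilin S f \<and> (\<forall>i<d. a i = bs i) \<and> f a \<noteq> 0 \<and> card S = n"
proof -
  obtain S f a where f: "alt_multilin S f" "\<forall>i<d. a i = bs i" "f a \<noteq> 0" using alt_multilin_exists[OF assms] by blast
  have "\<exists>S' f' a'. alt_multilin S' f' \<and> (\<forall>i<d. a' i = bs i) \<and> f' a' \<noteq> 0 \<and> card S' = n" if "n \<ge> card S" for n
    using that
  proof (induction n rule: dec_induct)
    case base
    then show ?case using f by blast
  next
    case (step n)
    then obtain S' f' a' where "alt_multilin S' f'" "\<forall>i<d. a' i = bs i" "f' a' \<noteq> 0" "card S' = n" by blast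
    then show ?case using alt_multilin_pad by blast
  qed
  then show ?thesis by blast
qed

end

end

section \<open>Gram determinants of the trace form\<close>

context enumerated_algebra
begin

lemma alternating_linear_combination:
  assumes "\<And>p. p \<in> P \<Longrightarrow> alternating k (F p)"
  shows "alternating k (\<lambda>a. \<Sum>p\<in>P. scale (c p) (F p a))"
  unfolding alternating_def
proof (intro allI impI)
  fix a :: "nat \<Rightarrow> 'a" and i j assume "i < k" "j < k" "i \<noteq> j" "a i = a j"
  then have "F p a = 0" if "p \<in> P" for p using alternatingD[OF assms[OF that]] by blast
  then show "(\<Sum>p\<in>P. scale (c p) (F p a)) = 0" by simp
qed

text \<open>
  Antisymmetrizing \<open>\<Prod> \<kappa>(z\<^sub>i, w\<^sub>i)\<close> in the variables \<open>w\<^sub>i\<close> gives the determinant of the matrix of all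
  \<open>\<kappa>(z\<^sub>i, w\<^sub>j)\<close>.
\<close>
definition det_step :: "(nat \<Rightarrow> nat) \<Rightarrow> (nat \<Rightarrow> nat) \<Rightarrow> ((nat \<Rightarrow> 'a) \<Rightarrow> 'a) \<Rightarrow> ((nat \<Rightarrow> 'a) \<Rightarrow> 'a)" where
  "det_step z w f = (\<lambda>a. \<Sum>p\<in>{p. p permutes {0..<d}}. scale (signof p) (form_steps d z (\<lambda>i. w (p i)) f a))"

definition gram :: "(nat \<Rightarrow> 'a) \<Rightarrow> (nat \<Rightarrow> 'a) \<Rightarrow> 'f mat" where
  "gram x y = mat d d (\<lambda>(i, j). form (x i) (y j))"

lemma alt_multilin_det_step:
  assumes f: "alt_multilin S f" and z: "inj_on z {..<d}" and w: "inj_on w {..<d}"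
    and zw: "z ` {..<d} \<inter> w ` {..<d} = {}" "(z ` {..<d} \<union> w ` {..<d}) \<inter> S = {}" and d0: "d > 0"
  shows "alt_multilin (S \<union> z ` {..<d} \<union> w ` {..<d}) (det_step z w f) \<and>
    (\<forall>a. (\<forall>i<d. a i = bs i) \<longrightarrow>
      det_step z w f a = scale (det (gram (\<lambda>i. a (z i)) (\<lambda>i. a (w i)))) (f a))"
proof -
  let ?T = "S \<union> z ` {..<d} \<union> w ` {..<d}"
  have step: "alt_multilin ?T (form_steps d z (\<lambda>i. w (p i)) f) \<and>
    (\<forall>a. (\<forall>i<d. a i = bs i) \<longrightarrow>
      form_steps d z (\<lambda>i. w (p i)) f a = scale (\<Prod>i<d. form (a (z i)) (a (w (p i)))) (f a))"
    if p: "p permutes {0..<d}" for p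
  proof -
    have im: "p ` {..<d} = {..<d}" using permutes_image[OF p] by (simp add: lessThan_atLeast0)
    have imw: "(\<lambda>i. w (p i)) ` {..<d} = w ` {..<d}"
      using image_image[of w p "{..<d}"] im by simp
    have "inj_on (\<lambda>i. w (p i)) {..<d}"
      using comp_inj_on[of p "{..<d}" w] permutes_inj_on[OF p] w im by (simp add: comp_def)
    then show ?thesis using alt_multilin_form_steps[OF f z, of "\<lambda>i. w (p i)"] zw d0 unfolding imw by blast
  qed
  have fin: "finite {p. p permutes {0..<d}}" by (simp add: finite_permutations)
  have ne: "{p. p permutes {0..<d}} \<noteq> {}" using permutes_id by blast
  have "pmultilin ?T (det_step z w f)"
    unfolding det_step_def using step
    by (intro multilin_sum[OF fin ne] multilin.scale) (auto simp: alt_multilin_def)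
  moreover have "alternating d (det_step z w f)"
    unfolding det_step_def using step by (intro alternating_linear_combination) (auto simp: alt_multilin_def)
  moreover have "{..<d} \<subseteq> ?T" using f by (auto simp: alt_multilin_def)
  moreover have "det_step z w f a = scale (det (gram (\<lambda>i. a (z i)) (\<lambda>i. a (w i)))) (f a)"
    if a: "\<forall>i<d. a i = bs i" for a
  proof -
    have "det_step z w f a = (\<Sum>p\<in>{p. p permutes {0..<d}}.
        scale (signof p * (\<Prod>i<d. form (a (z i)) (a (w (p i))))) (f a))"
      unfolding det_step_def using step a by (intro sum.cong) auto
    also have "\<dots> = scale (\<Sum>p\<in>{p. p permutes {0..<d}}. signof p * (\<Prod>i<d. form (a (z i)) (a (w (p i))))) (f a)"
      by (simp add: scale_sum_left)
    also have "(\<Sum>p\<in>{p. p permutes {0..<d}}. signof p * (\<Prod>i<d. form (a (z i)) (a (w (p i)))))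
        = det (gram (\<lambda>i. a (z i)) (\<lambda>i. a (w i)))"
    proof -
      have c: "gram (\<lambda>i. a (z i)) (\<lambda>i. a (w i)) \<in> carrier_mat d d" by (simp add: gram_def)
      have "(\<Prod>i<d. form (a (z i)) (a (w (p i)))) = (\<Prod>i = 0..<d. gram (\<lambda>i. a (z i)) (\<lambda>i. a (w i)) $$ (i, p i))"
        if "p permutes {0..<d}" for p
      proof -
        have "p i < d" if "i < d" for i using permutes_in_image[OF \<open>p permutes {0..<d}\<close>, of i] that by simp
        then show ?thesis by (intro prod.cong) (auto simp: gram_def lessThan_atLeast0)
      qed
      then show ?thesis unfolding det_def'[OF c] by (intro sum.cong) auto
    qed
    finally show ?thesis .
  qed
  ultimately show ?thesis by (simp add: alt_multilin_def)
qed

text \<open>Column \<open>2 k\<close> of variables is paired with column \<open>2 k + 1\<close>.\<close>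
primrec det_steps :: "nat \<Rightarrow> (nat \<Rightarrow> nat \<Rightarrow> nat) \<Rightarrow> ((nat \<Rightarrow> 'a) \<Rightarrow> 'a) \<Rightarrow> ((nat \<Rightarrow> 'a) \<Rightarrow> 'a)" where
  "det_steps 0 cl f = f"
| "det_steps (Suc k) cl f = det_step (cl (2 * k)) (cl (2 * k + 1)) (det_steps k cl f)"

lemma alt_multilin_det_steps:
  assumes f: "alt_multilin S f" and d0: "d > 0"
  shows "inj_on (\<lambda>(c, j). cl c j) ({..<2 * K} \<times> {..<d}) \<Longrightarrow>
    (\<lambda>(c, j). cl c j) ` ({..<2 * K} \<times> {..<d}) \<inter> S = {} \<Longrightarrow>
    alt_multilin (S \<union> (\<lambda>(c, j). cl c j) ` ({..<2 * K} \<times> {..<d})) (det_steps K cl f) \<and>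
    (\<forall>a. (\<forall>i<d. a i = bs i) \<longrightarrow> det_steps K cl f a =
      scale (\<Prod>k<K. det (gram (\<lambda>i. a (cl (2 * k) i)) (\<lambda>i. a (cl (2 * k + 1) i)))) (f a))"
proof (induction K)
  case 0
  then show ?case using f by simp
next
  case (Suc K)
  let ?I = "\<lambda>K. (\<lambda>(c, j). cl c j) ` ({..<2 * K} \<times> {..<d})"
  let ?z = "cl (2 * K)" and ?w = "cl (2 * K + 1)"
  have sub: "{..<2 * K} \<times> {..<d} \<subseteq> {..<2 * Suc K} \<times> {..<d}" by auto
  have "?I K \<subseteq> ?I (Suc K)" by (rule image_mono[OF sub])
  then have dis: "?I K \<inter> S = {}" using Suc.prems(2) by blast
  note IH' = Suc.IH[OF inj_on_subset[OF Suc.prems(1) sub] dis]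
  have IH: "alt_multilin (S \<union> ?I K) (det_steps K cl f)" by (rule IH'[THEN conjunct1])
  have IHv: "det_steps K cl f a =
      scale (\<Prod>k<K. det (gram (\<lambda>i. a (cl (2 * k) i)) (\<lambda>i. a (cl (2 * k + 1) i)))) (f a)"
    if "\<forall>i<d. a i = bs i" for a
    by (rule IH'[THEN conjunct2, rule_format]) (use that in blast)
  have inj: "c = c' \<and> j = j'" if "cl c j = cl c' j'" "c < 2 * Suc K" "c' < 2 * Suc K" "j < d" "j' < d" for c c' j j'
  proof -
    have "(c, j) = (c', j')" by (rule inj_onD[OF Suc.prems(1)]) (use that in simp_all)
    then show ?thesis by simp
  qed
  have inS: "cl c j \<notin> S" if "c < 2 * Suc K" "j < d" for c j
  proof -
    have "cl c j \<in> ?I (Suc K)" by (rule image_eqI[of _ _ "(c, j)"]) (use that in simp_all)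
    then show ?thesis using Suc.prems(2) by blast
  qed
  have lt: "2 * K < 2 * Suc K" "2 * K + 1 < 2 * Suc K" by simp_all
  have inj1: "inj_on (cl c) {..<d}" if c: "c < 2 * Suc K" for c
  proof (rule inj_onI)
    fix x y assume "x \<in> {..<d}" "y \<in> {..<d}" and e: "cl c x = cl c y"
    then have "x < d" "y < d" by simp_all
    from inj[OF e c c this] show "x = y" by (rule conjunct2)
  qed
  note 1 = inj1[OF lt(1)] inj1[OF lt(2)]
  have 2: "?z ` {..<d} \<inter> ?w ` {..<d} = {}"
  proof (rule ccontr)
    assume "\<not> ?thesis"
    then obtain i j where ij: "i < d" "j < d" and e: "?z i = ?w j" by auto
    have "2 * K = 2 * K + 1" by (rule inj[OF e lt ij, THEN conjunct1])
    then show False by simp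
  qed
  have 3: "(?z ` {..<d} \<union> ?w ` {..<d}) \<inter> (S \<union> ?I K) = {}"
  proof (rule ccontr)
    assume "\<not> ?thesis"
    then obtain c j where cj: "c \<in> {2 * K, 2 * K + 1}" "j < d" "cl c j \<in> S \<union> ?I K" by blast
    have c: "c < 2 * Suc K" using cj(1) by auto
    have "cl c j \<in> ?I K" using inS[OF c cj(2)] cj(3) by blast
    then obtain c' j' where c': "c' < 2 * K" "j' < d" and e: "cl c j = cl c' j'" by auto
    have "c' < 2 * Suc K" using c' by simp
    have "c = c'" by (rule inj[OF e c \<open>c' < 2 * Suc K\<close> cj(2) c'(2), THEN conjunct1])
    then show False using c'(1) cj(1) by auto
  qed
  note st = alt_multilin_det_step[OF IH 1 2 3 d0]
  have e: "S \<union> ?I K \<union> ?z ` {..<d} \<union> ?w ` {..<d} = S \<union> ?I (Suc K)"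
  proof -
    have "{..<2 * Suc K} = {..<2 * K} \<union> {2 * K, 2 * K + 1}" by auto
    then have "{..<2 * Suc K} \<times> {..<d} = {..<2 * K} \<times> {..<d} \<union> {2 * K} \<times> {..<d} \<union> {2 * K + 1} \<times> {..<d}" by auto
    moreover have "(\<lambda>(c, j). cl c j) ` ({c} \<times> {..<d}) = cl c ` {..<d}" for c by auto
    ultimately show ?thesis by (simp add: image_Un Un_assoc)
  qed
  have "alt_multilin (S \<union> ?I (Suc K)) (det_steps (Suc K) cl f)"
    using st unfolding e by simp
  moreover have "det_steps (Suc K) cl f a =
      scale (\<Prod>k<Suc K. det (gram (\<lambda>i. a (cl (2 * k) i)) (\<lambda>i. a (cl (2 * k + 1) i)))) (f a)"
    if a: "\<forall>i<d. a i = bs i" for a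
    using st[THEN conjunct2, rule_format, of a] a IHv[OF a] by (simp add: mult.commute)
  ultimately show ?case by blast
qed

section \<open>A triangular family of multilinear functions\<close>

context
  assumes simple: "stably_simple {}"
begin

lemma gram_basis_nonsingular: "det (gram bs bs) \<noteq> 0"
proof
  assume "det (gram bs bs) = 0"
  moreover have c: "gram bs bs \<in> carrier_mat d d" by (simp add: gram_def)
  ultimately obtain v where v: "v \<in> carrier_vec d" "v \<noteq> 0\<^sub>v d" "gram bs bs *\<^sub>v v = 0\<^sub>v d"
    using det_0_iff_vec_prod_zero_field[OF c] by blast
  define x where "x = (\<Sum>j<d. scale (v $ j) (bs j))"
  have form_sum: "form y (\<Sum>j\<in>J. g j) = (\<Sum>j\<in>J. form y (g j))" for y and J :: "nat set" and g
    by (induction J rule: infinite_finite_induct) (simp_all add: form_add_right)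
  have 0: "form (bs i) x = 0" if i: "i < d" for i
  proof -
    have "form (bs i) x = (\<Sum>j<d. form (bs i) (bs j) * v $ j)"
      unfolding x_def form_sum by (simp add: form_scale_right mult.commute)
    also have "\<dots> = (gram bs bs *\<^sub>v v) $ i"
      using i v(1) by (simp add: gram_def scalar_prod_def lessThan_atLeast0)
    finally show ?thesis using v(3) i by simp
  qed
  have "form y x = 0" for y
  proof -
    have "y \<in> span Basis" using basis_UNIV by simp
    then show ?thesis
    proof (induction rule: span_induct_alt)
      case (step c b y)
      then obtain i where "i < d" "b = bs i" using bs by (auto simp: bij_betw_def)
      then show ?case using step 0 by (simp add: form_add_left form_scale_left)
    qed simp
  qed
  then have "x = 0"
    using stably_simple_nondegenerate[OF _ simple, of x] by (simp add: form_sym[of x])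
  then have "v $ j = 0" if "j < d" for j
    using bs_independent[OF simple, of "\<lambda>j. v $ j" j] that by (simp add: x_def)
  then have "v = 0\<^sub>v d" using v(1) by (intro eq_vecI) auto
  then show False using v(2) by simp
qed

lemma gram_det_imp_inj:
  assumes "det (gram (\<lambda>i. x (u i)) (\<lambda>j. y (v j))) \<noteq> 0"
  shows "inj_on u {..<d}" "inj_on v {..<d}"
proof -
  let ?A = "gram (\<lambda>i. x (u i)) (\<lambda>j. y (v j))"
  have c: "?A \<in> carrier_mat d d" by (simp add: gram_def)
  show "inj_on u {..<d}"
  proof (rule inj_onI, rule ccontr)
    fix i j assume ij: "i \<in> {..<d}" "j \<in> {..<d}" "u i = u j" "i \<noteq> j"
    have "row ?A i = row ?A j" using ij by (intro eq_vecI) (auto simp: gram_def)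
    then have "det ?A = 0" using det_identical_rows[OF c, of i j] ij by auto
    then show False using assms by simp
  qed
  show "inj_on v {..<d}"
  proof (rule inj_onI, rule ccontr)
    fix i j assume ij: "i \<in> {..<d}" "j \<in> {..<d}" "v i = v j" "i \<noteq> j"
    have "col ?A i = col ?A j" using ij by (intro eq_vecI) (auto simp: gram_def)
    then have "det ?A = 0" using det_identical_columns[OF c, of i j] ij by auto
    then show False using assms by simp
  qed
qed

text \<open>
  The function \<open>G w\<close> multiplies \<open>f\<close> by the Gram determinants of paired columns of the tableau of \<open>w\<close>, and
  the point \<open>pt w'\<close> puts the \<open>j\<close>-th basis vector at every position where \<open>w'\<close> has the letter \<open>j\<close>. On the
  diagonal all determinants are those of the Gram matrix of the basis, hence nonzero. In general a
  nonzero value requires that \<open>w'\<close> has distinct letters on each column of \<open>w\<close>, because otherwise some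
  Gram matrix has two equal rows or columns; this is the situation of \<open>lattice_words_triangular\<close>.
\<close>
lemma triangular_family:
  assumes f: "alt_multilin S f" "\<forall>i<d. a0 i = bs i" "f a0 \<noteq> 0" and d0: "d > 0"
  shows "\<exists>G pt. \<forall>w\<in>lattice_words d (2 * K).
    pmultilin {1..card S + d * (2 * K)} (G w) \<and> G w (pt w) \<noteq> 0 \<and>
    (\<forall>w'\<in>lattice_words d (2 * K). G w (pt w') \<noteq> 0 \<longrightarrow> w = w' \<or> (w, w') \<in> lexn less_than (d * (2 * K)))"
proof -
  let ?N = "d * (2 * K)" and ?W = "lattice_words d (2 * K)"
  have ml: "pmultilin S f" and S: "{..<d} \<subseteq> S" using f(1) by (auto simp: alt_multilin_def)
  have finS: "finite S" using multilin_finite[OF ml] by blast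
  then obtain m where m: "\<And>x. x \<in> S \<Longrightarrow> x < m" using finite_nat_set_iff_bounded[of S] by auto
  define T where "T = S \<union> {m..<m + ?N}"
  have disj: "{m..<m + ?N} \<inter> S = {}" using m by (meson atLeastLessThan_iff disjoint_iff not_less)
  have finT: "finite T" unfolding T_def using finS by simp
  have "S \<inter> {m..<m + ?N} = {}" using disj by blast
  from card_Un_disjoint[OF finS finite_atLeastLessThan this]
  have cT: "card T = card S + ?N" unfolding T_def by simp
  define cl where "cl w c j = m + occ w j c" for w c j
  define pt where "pt w i = (if i \<in> {m..<m + ?N} then bs (w ! (i - m)) else a0 i)" for w i
  define G where "G w = det_steps K (cl w) f" for w
  have cnt: "count_list w j = 2 * K" if "w \<in> ?W" "j < d" for w j
    using that by (auto simp: lattice_words_def)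
  have len: "length w = ?N" if "w \<in> ?W" for w by (rule lattice_words_length[OF that])
  have occN: "occ w j c < ?N" if "w \<in> ?W" "j < d" "c < 2 * K" for w j c
    using occ_props(1)[of c w j] cnt[OF that(1,2)] len[OF that(1)] that(3) by simp
  have occw: "w ! occ w j c = j" if "w \<in> ?W" "j < d" "c < 2 * K" for w j c
    using occ_props(2)[of c w j] cnt[OF that(1,2)] that(3) by simp
  have ptcl: "pt w' (cl w c j) = bs (w' ! occ w j c)" if "w \<in> ?W" "j < d" "c < 2 * K" for w w' j c
    using occN[OF that] by (simp add: pt_def cl_def)
  have pt_bs: "\<forall>i<d. pt w i = bs i" for w
  proof (intro allI impI)
    fix i assume i: "i < d"
    then have "i < m" using S m by auto
    then show "pt w i = bs i" using f(2) i by (simp add: pt_def)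
  qed
  have fpt: "f (pt w) = f a0" for w
    by (rule multilin_cong[OF ml]) (use m in \<open>auto simp: pt_def dest: m\<close>)
  have G: "pmultilin T (G w) \<and> G w (pt w') =
      scale (\<Prod>k<K. det (gram (\<lambda>i. pt w' (cl w (2 * k) i)) (\<lambda>i. pt w' (cl w (2 * k + 1) i)))) (f a0)"
    if w: "w \<in> ?W" for w w'
  proof -
    have inj: "inj_on (\<lambda>(c, j). cl w c j) ({..<2 * K} \<times> {..<d})"
    proof (rule inj_onI, clarify)
      fix c j c' j'
      assume lt: "c < 2 * K" "j < d" "c' < 2 * K" "j' < d" and e: "cl w c j = cl w c' j'"
      have "occ w j c = occ w j' c'" using e by (simp add: cl_def)
      then have "j = j' \<and> c = c'" using lt by (intro occ_inj) (simp_all add: cnt[OF w])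
      then show "c = c' \<and> j = j'" by blast
    qed
    have im: "(\<lambda>(c, j). cl w c j) ` ({..<2 * K} \<times> {..<d}) = {m..<m + ?N}"
    proof (rule card_subset_eq)
      show "(\<lambda>(c, j). cl w c j) ` ({..<2 * K} \<times> {..<d}) \<subseteq> {m..<m + ?N}"
        using occN[OF w] by (auto simp: cl_def)
      show "card ((\<lambda>(c, j). cl w c j) ` ({..<2 * K} \<times> {..<d})) = card {m..<m + ?N}"
        unfolding card_image[OF inj] by simp
    qed simp
    from alt_multilin_det_steps[OF f(1) d0 inj, unfolded im, OF disj]
    have "alt_multilin T (det_steps K (cl w) f)"
      and v: "\<And>a. \<forall>i<d. a i = bs i \<Longrightarrow> det_steps K (cl w) f a =
        scale (\<Prod>k<K. det (gram (\<lambda>i. a (cl w (2 * k) i)) (\<lambda>i. a (cl w (2 * k + 1) i)))) (f a)"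
      unfolding T_def by blast+
    then show ?thesis using v[OF pt_bs] by (simp add: G_def alt_multilin_def fpt)
  qed
  have diag: "G w (pt w) \<noteq> 0" if w: "w \<in> ?W" for w
  proof -
    have "gram (\<lambda>i. pt w (cl w (2 * k) i)) (\<lambda>i. pt w (cl w (2 * k + 1) i)) = gram bs bs" if "k < K" for k
      unfolding gram_def using that w by (intro cong_mat) (auto simp: ptcl occw)
    then show ?thesis using G[OF w, of w] gram_basis_nonsingular f(3) by simp
  qed
  have tri: "w = w' \<or> (w, w') \<in> lexn less_than ?N" if w: "w \<in> ?W" "w' \<in> ?W" "G w (pt w') \<noteq> 0" for w w'
  proof (rule lattice_words_triangular[OF w(1) len[OF w(2)]])
    fix c assume c: "c < 2 * K"
    then have k: "c div 2 < K" by linarith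
    let ?k = "c div 2"
    have "det (gram (\<lambda>i. pt w' (cl w (2 * ?k) i)) (\<lambda>i. pt w' (cl w (2 * ?k + 1) i))) \<noteq> 0"
      using w(3) G[OF w(1), of w'] k by auto
    moreover have "gram (\<lambda>i. pt w' (cl w (2 * ?k) i)) (\<lambda>i. pt w' (cl w (2 * ?k + 1) i))
        = gram (\<lambda>i. bs (w' ! occ w i (2 * ?k))) (\<lambda>i. bs (w' ! occ w i (2 * ?k + 1)))"
      unfolding gram_def using k by (intro cong_mat) (auto simp: ptcl[OF w(1)])
    ultimately have "inj_on (\<lambda>i. w' ! occ w i (2 * ?k)) {..<d}" "inj_on (\<lambda>i. w' ! occ w i (2 * ?k + 1)) {..<d}"
      using gram_det_imp_inj[of bs "\<lambda>i. w' ! occ w i (2 * ?k)" bs "\<lambda>i. w' ! occ w i (2 * ?k + 1)"] by simp_all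
    moreover have "c = 2 * ?k \<or> c = 2 * ?k + 1" by linarith
    ultimately show "inj_on (\<lambda>j. w' ! occ w j c) {..<d}" by metis
  qed
  \<comment> \<open>It remains to rename the variables to \<open>1, \<dots>, n\<close>.\<close>
  have "\<exists>\<pi>. bij_betw \<pi> T {1..card S + ?N}"
    using finT cT by (intro finite_same_card_bij) auto
  then obtain \<pi> where pi: "bij_betw \<pi> T {1..card S + ?N}" by blast
  have injpi: "inj_on \<pi> T" and impi: "\<pi> ` T = {1..card S + ?N}" using pi by (auto simp: bij_betw_def)
  define G' where "G' w a = G w (\<lambda>i. a (\<pi> i))" for w a
  define pt' where "pt' w j = pt w (inv_into T \<pi> j)" for w j
  have G'pt: "G' w (pt' w') = G w (pt w')" if "w \<in> ?W" for w w'
    unfolding G'_def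
    by (rule multilin_cong[OF G[OF that, THEN conjunct1]]) (simp add: pt'_def inv_into_f_f[OF injpi])
  have "pmultilin {1..card S + ?N} (G' w)" if "w \<in> ?W" for w
    using pmultilin_rename[OF G[OF that, THEN conjunct1] injpi] unfolding impi G'_def .
  then show ?thesis using diag tri G'pt by (intro exI[of _ G'] exI[of _ pt']) auto
qed

end

end

section \<open>Dimensions of quotients\<close>

text \<open>
  The homomorphism theorem. The finite set \<open>T\<close> ensures that the image is finite-dimensional, where
  both sides are genuine dimensions.
\<close>
lemma quotient_dim_eq_dim_image:
  fixes sV :: "'f::field \<Rightarrow> 'v::ab_group_add \<Rightarrow> 'v" and sW :: "'f \<Rightarrow> 'w::ab_group_add \<Rightarrow> 'w"
  assumes lin: "Vector_Spaces.linear sV sW \<Phi>" and V: "module.subspace sV V"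
    and T: "finite T" "\<Phi> ` V \<subseteq> module.span sW T"
  shows "quotient_dim sV V (V \<inter> {x. \<Phi> x = 0}) = vector_space.dim sW (\<Phi> ` V)"
proof -
  interpret L: Vector_Spaces.linear sV sW \<Phi> by (rule lin)
  let ?W = "V \<inter> {x. \<Phi> x = 0}"
  have lc: "\<Phi> (lincomb sV (\<lambda>b. b) c) = lincomb sW \<Phi> c" for c
    by (simp add: lincomb_def L.sum L.scale)
  have lcV: "lincomb sV (\<lambda>b. b) c \<in> V" if "B \<subseteq> V" "Poly_Mapping.keys c \<subseteq> B" for B c
    unfolding lincomb_def using that V
    by (intro L.vs1.subspace_sum L.vs1.subspace_scale) auto
  have inW: "x - lincomb sV (\<lambda>b. b) c \<in> ?W \<longleftrightarrow> \<Phi> x = lincomb sW \<Phi> c"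
    if "x \<in> V" "B \<subseteq> V" "Poly_Mapping.keys c \<subseteq> B" for x B c
  proof -
    have "x - lincomb sV (\<lambda>b. b) c \<in> V" by (rule L.vs1.subspace_diff[OF V that(1) lcV[OF that(2,3)]])
    then show ?thesis by (simp add: L.diff lc)
  qed
  have qb: "quotient_basis sV V ?W B (\<lambda>b. b) \<longleftrightarrow>
      B \<subseteq> V \<and> (\<forall>x\<in>V. \<exists>!c. Poly_Mapping.keys c \<subseteq> B \<and> \<Phi> x = lincomb sW \<Phi> c)" for B
  proof (cases "B \<subseteq> V")
    case True
    have "(\<exists>!c. Poly_Mapping.keys c \<subseteq> B \<and> x - lincomb sV (\<lambda>b. b) c \<in> ?W) \<longleftrightarrow>
        (\<exists>!c. Poly_Mapping.keys c \<subseteq> B \<and> \<Phi> x = lincomb sW \<Phi> c)" if "x \<in> V" for x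
      by (rule arg_cong[where f = Ex1], rule ext) (use inW[OF that True] in blast)
    then show ?thesis using True by (simp add: quotient_basis_def)
  qed (simp add: quotient_basis_def)
  have unique_card: "card B = L.vs2.dim (\<Phi> ` V)" if B: "quotient_basis sV V ?W B (\<lambda>b. b)" for B
  proof -
    have BV: "B \<subseteq> V" and ex1: "\<And>x. x \<in> V \<Longrightarrow> \<exists>!c. Poly_Mapping.keys c \<subseteq> B \<and> \<Phi> x = lincomb sW \<Phi> c"
      using B unfolding qb by blast+
    have uniq: "c = c'" if "x \<in> V" "Poly_Mapping.keys c \<subseteq> B" "\<Phi> x = lincomb sW \<Phi> c"
      "Poly_Mapping.keys c' \<subseteq> B" "\<Phi> x = lincomb sW \<Phi> c'" for x c c'
      using ex1[OF that(1)] that by blast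
    have inj: "inj_on \<Phi> B"
    proof (rule inj_onI)
      fix b b' assume b: "b \<in> B" "b' \<in> B" "\<Phi> b = \<Phi> b'"
      have "Poly_Mapping.single b (1::'f) = Poly_Mapping.single b' 1"
        by (rule uniq[of b]) (use b BV in auto)
      then have "Poly_Mapping.lookup (Poly_Mapping.single b (1::'f)) b = Poly_Mapping.lookup (Poly_Mapping.single b' 1) b" by simp
      then show "b = b'" by (simp add: lookup_single when_def split: if_splits)
    qed
    have ind: "L.vs2.independent (\<Phi> ` B)"
    proof (rule ccontr)
      assume "\<not> ?thesis"
      then have "\<exists>t u. finite t \<and> t \<subseteq> \<Phi> ` B \<and> (\<Sum>v\<in>t. sW (u v) v) = 0 \<and> (\<exists>v\<in>t. u v \<noteq> 0)"
        unfolding L.vs2.dependent_explicit by (simp only: not_not)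
      then obtain t u v0 where t: "finite t" "t \<subseteq> \<Phi> ` B" "(\<Sum>v\<in>t. sW (u v) v) = 0" "v0 \<in> t" "u v0 \<noteq> 0"
        by (elim exE conjE bexE)
      define g where "g = inv_into B \<Phi>"
      have g: "g v \<in> B" "\<Phi> (g v) = v" if "v \<in> t" for v
        using that t(2) unfolding g_def by (auto intro: inv_into_into f_inv_into_f)
      have gi: "g v = g v0 \<longleftrightarrow> v = v0" if "v \<in> t" for v using g[OF that] g[OF t(4)] by metis
      define c where "c = (\<Sum>v\<in>t. Poly_Mapping.single (g v) (u v))"
      have lk: "Poly_Mapping.lookup c (g v0) = u v0"
        unfolding c_def lookup_sum using t(1,4) gi
        by (simp add: lookup_single when_def sum.delta cong: sum.cong)
      have keys: "Poly_Mapping.keys c \<subseteq> B"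
      proof -
        have "Poly_Mapping.keys c \<subseteq> (\<Union>v\<in>t. Poly_Mapping.keys (Poly_Mapping.single (g v) (u v)))"
          unfolding c_def by (rule keys_sum)
        also have "\<dots> \<subseteq> B" using g by auto
        finally show ?thesis .
      qed
      have "lincomb sW \<Phi> c = (\<Sum>v\<in>t. sW (u v) v)"
        unfolding c_def L.vs2.lincomb_sum using g by (intro sum.cong) simp_all
      then have z: "lincomb sW \<Phi> c = 0" using t(3) by simp
      have "c = 0"
        by (rule uniq[of 0]) (use L.vs1.subspace_0[OF V] keys z in \<open>simp_all add: L.zero lincomb_def\<close>)
      then show False using lk t(5) by simp
    qed
    have "\<Phi> ` V \<subseteq> L.vs2.span (\<Phi> ` B)"
    proof
      fix y assume "y \<in> \<Phi> ` V"
      then obtain c where c: "Poly_Mapping.keys c \<subseteq> B" "y = lincomb sW \<Phi> c" using ex1 by blast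
      show "y \<in> L.vs2.span (\<Phi> ` B)"
        unfolding c(2) lincomb_def using c(1)
        by (intro L.vs2.span_sum L.vs2.span_scale L.vs2.span_base) auto
    qed
    then have "card (\<Phi> ` B) = L.vs2.dim (\<Phi> ` V)"
      using L.vs2.basis_card_eq_dim[of "\<Phi> ` B" "\<Phi> ` V"] ind BV by blast
    then show ?thesis using card_image[OF inj] by simp
  qed
  have ex: "\<exists>B. quotient_basis sV V ?W B (\<lambda>b. b)"
  proof -
    obtain C where C: "C \<subseteq> \<Phi> ` V" "L.vs2.independent C" "\<Phi> ` V \<subseteq> L.vs2.span C"
      using L.vs2.basis_exists[of "\<Phi> ` V"] by metis
    have "C \<subseteq> L.vs2.span T" using C(1) T(2) by (rule subset_trans)
    then have finC: "finite C" using L.vs2.independent_span_bound[OF T(1) C(2)] by blast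
    define g where "g = inv_into V \<Phi>"
    have g: "g y \<in> V" "\<Phi> (g y) = y" if "y \<in> C" for y
      using that C(1) unfolding g_def by (auto intro: inv_into_into f_inv_into_f)
    have ginj: "inj_on g C" by (rule inj_onI) (metis g(2))
    have lcC: "lincomb sW \<Phi> c = (\<Sum>y\<in>C. sW (Poly_Mapping.lookup c (g y)) y)"
      if "Poly_Mapping.keys c \<subseteq> g ` C" for c
    proof -
      have "lincomb sW \<Phi> c = (\<Sum>b\<in>g ` C. sW (Poly_Mapping.lookup c b) (\<Phi> b))"
        by (rule L.vs2.lincomb_superset) (use finC that in auto)
      also have "\<dots> = (\<Sum>y\<in>C. sW (Poly_Mapping.lookup c (g y)) y)"
        unfolding sum.reindex[OF ginj] using g by (intro sum.cong) simp_all
      finally show ?thesis .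
    qed
    have exu: "\<exists>!c. Poly_Mapping.keys c \<subseteq> g ` C \<and> \<Phi> x = lincomb sW \<Phi> c" if x: "x \<in> V" for x
    proof (rule ex_ex1I)
      have "\<Phi> x \<in> L.vs2.span C" using C(3) x by blast
      then obtain r where r: "\<Phi> x = (\<Sum>y\<in>C. sW (r y) y)"
        unfolding L.vs2.span_finite[OF finC] by blast
      define c where "c = (\<Sum>y\<in>C. Poly_Mapping.single (g y) (r y))"
      have "Poly_Mapping.keys c \<subseteq> (\<Union>y\<in>C. Poly_Mapping.keys (Poly_Mapping.single (g y) (r y)))"
        unfolding c_def by (rule keys_sum)
      also have "\<dots> \<subseteq> g ` C" by auto
      finally have "Poly_Mapping.keys c \<subseteq> g ` C" .
      moreover have "lincomb sW \<Phi> c = \<Phi> x"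
        unfolding c_def L.vs2.lincomb_sum r using g by (intro sum.cong) simp_all
      ultimately show "\<exists>c. Poly_Mapping.keys c \<subseteq> g ` C \<and> \<Phi> x = lincomb sW \<Phi> c" by metis
    next
      fix c c' assume c: "Poly_Mapping.keys c \<subseteq> g ` C \<and> \<Phi> x = lincomb sW \<Phi> c"
        "Poly_Mapping.keys c' \<subseteq> g ` C \<and> \<Phi> x = lincomb sW \<Phi> c'"
      have "lincomb sW \<Phi> c = lincomb sW \<Phi> c'" using c by metis
      then have "(\<Sum>y\<in>C. sW (Poly_Mapping.lookup c (g y) - Poly_Mapping.lookup c' (g y)) y) = 0"
        using lcC[of c] lcC[of c'] c by (simp add: L.vs2.scale_left_diff_distrib sum_subtractf)
      then have z: "Poly_Mapping.lookup c (g y) - Poly_Mapping.lookup c' (g y) = 0" if "y \<in> C" for y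
        by (rule L.vs2.independentD[OF C(2) finC subset_refl _ that])
      show "c = c'"
      proof (rule poly_mapping_eqI)
        fix b
        show "Poly_Mapping.lookup c b = Poly_Mapping.lookup c' b"
        proof (cases "b \<in> g ` C")
          case True
          then show ?thesis using z by auto
        next
          case False
          then have "b \<notin> Poly_Mapping.keys c" "b \<notin> Poly_Mapping.keys c'" using c by blast+
          then show ?thesis by (simp add: in_keys_iff)
        qed
      qed
    qed
    have gC: "g ` C \<subseteq> V" using g by auto
    show ?thesis unfolding qb by (rule exI[of _ "g ` C"]) (intro conjI ballI gC exu)
  qed
  show ?thesis unfolding quotient_dim_def by (rule unique_card[OF someI_ex[OF ex]])
qed

context assoc_or_lie_algebra
begin

definition fscale :: "'f \<Rightarrow> ((nat \<Rightarrow> 'a) \<Rightarrow> 'a) \<Rightarrow> ((nat \<Rightarrow> 'a) \<Rightarrow> 'a)" where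
  "fscale c f = (\<lambda>a. scale c (f a))"

lemma vector_space_fscale: "vector_space fscale"
  by unfold_locales
     (auto simp: fscale_def fun_eq_iff scale_right_distrib scale_left_distrib)

sublocale fn: vector_space fscale
  by (rule vector_space_fscale)

section \<open>Dimensions of spaces of multilinear functions\<close>

lemma sum_fun_apply: "(\<Sum>i\<in>I. f i) a = (\<Sum>i\<in>I. f i a)"
  by (induction I rule: infinite_finite_induct) auto

text \<open>Restriction to \<open>Z\<close> is injective on \<open>R\<close>, and the functions on \<open>Z\<close> have dimension \<open>card Z * card Basis\<close>.\<close>
lemma finite_spanning_by_evaluation:
  assumes R: "fn.subspace R" and Z: "finite Z" and zero: "\<And>f. f \<in> R \<Longrightarrow> (\<And>z. z \<in> Z \<Longrightarrow> f z = 0) \<Longrightarrow> f = 0"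
  shows "fn.dim R \<le> card Z * card Basis" "\<exists>T. finite T \<and> R \<subseteq> fn.span T"
proof -
  interpret ff: vector_space_pair fscale fscale ..
  define \<rho> where "\<rho> f = (\<lambda>z. if z \<in> Z then f z else 0)" for f :: "(nat \<Rightarrow> 'a) \<Rightarrow> 'a"
  have lrho: "Vector_Spaces.linear fscale fscale \<rho>"
    by (auto simp: Vector_Spaces.linear_iff vector_space_fscale \<rho>_def fscale_def fun_eq_iff)
  define e where "e z b = (\<lambda>y. if y = z then b else (0::'a))" for z :: "nat \<Rightarrow> 'a" and b
  let ?T = "(\<lambda>(z, b). e z b) ` (Z \<times> Basis)"
  have finT: "finite ?T" using Z finite_Basis by simp
  have cT: "card ?T \<le> card Z * card Basis"
    using card_image_le[of "Z \<times> Basis" "\<lambda>(z, b). e z b"] Z finite_Basis by (simp add: card_cartesian_product)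
  have rT: "\<rho> f \<in> fn.span ?T" for f
  proof -
    have "\<rho> f = (\<Sum>z\<in>Z. \<Sum>b\<in>Basis. fscale (representation Basis (f z) b) (e z b))"
    proof
      fix y
      have "(\<Sum>z\<in>Z. \<Sum>b\<in>Basis. fscale (representation Basis (f z) b) (e z b)) y
          = (\<Sum>z\<in>Z. \<Sum>b\<in>Basis. if y = z then scale (representation Basis (f z) b) b else 0)"
        unfolding sum_fun_apply by (intro sum.cong) (auto simp: fscale_def e_def)
      also have "\<dots> = (\<Sum>z\<in>Z. if y = z then f z else 0)"
        by (intro sum.cong refl) (auto simp: span_rep_sum[OF basis_UNIV])
      also have "\<dots> = \<rho> f y" using Z by (simp add: \<rho>_def sum.delta')
      finally show "\<rho> f y = (\<Sum>z\<in>Z. \<Sum>b\<in>Basis. fscale (representation Basis (f z) b) (e z b)) y" by simp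
    qed
    also have "\<dots> \<in> fn.span ?T"
      by (intro fn.span_sum fn.span_scale fn.span_base) auto
    finally show ?thesis .
  qed
  obtain C where C: "C \<subseteq> R" "fn.independent C" "R \<subseteq> fn.span C" "card C = fn.dim R"
    using fn.basis_exists[of R] by metis
  have spC: "fn.span C \<subseteq> R" by (rule fn.span_minimal[OF C(1) R])
  have inj: "inj_on \<rho> (fn.span C)"
  proof (rule inj_onI)
    fix f g assume fg: "f \<in> fn.span C" "g \<in> fn.span C" "\<rho> f = \<rho> g"
    then have "f - g \<in> R" using spC fn.subspace_diff[OF R] by blast
    moreover have "(f - g) z = 0" if "z \<in> Z" for z
      using fun_cong[OF fg(3), of z] that by (simp add: \<rho>_def)
    ultimately have "f - g = 0" by (rule zero)
    then show "f = g" by simp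
  qed
  have "fn.independent (\<rho> ` C)" by (rule ff.linear_independent_injective_image[OF lrho C(2) inj])
  moreover have "\<rho> ` C \<subseteq> fn.span ?T" using rT by blast
  ultimately have "finite (\<rho> ` C) \<and> card (\<rho> ` C) \<le> card ?T"
    by (rule fn.independent_span_bound[OF finT])
  moreover have injC: "inj_on \<rho> C" by (rule inj_on_subset[OF inj fn.span_superset])
  ultimately have "finite C" "card C \<le> card ?T" by (auto simp: card_image finite_image_iff)
  then show "fn.dim R \<le> card Z * card Basis" "\<exists>T. finite T \<and> R \<subseteq> fn.span T" using C cT by auto
qed

text \<open>
  The coordinates outside \<open>{1..n}\<close> are set to \<open>0\<close> in order to make the set finite; functions in the
  variables \<open>1, \<dots>, n\<close> do not depend on them.
\<close>
definition grid :: "nat \<Rightarrow> (nat \<Rightarrow> 'a set) \<Rightarrow> (nat \<Rightarrow> 'a) set" where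
  "grid n B = (\<lambda>g i. if i \<in> {1..n} then g i else 0) ` PiE {1..n} B"

lemma grid_mem: "(\<And>i. i \<in> {1..n} \<Longrightarrow> a i \<in> B i) \<Longrightarrow> (\<lambda>i. if i \<in> {1..n} then a i else 0) \<in> grid n B"
  unfolding grid_def by (rule image_eqI[of _ _ "restrict a {1..n}"]) auto

lemma finite_grid: "(\<And>i. finite (B i)) \<Longrightarrow> finite (grid n B)"
  unfolding grid_def by (intro finite_imageI finite_PiE) auto

lemma card_grid_le: "(\<And>i. finite (B i)) \<Longrightarrow> card (grid n B) \<le> (\<Prod>i\<in>{1..n}. card (B i))"
  unfolding grid_def using card_image_le[OF finite_PiE[of "{1..n}" B]] by (simp add: card_PiE)

lemma multilin_zero_on_basis:
  assumes f: "multilin Ops S f" and Ops: "\<And>\<phi>. \<phi> \<in> Ops \<Longrightarrow> lin \<phi>" and B: "span B = UNIV"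
    and z: "\<And>a. (\<And>i. i \<in> S \<Longrightarrow> a i \<in> B) \<Longrightarrow> f a = 0"
  shows "f a = 0"
proof -
  have finS: "finite S" using multilin_finite[OF f] by blast
  have "T \<subseteq> S \<Longrightarrow> (\<forall>i\<in>S - T. a i \<in> B) \<Longrightarrow> f a = 0" if "finite T" for T a
    using that
  proof (induction T arbitrary: a rule: finite_induct)
    case empty
    then show ?case using z by simp
  next
    case (insert t T)
    have "lin (\<lambda>v. f (a(t := v)))" using multilin_lin[OF f Ops, of t] insert.prems by auto
    moreover have "lin (\<lambda>v. 0)" by (rule linI) auto
    ultimately have "f (a(t := v)) = 0" for v
    proof (rule lin_eqI_basis[OF _ _ B])
      fix b assume "b \<in> B"
      then show "f (a(t := b)) = 0" using insert.prems by (intro insert.IH) auto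
    qed
    from this[of "a t"] show ?case by simp
  qed
  from this[OF finS, of a] show ?thesis by simp
qed

lemma multilin_zero_on_grid:
  assumes f: "multilin Ops {1..n} f" and Ops: "\<And>\<phi>. \<phi> \<in> Ops \<Longrightarrow> lin \<phi>" and B: "span B = UNIV"
    and z: "\<And>a. a \<in> grid n (\<lambda>_. B) \<Longrightarrow> f a = 0"
  shows "f = 0"
proof
  fix a
  have "f a = 0"
  proof (rule multilin_zero_on_basis[OF f Ops B])
    fix a assume "\<And>i. i \<in> {1..n} \<Longrightarrow> a i \<in> B"
    then have "f (\<lambda>i. if i \<in> {1..n} then a i else 0) = 0" by (intro z grid_mem)
    moreover have "f (\<lambda>i. if i \<in> {1..n} then a i else 0) = f a" by (rule multilin_cong[OF f]) simp
    ultimately show "f a = 0" by simp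
  qed auto
  then show "f a = 0 a" by simp
qed

lemma dim_le_power:
  assumes R: "fn.subspace R" and ml: "\<And>f. f \<in> R \<Longrightarrow> multilin Ops {1..n} f" and Ops: "\<And>\<phi>. \<phi> \<in> Ops \<Longrightarrow> lin \<phi>"
  shows "fn.dim R \<le> card Basis ^ n * card Basis" "\<exists>T. finite T \<and> R \<subseteq> fn.span T"
proof -
  let ?Z = "grid n (\<lambda>_. Basis)"
  have fin: "finite ?Z" by (rule finite_grid) (rule finite_Basis)
  have zero: "f = 0" if "f \<in> R" "\<And>z. z \<in> ?Z \<Longrightarrow> f z = 0" for f
    by (rule multilin_zero_on_grid[OF ml[OF that(1)] Ops basis_UNIV(2) that(2)])
  note fs = finite_spanning_by_evaluation[OF R fin zero]
  have "card ?Z \<le> card Basis ^ n" using card_grid_le[of "\<lambda>_. Basis" n] finite_Basis by simp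
  then show "fn.dim R \<le> card Basis ^ n * card Basis" using fs(1) by (meson le_trans mult_le_mono1)
  show "\<exists>T. finite T \<and> R \<subseteq> fn.span T" by (rule fs(2))
qed

lemma extend_to_basis:
  assumes "independent E"
  obtains B where "E \<subseteq> B" "independent B" "span B = UNIV" "finite B" "card B = card Basis"
proof -
  let ?B = "extend_basis E"
  have B: "E \<subseteq> ?B" "independent ?B" "span ?B = UNIV"
    using extend_basis_superset[OF assms] independent_extend_basis[OF assms] span_extend_basis[OF assms] by auto
  moreover have "finite ?B" using B(2) by (rule finiteI_independent)
  moreover have "card ?B = card Basis"
    using basis_card_eq_dim[of ?B UNIV] B dim_UNIV by simp
  ultimately show ?thesis using that by blast
qed

text \<open>
  If \<open>I = J\<close>, choose a basis that contains some \<open>e\<close> in \<open>I\<close>: the functions vanish at basis tuples that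
  contain \<open>e\<close> twice, so the tuples with \<open>e\<close> at no more than one place determine them. If \<open>I\<close> and \<open>J\<close>
  are disjoint, choose a basis that contains \<open>e\<close> in \<open>I\<close> and \<open>e'\<close> in \<open>J\<close>: the tuples that avoid \<open>e\<close> or
  avoid \<open>e'\<close> determine the functions.
\<close>
lemma dim_le_annihilating_ideals:
  assumes R: "fn.subspace R" and ml: "\<And>f. f \<in> R \<Longrightarrow> multilin Ops {1..n} f" and Ops: "\<And>\<phi>. \<phi> \<in> Ops \<Longrightarrow> lin \<phi>"
    and I: "stable_ideal Ops I" "I \<noteq> {0}" and J: "stable_ideal Ops J" "J \<noteq> {0}"
    and IJ: "I = J \<or> I \<inter> J = {0}" "\<And>x y. x \<in> I \<Longrightarrow> y \<in> J \<Longrightarrow> mul x y = 0 \<and> mul y x = 0"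
    and n: "n \<ge> 1"
  shows "fn.dim R \<le> 2 * n * card Basis ^ 2 * (card Basis - 1) ^ (n - 1)"
proof -
  let ?d = "card Basis"
  obtain e where e: "e \<in> I" "e \<noteq> 0" using I(2) subspace_0[OF stable_idealD(1)[OF I(1)]] by blast
  obtain Z where Z: "finite Z" "card Z \<le> 2 * n * ?d * (?d - 1) ^ (n - 1)"
    "\<And>f. f \<in> R \<Longrightarrow> (\<And>z. z \<in> Z \<Longrightarrow> f z = 0) \<Longrightarrow> f = 0"
  proof (cases "I = J")
    case True
    have "independent {e}" using e(2) by simp
    then obtain B where B: "{e} \<subseteq> B" "independent B" "span B = UNIV" "finite B" "card B = ?d"
      by (rule extend_to_basis)
    define G where "G p = grid n (\<lambda>i. if i = p then B else B - {e})" for p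
    have finG: "finite (G p)" for p unfolding G_def using B(4) by (intro finite_grid) auto
    have cG: "card (G p) \<le> ?d * (?d - 1) ^ (n - 1)" if p: "p \<in> {1..n}" for p
    proof -
      have "card (G p) \<le> (\<Prod>i\<in>{1..n}. card (if i = p then B else B - {e}))"
        unfolding G_def using B(4) by (intro card_grid_le) auto
      also have "\<dots> = card B * (\<Prod>i\<in>{1..n} - {p}. card (B - {e}))"
        using p by (subst prod.remove[of _ p]) (auto intro!: prod.cong)
      also have "\<dots> = ?d * (?d - 1) ^ (n - 1)" using B p by simp
      finally show ?thesis .
    qed
    let ?Z = "\<Union>p\<in>{1..n}. G p"
    have cZ: "card ?Z \<le> n * (?d * (?d - 1) ^ (n - 1))"
    proof -
      have "card ?Z \<le> (\<Sum>p\<in>{1..n}. card (G p))" by (rule card_UN_le) simp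
      also have "\<dots> \<le> (\<Sum>p\<in>{1..n}. ?d * (?d - 1) ^ (n - 1))" by (intro sum_mono cG)
      finally show ?thesis by simp
    qed
    have zero: "f = 0" if f: "f \<in> R" "\<And>z. z \<in> ?Z \<Longrightarrow> f z = 0" for f
    proof (rule multilin_zero_on_grid[OF ml[OF f(1)] Ops B(3)])
      fix a assume "a \<in> grid n (\<lambda>_. B)"
      then obtain g where g: "g \<in> PiE {1..n} (\<lambda>_. B)" "a = (\<lambda>i. if i \<in> {1..n} then g i else 0)"
        unfolding grid_def by blast
      have aB: "a i \<in> B" if "i \<in> {1..n}" for i using g that by auto
      show "f a = 0"
      proof (cases "\<exists>p q. p \<in> {1..n} \<and> q \<in> {1..n} \<and> p \<noteq> q \<and> a p = e \<and> a q = e")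
        case True
        then obtain p q where pq: "p \<in> {1..n}" "q \<in> {1..n}" "p \<noteq> q" "a p = e" "a q = e" by blast
        show ?thesis
          by (rule multilin_annihilating_ideals[OF ml[OF f(1)] I(1) J(1) IJ(2) pq(1-3)])
             (use pq e \<open>I = J\<close> in auto)
      next
        case False
        obtain p where p: "p \<in> {1..n}" "\<And>i. i \<in> {1..n} \<Longrightarrow> i \<noteq> p \<Longrightarrow> a i \<noteq> e"
        proof (cases "\<exists>p\<in>{1..n}. a p = e")
          case True
          then show ?thesis using False that by blast
        next
          case False
          then show ?thesis using that[of 1] n by auto
        qed
        have Gp: "(\<lambda>i. if i \<in> {1..n} then a i else 0) \<in> G p"
          unfolding G_def by (rule grid_mem) (use aB p in auto)
        have aa: "(\<lambda>i. if i \<in> {1..n} then a i else 0) = a" using g(2) by auto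
        have "a \<in> ?Z" using Gp p(1) unfolding aa by blast
        then show ?thesis by (rule f(2))
      qed
    qed
    show ?thesis
    proof (rule that[of ?Z])
      show "finite ?Z" using finG by simp
      show "card ?Z \<le> 2 * n * ?d * (?d - 1) ^ (n - 1)" using cZ by (simp add: mult.assoc)
    qed (rule zero)
  next
    case False
    then have IJ0: "I \<inter> J = {0}" using IJ(1) by blast
    obtain e' where e': "e' \<in> J" "e' \<noteq> 0" using J(2) subspace_0[OF stable_idealD(1)[OF J(1)]] by blast
    have ne: "e \<noteq> e'" using e e' IJ0 by blast
    have "e' \<notin> span {e}"
    proof
      assume "e' \<in> span {e}"
      then have "e' \<in> I" using span_minimal[of "{e}" I] e(1) stable_idealD(1)[OF I(1)] by blast
      then show False using e' IJ0 by blast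
    qed
    then have "independent {e', e}" using e(2) by (intro independent_insertI) (auto simp: independent_empty)
    then obtain B where B: "{e', e} \<subseteq> B" "independent B" "span B = UNIV" "finite B" "card B = ?d"
      by (rule extend_to_basis)
    let ?Z = "grid n (\<lambda>_. B - {e}) \<union> grid n (\<lambda>_. B - {e'})"
    have c1: "card (grid n (\<lambda>_. B - {x})) \<le> (?d - 1) ^ n" if "x \<in> B" for x
      using card_grid_le[of "\<lambda>_. B - {x}" n] B that by simp
    have "card ?Z \<le> card (grid n (\<lambda>_. B - {e})) + card (grid n (\<lambda>_. B - {e'}))" by (rule card_Un_le)
    also have "\<dots> \<le> 2 * (?d - 1) ^ n" using c1[of e] c1[of e'] B(1) by simp
    also have "\<dots> = 2 * ((?d - 1) * (?d - 1) ^ (n - 1))" using n by (simp add: power_eq_if)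
    also have "\<dots> \<le> 2 * ((n * ?d) * (?d - 1) ^ (n - 1))"
    proof -
      have "?d - 1 \<le> ?d" by simp
      also have "\<dots> \<le> n * ?d" using n by simp
      finally show ?thesis by (intro mult_le_mono2 mult_le_mono1)
    qed
    finally have cZ: "card ?Z \<le> 2 * n * ?d * (?d - 1) ^ (n - 1)" by (simp add: mult.assoc)
    have zero: "f = 0" if f: "f \<in> R" "\<And>z. z \<in> ?Z \<Longrightarrow> f z = 0" for f
    proof (rule multilin_zero_on_grid[OF ml[OF f(1)] Ops B(3)])
      fix a assume "a \<in> grid n (\<lambda>_. B)"
      then obtain g where g: "g \<in> PiE {1..n} (\<lambda>_. B)" "a = (\<lambda>i. if i \<in> {1..n} then g i else 0)"
        unfolding grid_def by blast
      have aB: "a i \<in> B" if "i \<in> {1..n}" for i using g that by auto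
      have aa: "(\<lambda>i. if i \<in> {1..n} then a i else 0) = a" using g(2) by auto
      show "f a = 0"
      proof (cases "(\<exists>p\<in>{1..n}. a p = e) \<and> (\<exists>q\<in>{1..n}. a q = e')")
        case True
        then obtain p q where pq: "p \<in> {1..n}" "q \<in> {1..n}" "a p = e" "a q = e'" by blast
        then have "p \<noteq> q" using ne by auto
        show ?thesis
          by (rule multilin_annihilating_ideals[OF ml[OF f(1)] I(1) J(1) IJ(2) pq(1,2) \<open>p \<noteq> q\<close>])
             (use pq e e' in auto)
      next
        case False
        then consider "\<And>i. i \<in> {1..n} \<Longrightarrow> a i \<noteq> e" | "\<And>i. i \<in> {1..n} \<Longrightarrow> a i \<noteq> e'" by blast
        then have "a \<in> ?Z"
        proof cases
          case 1
          then have "(\<lambda>i. if i \<in> {1..n} then a i else 0) \<in> grid n (\<lambda>_. B - {e})"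
            using aB by (intro grid_mem) auto
          then show ?thesis unfolding aa by blast
        next
          case 2
          then have "(\<lambda>i. if i \<in> {1..n} then a i else 0) \<in> grid n (\<lambda>_. B - {e'})"
            using aB by (intro grid_mem) auto
          then show ?thesis unfolding aa by blast
        qed
        then show ?thesis by (rule f(2))
      qed
    qed
    show ?thesis
    proof (rule that[OF _ cZ])
      show "finite ?Z" using B(4) by (intro finite_UnI finite_grid) auto
    qed (rule zero)
  qed
  have "fn.dim R \<le> card Z * ?d" by (rule finite_spanning_by_evaluation(1)[OF R Z(1) Z(3)])
  also have "\<dots> \<le> (2 * n * ?d * (?d - 1) ^ (n - 1)) * ?d" by (rule mult_le_mono1[OF Z(2)])
  also have "\<dots> = 2 * n * ?d ^ 2 * (?d - 1) ^ (n - 1)" by (simp add: power2_eq_square mult_ac)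
  finally show ?thesis .
qed

text \<open>
  In a linear relation among the \<open>G w\<close>, let \<open>w\<close> be \<open>r\<close>-minimal among the indices of nonzero coefficients.
  At \<open>pt w\<close> all other terms vanish, but the term of \<open>w\<close> does not.
\<close>
lemma dim_ge_triangular:
  assumes R: "fn.subspace R" and T: "finite T" "R \<subseteq> fn.span T" and W: "finite W" "wf r"
    and G: "\<And>w. w \<in> W \<Longrightarrow> G w \<in> R" "\<And>w. w \<in> W \<Longrightarrow> G w (pt w) \<noteq> 0"
    and tri: "\<And>w w'. w \<in> W \<Longrightarrow> w' \<in> W \<Longrightarrow> G w (pt w') \<noteq> 0 \<Longrightarrow> w = w' \<or> (w, w') \<in> r"
  shows "card W \<le> fn.dim R"
proof -
  have coeff: "\<forall>w\<in>W. c w = 0" if c: "(\<Sum>w\<in>W. fscale (c w) (G w)) = 0" for c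
  proof (rule ccontr)
    assume "\<not> ?thesis"
    then obtain w0 where w0: "w0 \<in> {w \<in> W. c w \<noteq> 0}" by blast
    have "\<exists>z\<in>{w \<in> W. c w \<noteq> 0}. \<forall>y. (y, z) \<in> r \<longrightarrow> y \<notin> {w \<in> W. c w \<noteq> 0}"
      by (rule W(2)[unfolded wf_eq_minimal, rule_format, OF w0])
    then obtain w where w': "w \<in> {w \<in> W. c w \<noteq> 0}" "\<forall>y. (y, w) \<in> r \<longrightarrow> y \<notin> {w \<in> W. c w \<noteq> 0}"
      by (rule bexE)
    have w: "w \<in> W" "c w \<noteq> 0" "\<And>v. (v, w) \<in> r \<Longrightarrow> \<not> (v \<in> W \<and> c v \<noteq> 0)"
      using w' by simp_all
    have "0 = (\<Sum>v\<in>W. fscale (c v) (G v)) (pt w)" using c by simp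
    also have "\<dots> = (\<Sum>v\<in>W. scale (c v) (G v (pt w)))" by (simp add: sum_fun_apply fscale_def)
    also have "\<dots> = (\<Sum>v\<in>{w}. scale (c v) (G v (pt w)))"
    proof (rule sum.mono_neutral_right[OF W(1)])
      show "\<forall>v\<in>W - {w}. scale (c v) (G v (pt w)) = 0"
      proof
        fix v assume "v \<in> W - {w}"
        then show "scale (c v) (G v (pt w)) = 0"
          using tri[of v w] w by (cases "G v (pt w) = 0") auto
      qed
    qed (use w in auto)
    finally show False using w G(2)[OF w(1)] by simp
  qed
  have inj: "inj_on G W"
  proof (rule inj_onI, rule ccontr)
    fix u v assume uv: "u \<in> W" "v \<in> W" "G u = G v" "u \<noteq> v"
    let ?c = "\<lambda>w. if w = u then 1 else if w = v then - 1 else (0::'f)"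
    have "(\<Sum>w\<in>W. fscale (?c w) (G w)) = (\<Sum>w\<in>{u, v}. fscale (?c w) (G w))"
      using uv W(1) by (intro sum.mono_neutral_right) auto
    also have "\<dots> = 0" using uv by simp
    finally have "?c u = 0" using coeff[of ?c] uv(1) by blast
    then show False by simp
  qed
  have ind: "fn.independent (G ` W)"
  proof
    assume "fn.dependent (G ` W)"
    then obtain u where u: "\<exists>v\<in>G ` W. u v \<noteq> 0" "(\<Sum>v\<in>G ` W. fscale (u v) v) = 0"
      using fn.dependent_finite[of "G ` W"] W(1) by auto
    have "(\<Sum>w\<in>W. fscale (u (G w)) (G w)) = 0" using u(2) unfolding sum.reindex[OF inj] by (simp only: comp_def)
    from coeff[OF this] show False using u(1) by auto
  qed
  obtain C where C: "C \<subseteq> R" "fn.independent C" "R \<subseteq> fn.span C" "card C = fn.dim R"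
    using fn.basis_exists[of R] by metis
  have "finite C" using fn.independent_span_bound[OF T(1) C(2)] C(1) T(2) by blast
  then have "card (G ` W) \<le> card C"
    using fn.independent_span_bound[OF _ ind, of C] G(1) C(3) by blast
  then show ?thesis using C(4) card_image[OF inj] by simp
qed

end

section \<open>Limits of roots\<close>

lemma root_mult_power_tendsto:
  assumes "C > 0" "d \<ge> 0"
  shows "(\<lambda>n. root n (C * d ^ n)) \<longlonglongrightarrow> d"
proof -
  have "(\<lambda>n. root n C * d) \<longlonglongrightarrow> 1 * d"
    by (intro tendsto_mult LIMSEQ_root_const assms tendsto_const)
  moreover have "eventually (\<lambda>n. root n C * d = root n (C * d ^ n)) sequentially"
    using eventually_gt_at_top[of 0]
    by eventually_elim (use assms in \<open>simp add: real_root_mult real_root_power_cancel\<close>)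
  ultimately show ?thesis using Lim_transform_eventually by fastforce
qed

text \<open>
  If the limit were \<open>d\<close>, then \<open>(d - 1/2)\<^sup>n\<close> would eventually be at most \<open>C n (d - 1)\<^sup>n\<^sup>-\<^sup>1\<close>, but the ratio
  of the latter to the former tends to zero.
\<close>
lemma not_has_PIexp_of_small:
  assumes d: "d \<ge> 1" and c: "\<And>n. n \<ge> 1 \<Longrightarrow> c n \<le> C * n * (d - 1) ^ (n - 1)"
  shows "\<not> has_PIexp c (real d)"
proof
  assume "has_PIexp c (real d)"
  then have "(\<lambda>n. root n (real (c n))) \<longlonglongrightarrow> real d" by (simp add: has_PIexp_def)
  then have "eventually (\<lambda>n. root n (real (c n)) > real d - 1 / 2) sequentially"
    by (rule order_tendstoD) simp
  then have ev: "eventually (\<lambda>n. (real d - 1 / 2) ^ n \<le> real C * real n * (real d - 1) ^ (n - 1)) sequentially"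
    using eventually_gt_at_top[of 0]
  proof eventually_elim
    case (elim n)
    have "(real d - 1 / 2) ^ n \<le> root n (real (c n)) ^ n" using elim d by (intro power_mono) auto
    also have "\<dots> = real (c n)" using elim by simp
    also have "\<dots> \<le> real (C * n * (d - 1) ^ (n - 1))" using c[of n] elim by (intro of_nat_mono) auto
    also have "\<dots> = real C * real n * (real d - 1) ^ (n - 1)" using d by (simp add: of_nat_diff)
    finally show ?case .
  qed
  define q where "q = (real d - 1) / (real d - 1 / 2)"
  have q: "0 \<le> q" "q < 1" using d by (auto simp: q_def field_simps)
  \<comment> \<open>The index is shifted by one to get rid of the exponent \<open>n - 1\<close>.\<close>
  have "(\<lambda>n. real n * q ^ n) \<longlonglongrightarrow> 0" using q by (intro powser_times_n_limit_0) auto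
  then have "(\<lambda>n. real (Suc n) * q ^ Suc n) \<longlonglongrightarrow> 0" by (rule LIMSEQ_Suc)
  have lim: "(\<lambda>n. real C * (real n * q ^ n + q ^ n)) \<longlonglongrightarrow> real C * (0 + 0)"
    using q by (intro tendsto_intros \<open>(\<lambda>n. real n * q ^ n) \<longlonglongrightarrow> 0\<close> LIMSEQ_realpow_zero) auto
  have "eventually (\<lambda>n. (real d - 1 / 2) ^ Suc n \<le> real C * real (Suc n) * (real d - 1) ^ n) sequentially"
    using ev[folded eventually_sequentially_Suc[where P = "\<lambda>n. (real d - 1 / 2) ^ n \<le> real C * real n * (real d - 1) ^ (n - 1)"]] by simp
  then have "eventually (\<lambda>n. 1 / 2 \<le> real C * (real n * q ^ n + q ^ n)) sequentially"
  proof eventually_elim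
    case (elim n)
    have p: "(real d - 1 / 2) > 0" "real d - 1 / 2 \<ge> 1 / 2" using d by auto
    have "(real d - 1 / 2) * (real d - 1 / 2) ^ n \<le> real C * real (Suc n) * (real d - 1) ^ n" using elim by simp
    then have "real d - 1 / 2 \<le> real C * real (Suc n) * (real d - 1) ^ n / (real d - 1 / 2) ^ n"
      using p by (simp add: pos_le_divide_eq)
    also have "\<dots> = real C * (real n * q ^ n + q ^ n)"
      by (simp add: q_def power_divide algebra_simps add_divide_distrib)
    finally show ?case using p by linarith
  qed
  then have "1 / 2 \<le> real C * (0 + 0)"
    by (rule tendsto_lowerbound[OF lim _ sequentially_bot])
  then show False by simp
qed

text \<open>
  Fix a block size \<open>B\<close>, even so that columns can be paired, and let \<open>M\<close> be the number of words with \<open>B\<close>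
  copies of each of the \<open>d\<close> letters. Writing \<open>n\<close> as a bounded number plus \<open>t d B\<close>, the count of lattice words
  gives \<open>c n \<ge> M\<^sup>t\<close>, whence the lower limit of the roots is at least \<open>M\<close> to the power \<open>1 / (d B)\<close>. This
  is at least \<open>d\<close> divided by the \<open>B\<close>-th root of \<open>d B + 1\<close>, which tends to \<open>d\<close> as \<open>B\<close> grows.
\<close>
lemma has_PIexp_of_lattice_words:
  assumes d: "d \<ge> 1" and upper: "\<And>n. n \<ge> 1 \<Longrightarrow> c n \<le> d ^ n * d"
    and lower: "\<And>m K. m \<ge> N \<Longrightarrow> 1 \<le> m + d * (2 * K) \<Longrightarrow> card (lattice_words d (2 * K)) \<le> c (m + d * (2 * K))"
  shows "has_PIexp c (real d)"
  unfolding has_PIexp_def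
proof (rule order_tendstoI)
  fix x assume x: "x < real d"
  have "(\<lambda>b. real d / (real d * (2 * real b) + 1) powr (1 / (2 * real b))) \<longlonglongrightarrow> real d"
    using d by real_asymp
  then have "eventually (\<lambda>b. real d / (real d * (2 * real b) + 1) powr (1 / (2 * real b)) > x) sequentially"
    using x by (rule order_tendstoD)
  then obtain b0 where b0: "\<And>b. b \<ge> b0 \<Longrightarrow> real d / (real d * (2 * real b) + 1) powr (1 / (2 * real b)) > x"
    by (auto simp: eventually_sequentially)
  define b where "b = Suc b0"
  define B where "B = 2 * b"
  have B: "B > 0" "real B = 2 * real b" by (auto simp: B_def b_def)
  define M where "M = card (balanced_words d B)"
  have bal: "d ^ (d * B) \<le> (d * B + 1) ^ d * M" unfolding M_def by (rule card_balanced_words_ge)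
  then have M1: "M \<ge> 1" using d by (cases "M = 0") auto
  define L where "L = real M powr (1 / real (d * B))"
  have "x < L"
  proof -
    have "real d ^ (d * B) \<le> (real (d * B) + 1) ^ d * real M"
      using of_nat_mono[OF bal, where 'a = real] by (simp add: algebra_simps)
    then have "real d ^ (d * B) / (real (d * B) + 1) ^ d \<le> real M"
      by (simp add: pos_divide_le_eq add_pos_nonneg mult.commute add_nonneg_pos)
    then have "(real d ^ (d * B) / (real (d * B) + 1) ^ d) powr (1 / real (d * B)) \<le> L"
      unfolding L_def by (intro powr_mono2) auto
    moreover have "(real d ^ (d * B) / (real (d * B) + 1) ^ d) powr (1 / real (d * B))
        = real d / (real d * (2 * real b) + 1) powr (1 / (2 * real b))"
    proof -
      have "(real d ^ (d * B)) powr (1 / real (d * B)) = real d"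
        using d B by (simp add: powr_realpow[symmetric] powr_powr)
      moreover have "((real (d * B) + 1) ^ d) powr (1 / real (d * B)) = (real (d * B) + 1) powr (1 / real B)"
        using d B by (simp add: powr_realpow[symmetric] powr_powr add_nonneg_pos)
      ultimately show ?thesis using B by (simp add: powr_divide add_nonneg_pos)
    qed
    ultimately show ?thesis using b0[of b] by (simp add: b_def)
  qed
  \<comment> \<open>The sorted prefix and suffix together contain \<open>(d - 1) * B\<close> copies of each of the \<open>d\<close> letters.\<close>
  define N1 where "N1 = N + d * ((d - 1) * B)"
  define t where "t n = (n - N1) div (d * B)" for n
  have cn: "real M ^ t n \<le> real (c n)" if n: "n \<ge> N1" "n \<ge> 1" for n
  proof -
    define r where "r = (n - N1) mod (d * B)"
    define m where "m = N + r"
    define K where "K = ((d - 1) + t n) * b"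
    have K: "2 * K = (d - 1) * B + t n * B" by (simp add: K_def B_def algebra_simps)
    have "n - N1 = t n * (d * B) + r" unfolding t_def r_def by (simp only: div_mult_mod_eq)
    then have "N1 + (t n * (d * B) + r) = n" using n by simp
    moreover have "m + d * (2 * K) = N1 + (t n * (d * B) + r)"
      unfolding K m_def N1_def by (simp only: distrib_left ac_simps)
    ultimately have e: "m + d * (2 * K) = n" by simp
    have "M ^ t n \<le> card (lattice_words d (2 * K))"
      unfolding K M_def by (rule card_lattice_words_ge)
    also have "\<dots> \<le> c (m + d * (2 * K))" by (rule lower) (use e n in \<open>auto simp: m_def\<close>)
    finally have "M ^ t n \<le> c n" by (simp only: e)
    from of_nat_mono[OF this, where 'a = real] show ?thesis by simp
  qed
  have dB: "d * B > 0" using d B by simp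
  have lim: "(\<lambda>n. ((real n - u) / e - 1) / real n) \<longlonglongrightarrow> 1 / e" if "e > 0" for e u :: real
  proof -
    have "(\<lambda>n. ((real n - u) / e - 1) / real n) \<longlonglongrightarrow> inverse e" using that by real_asymp
    then show ?thesis by (simp only: inverse_eq_divide)
  qed
  have tl: "(\<lambda>n. real (t n) / real n) \<longlonglongrightarrow> 1 / real (d * B)"
  proof (rule tendsto_sandwich)
    show "eventually (\<lambda>n. ((real n - real N1) / real (d * B) - 1) / real n \<le> real (t n) / real n) sequentially"
      using eventually_ge_at_top[of N1] eventually_gt_at_top[of 0]
    proof eventually_elim
      case (elim n)
      have "real (n - N1) = real (t n) * real (d * B) + real ((n - N1) mod (d * B))"
        unfolding t_def of_nat_mult[symmetric] of_nat_add[symmetric] by (simp only: div_mult_mod_eq)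
      moreover have "real ((n - N1) mod (d * B)) \<le> real (d * B)" by (rule of_nat_mono) (rule less_imp_le[OF mod_less_divisor[OF dB]])
      ultimately have "real n - real N1 \<le> (real (t n) + 1) * real (d * B)"
        using elim by (simp add: of_nat_diff algebra_simps)
      then have "(real n - real N1) / real (d * B) \<le> real (t n) + 1"
        using dB by (simp add: pos_divide_le_eq)
      then show ?case using elim by (intro divide_right_mono) auto
    qed
    show "eventually (\<lambda>n. real (t n) / real n \<le> 1 / real (d * B)) sequentially"
      using eventually_gt_at_top[of 0]
    proof eventually_elim
      case (elim n)
      have "t n * (d * B) \<le> n - N1" unfolding t_def by simp
      then have "t n * (d * B) \<le> n" by simp
      from of_nat_mono[OF this, where 'a = real]
      have "real (t n) * real (d * B) \<le> real n" by (simp only: of_nat_mult)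
      then show ?case using elim dB by (simp add: field_simps)
    qed
    have "real (d * B) > 0" using dB by simp
    then show "(\<lambda>n. ((real n - real N1) / real (d * B) - 1) / real n) \<longlonglongrightarrow> 1 / real (d * B)"
      by (rule lim)
  qed simp
  have "(\<lambda>n. real M powr (real (t n) / real n)) \<longlonglongrightarrow> L"
    unfolding L_def using M1 by (intro tendsto_powr tl tendsto_const) auto
  then have "eventually (\<lambda>n. x < real M powr (real (t n) / real n)) sequentially"
    using \<open>x < L\<close> by (rule order_tendstoD)
  then show "eventually (\<lambda>n. x < root n (real (c n))) sequentially"
    using eventually_ge_at_top[of N1] eventually_ge_at_top[of 1]
  proof eventually_elim
    case (elim n)
    have "real M powr (real (t n) / real n) = root n (real M ^ t n)"
      using elim M1 by (simp add: root_powr_inverse powr_realpow[symmetric] powr_powr)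
    also have "\<dots> \<le> root n (real (c n))" using elim cn[of n] by simp
    finally show ?case using elim by simp
  qed
next
  fix x assume x: "real d < x"
  have "(\<lambda>n. root n (real d * real d ^ n)) \<longlonglongrightarrow> real d"
    by (rule root_mult_power_tendsto) (use d in auto)
  then have "eventually (\<lambda>n. root n (real d * real d ^ n) < x) sequentially"
    using x by (rule order_tendstoD)
  then show "eventually (\<lambda>n. root n (real (c n)) < x) sequentially"
    using eventually_ge_at_top[of 1]
  proof eventually_elim
    case (elim n)
    have "real (c n) \<le> real (d ^ n * d)" using upper[of n] elim by (intro of_nat_mono) auto
    also have "\<dots> = real d * real d ^ n" by (simp add: mult.commute)
    finally have "root n (real (c n)) \<le> root n (real d * real d ^ n)"
      using elim by (intro real_root_le_mono) auto
    then show ?case using elim by linarith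
  qed
qed

context assoc_or_lie_algebra
begin

section \<open>Spans of products\<close>

lemma span_mul:
  assumes "f \<in> fn.span A" "g \<in> fn.span B" "\<And>x y. x \<in> A \<Longrightarrow> y \<in> B \<Longrightarrow> (\<lambda>a. mul (x a) (y a)) \<in> fn.span C"
  shows "(\<lambda>a. mul (f a) (g a)) \<in> fn.span C"
proof -
  have 1: "(\<lambda>a. mul (x a) (g a)) \<in> fn.span C" if x: "x \<in> A" for x
    using assms(2)
  proof (induction rule: fn.span_induct_alt)
    case base
    then show ?case using fn.span_zero[of C] by (simp add: mul_right.zero zero_fun_def)
  next
    case (step c y z)
    have "(\<lambda>a. mul (x a) ((fscale c y + z) a)) = fscale c (\<lambda>a. mul (x a) (y a)) + (\<lambda>a. mul (x a) (z a))"
      by (simp add: fun_eq_iff fscale_def mul_right.add mul_right.scale)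
    then show ?case using step assms(3)[OF x] by (simp only: fn.span_add fn.span_scale)
  qed
  show ?thesis
    using assms(1)
  proof (induction rule: fn.span_induct_alt)
    case base
    then show ?case using fn.span_zero[of C] by (simp add: mul_left.zero zero_fun_def)
  next
    case (step c y z)
    have "(\<lambda>a. mul ((fscale c y + z) a) (g a)) = fscale c (\<lambda>a. mul (y a) (g a)) + (\<lambda>a. mul (z a) (g a))"
      by (simp add: fun_eq_iff fscale_def mul_left.add mul_left.scale)
    then show ?case using step 1 by (simp only: fn.span_add fn.span_scale)
  qed
qed

text \<open>Here \<open>pf\<close> is the product of a list or its long commutator.\<close>
definition orderings :: "('a list \<Rightarrow> 'a) \<Rightarrow> nat set \<Rightarrow> ((nat \<Rightarrow> 'a) \<Rightarrow> 'a) set" where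
  "orderings pf S = {\<lambda>a. pf (map a xs) | xs. distinct xs \<and> set xs = S}"

lemma orderings_mem: "distinct xs \<Longrightarrow> (\<lambda>a. pf (map a xs)) \<in> orderings pf (set xs)"
  unfolding orderings_def by blast

lemma pmultilin_in_span_orderings:
  assumes one: "\<And>v. pf [v] = v"
    and mul: "\<And>xs ys. xs \<noteq> [] \<Longrightarrow> ys \<noteq> [] \<Longrightarrow> distinct (xs @ ys) \<Longrightarrow>
      (\<lambda>a. mul (pf (map a xs)) (pf (map a ys))) \<in> fn.span (orderings pf (set xs \<union> set ys))"
  shows "pmultilin S f \<Longrightarrow> f \<in> fn.span (orderings pf S)"
proof (induction rule: multilin.induct)
  case (var \<phi> i)
  have "(\<lambda>a. pf (map a [i])) \<in> orderings pf (set [i])" by (rule orderings_mem) simp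
  then show ?case using var one by (intro fn.span_base) simp
next
  case (prod S f T g)
  have ne: "S \<noteq> {}" "T \<noteq> {}" using multilin_finite[OF prod.hyps(1)] multilin_finite[OF prod.hyps(2)] by blast+
  show ?case
  proof (rule span_mul[OF prod.IH])
    fix x y assume "x \<in> orderings pf S" "y \<in> orderings pf T"
    then obtain xs ys where xs: "x = (\<lambda>a. pf (map a xs))" "distinct xs" "set xs = S"
      and ys: "y = (\<lambda>a. pf (map a ys))" "distinct ys" "set ys = T"
      unfolding orderings_def by blast
    have "(\<lambda>a. mul (pf (map a xs)) (pf (map a ys))) \<in> fn.span (orderings pf (set xs \<union> set ys))"
      by (rule mul) (use xs ys ne prod.hyps(3) in auto)
    then show "(\<lambda>a. mul (x a) (y a)) \<in> fn.span (orderings pf (S \<union> T))" by (simp only: xs ys)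
  qed
next
  case (add S f g)
  have "f + g \<in> fn.span (orderings pf S)" by (rule fn.span_add[OF add.IH])
  then show ?case by (simp only: plus_fun_def)
next
  case (scale S f c)
  have "fscale c f \<in> fn.span (orderings pf S)" by (rule fn.span_scale[OF scale.IH])
  moreover have "fscale c f = (\<lambda>a. scale c (f a))" by (simp add: fscale_def)
  ultimately show ?case by (simp only:)
qed

lemma span_multilin:
  assumes G: "\<And>g. g \<in> G \<Longrightarrow> multilin Ops S g" and ne: "G \<noteq> {}" and f: "f \<in> fn.span G"
  shows "multilin Ops S f"
  using f
proof (induction rule: fn.span_induct_alt)
  case base
  obtain g where "g \<in> G" using ne by blast
  from multilin.scale[OF G[OF this], of 0] show ?case by (simp add: zero_fun_def)
next
  case (step c x y)
  from multilin.add[OF multilin.scale[OF G[OF step(1)], of c] step(2)]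
  show ?case by (simp add: plus_fun_def fscale_def)
qed

lemma list_product_append:
  assumes assoc: "\<And>x y z. mul (mul x y) z = mul x (mul y z)"
  shows "xs \<noteq> [] \<Longrightarrow> ys \<noteq> [] \<Longrightarrow> list_product mul (xs @ ys) = mul (list_product mul xs) (list_product mul ys)"
proof (induction xs)
  case (Cons x xs)
  show ?case
  proof (cases xs)
    case Nil
    then show ?thesis using Cons.prems by (cases ys) auto
  next
    case (Cons x' xs')
    then show ?thesis using Cons.IH Cons.prems by (simp add: assoc)
  qed
qed simp

lemma long_commutator_snoc: "xs \<noteq> [] \<Longrightarrow> long_commutator br (xs @ [y]) = br (long_commutator br xs) y"
  by (cases xs) simp_all

lemma pmultilin_in_span_list_products:
  assumes "\<And>x y z. mul (mul x y) z = mul x (mul y z)" "pmultilin S f"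
  shows "f \<in> fn.span (orderings (list_product mul) S)"
proof (rule pmultilin_in_span_orderings[OF _ _ assms(2)])
  fix xs ys :: "nat list" assume xy: "xs \<noteq> []" "ys \<noteq> []" "distinct (xs @ ys)"
  have "(\<lambda>a. list_product mul (map a (xs @ ys))) \<in> orderings (list_product mul) (set (xs @ ys))"
    by (rule orderings_mem[OF xy(3)])
  moreover have "list_product mul (map a (xs @ ys)) = mul (list_product mul (map a xs)) (list_product mul (map a ys))" for a
    unfolding map_append by (rule list_product_append[OF assms(1)]) (use xy in auto)
  ultimately show "(\<lambda>a. mul (list_product mul (map a xs)) (list_product mul (map a ys)))
      \<in> fn.span (orderings (list_product mul) (set xs \<union> set ys))"
    by (intro fn.span_base) simp
qed simp

text \<open>
  By the Jacobi identity \<open>[u, [v, y]] = [[u, v], y] - [[u, y], v]\<close>, the right factor of a product of two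
  long commutators can be shortened.
\<close>
lemma pmultilin_in_span_long_commutators:
  assumes lie: "\<And>x y. mul x y = - mul y x" "\<And>x y z. mul (mul x y) z = mul x (mul y z) - mul y (mul x z)"
    and f: "pmultilin S f"
  shows "f \<in> fn.span (orderings (long_commutator mul) S)"
proof (rule pmultilin_in_span_orderings[OF _ _ f])
  let ?L = "long_commutator mul"
  have snoc: "(\<lambda>a. mul (f a) (a y)) \<in> fn.span (orderings ?L (insert y S))"
    if f: "f \<in> fn.span (orderings ?L S)" and S: "y \<notin> S" "S \<noteq> {}" for f y S
  proof (rule span_mul[OF f])
    show "(\<lambda>a. a y) \<in> fn.span {\<lambda>a. a y}" by (rule fn.span_base) simp
    fix x z :: "(nat \<Rightarrow> 'a) \<Rightarrow> 'a" assume "x \<in> orderings ?L S" and z: "z \<in> {\<lambda>a. a y}"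
    then obtain xs where xs: "x = (\<lambda>a. ?L (map a xs))" "distinct xs" "set xs = S"
      unfolding orderings_def by blast
    have "xs \<noteq> []" using xs S by auto
    then have "?L (map a (xs @ [y])) = mul (?L (map a xs)) (a y)" for a
      by (simp add: long_commutator_snoc)
    moreover have "(\<lambda>a. ?L (map a (xs @ [y]))) \<in> orderings ?L (set (xs @ [y]))"
      by (rule orderings_mem) (use xs S in auto)
    ultimately show "(\<lambda>a. mul (x a) (z a)) \<in> fn.span (orderings ?L (insert y S))"
      using z xs by (intro fn.span_base) simp
  qed
  have id: "mul u (mul v w) = mul (mul u v) w - mul (mul u w) v" for u v w
  proof -
    have "mul v (mul u w) = - mul (mul u w) v" by (rule lie(1))
    then show ?thesis using lie(2)[of u v w] by simp
  qed
  show "(\<lambda>a. mul (?L (map a xs)) (?L (map a ys))) \<in> fn.span (orderings ?L (set xs \<union> set ys))"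
    if "xs \<noteq> []" "ys \<noteq> []" "distinct (xs @ ys)" for xs ys
    using that
  proof (induction ys arbitrary: xs rule: rev_induct)
    case (snoc y ys)
    have base: "(\<lambda>a. mul (?L (map a xs)) (a y)) \<in> fn.span (orderings ?L (insert y (set xs)))"
      by (rule \<open>\<And>f y S. f \<in> fn.span (orderings ?L S) \<Longrightarrow> y \<notin> S \<Longrightarrow> S \<noteq> {} \<Longrightarrow>
          (\<lambda>a. mul (f a) (a y)) \<in> fn.span (orderings ?L (insert y S))\<close>)
         (use snoc.prems in \<open>auto intro!: fn.span_base orderings_mem\<close>)
    show ?case
    proof (cases "ys = []")
      case True
      then show ?thesis using base by simp
    next
      case False
      have e: "mul (?L (map a xs)) (?L (map a (ys @ [y]))) =
          mul (mul (?L (map a xs)) (?L (map a ys))) (a y) - mul (?L (map a (xs @ [y]))) (?L (map a ys))" for a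
        using False snoc.prems by (simp add: long_commutator_snoc id)
      have "(\<lambda>a. mul (?L (map a xs)) (?L (map a ys))) \<in> fn.span (orderings ?L (set xs \<union> set ys))"
        using False snoc.prems by (intro snoc.IH) auto
      then have 1: "(\<lambda>a. mul (mul (?L (map a xs)) (?L (map a ys))) (a y))
          \<in> fn.span (orderings ?L (insert y (set xs \<union> set ys)))"
        by (rule \<open>\<And>f y S. f \<in> fn.span (orderings ?L S) \<Longrightarrow> y \<notin> S \<Longrightarrow> S \<noteq> {} \<Longrightarrow>
          (\<lambda>a. mul (f a) (a y)) \<in> fn.span (orderings ?L (insert y S))\<close>)
           (use snoc.prems in auto)
      have 2: "(\<lambda>a. mul (?L (map a (xs @ [y]))) (?L (map a ys)))
          \<in> fn.span (orderings ?L (set (xs @ [y]) \<union> set ys))"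
        using False snoc.prems by (intro snoc.IH) auto
      have s: "set (xs @ [y]) \<union> set ys = set xs \<union> set (ys @ [y])"
        "insert y (set xs \<union> set ys) = set xs \<union> set (ys @ [y])" by auto
      from fn.span_diff[OF 1[unfolded s] 2[unfolded s]]
      show ?thesis unfolding e by (simp only: fun_diff_def)
    qed
  qed simp
qed simp

end

section \<open>Codimension growth and simplicity under the action\<close>

locale differential_algebra = enumerated_algebra scale Basis mul bs
    + derivation_action scale mul gscale gbracket act
  for scale :: "'f::{alg_closed_field, field_char_0} \<Rightarrow> 'a::ab_group_add \<Rightarrow> 'a" and Basis mul bs
    and gscale :: "'f \<Rightarrow> 'g::ab_group_add \<Rightarrow> 'g" and gbracket act +
  fixes \<Lambda> :: "'l set" and \<gamma> :: "'l \<Rightarrow> ('g word \<Rightarrow>\<^sub>0 'f)"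
  assumes uea_basis: "uea_basis gscale gbracket \<Lambda> \<gamma>"
begin

abbreviation uact :: "('g word \<Rightarrow>\<^sub>0 'f) \<Rightarrow> 'a \<Rightarrow> 'a" where "uact \<equiv> uea_act scale act"

lemma lin_foldr_act: "lin (foldr act gs)"
proof (induction gs)
  case Nil
  show ?case by (rule linI) simp_all
next
  case (Cons g gs)
  show ?case using lin_comp[OF act_linear Cons] by (simp add: comp_def)
qed

lemma lin_uact: "lin (uact h)"
  by (rule linI)
     (simp_all only: uea_act_def lin_add[OF lin_foldr_act] lin_scale[OF lin_foldr_act]
        lincomb_family_add lincomb_family_scale)

lemma uact_one: "uact 1 a = a"
  by (simp add: zero_word_def flip: single_one)

lemma derivation_act: "derivation (act g)"
  by (simp add: derivation_def act_linear act_derivation)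

lemma stable_ideal_uact:
  assumes I: "stable_ideal (range act) I" shows "stable_ideal (range uact) I"
proof (rule stable_idealI[OF stable_idealD(1)[OF I] stable_idealD(2)[OF I] stable_idealD(3)[OF I]])
  fix D x assume "D \<in> range uact" "x \<in> I"
  then obtain h where h: "D = uact h" by blast
  have "foldr act gs x \<in> I" for gs
    by (induction gs) (use \<open>x \<in> I\<close> stable_idealD(4)[OF I] in auto)
  then show "D x \<in> I" unfolding h uea_act_def lincomb_def
    by (intro subspace_sum subspace_scale stable_idealD(1)[OF I])
qed

text \<open>
  The action of a representative only depends on its class in \<open>U(\<gg>)\<close>, so it can be computed from the
  coordinates of the class in the basis \<open>\<gamma>\<close>.
\<close>
lemma uact_coords:
  "uact h a = lincomb scale (\<lambda>\<beta>. uact (\<gamma> \<beta>) a)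
     (quotient_coords pm_scale (uea_ideal gscale gbracket) \<Lambda> \<gamma> h)"
proof -
  let ?c = "quotient_coords pm_scale (uea_ideal gscale gbracket) \<Lambda> \<gamma> h"
  have "\<exists>!c. Poly_Mapping.keys c \<subseteq> \<Lambda> \<and> h - lincomb pm_scale \<gamma> c \<in> uea_ideal gscale gbracket"
    using uea_basis unfolding uea_basis_def quotient_basis_def by blast
  from theI'[OF this] have "h - lincomb pm_scale \<gamma> ?c \<in> uea_ideal gscale gbracket"
    unfolding quotient_coords_def by blast
  then have "uact (h - lincomb pm_scale \<gamma> ?c) a = 0" by (rule uea_act_ideal)
  moreover have "uact h a = uact (h - lincomb pm_scale \<gamma> ?c) a + uact (lincomb pm_scale \<gamma> ?c) a"
    unfolding uea_act_def lincomb_add[symmetric] by simp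
  ultimately show ?thesis by (simp add: uea_act_def lincomb_lincomb)
qed

lemma action_simple_iff: "action_simple_algebra scale mul act \<longleftrightarrow> stably_simple (range act)"
  unfolding action_simple_algebra_def stably_simple_def algebra_square_def ideal_square_def stable_ideal_def
  by simp

lemma simple_iff: "simple_algebra scale mul \<longleftrightarrow> stably_simple {}"
  unfolding simple_algebra_def stably_simple_def algebra_square_def ideal_square_def stable_ideal_def
  by simp

lemma simple_iff_action_simple: "action_simple_algebra scale mul act \<longleftrightarrow> simple_algebra scale mul"
proof
  show "action_simple_algebra scale mul act \<Longrightarrow> simple_algebra scale mul"
    unfolding action_simple_iff simple_iff
    using stably_simple_imp_simple[of "range act"] derivation_act by blast
  show "simple_algebra scale mul \<Longrightarrow> action_simple_algebra scale mul act"
    unfolding action_simple_iff simple_iff stably_simple_def using stable_ideal_antimono by blast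
qed

text \<open>
  The functions given by \<open>P\<^sub>n\<close> or \<open>V\<^sub>n\<close> form such a space. The lower bound for its dimension comes from
  the ordinary multilinear functions, which it contains; the upper bounds hold for every space of
  multilinear functions with operators from \<open>U(\<gg>)\<close>.
\<close>
definition codimension_space :: "((nat \<Rightarrow> 'a) \<Rightarrow> 'a) set \<Rightarrow> nat \<Rightarrow> bool" where
  "codimension_space R n \<longleftrightarrow> fn.subspace R \<and> (\<forall>f\<in>R. multilin (range uact) {1..n} f) \<and>
     (\<forall>f. pmultilin {1..n} f \<longrightarrow> f \<in> R)"

lemma lin_Ops: "\<phi> \<in> range uact \<Longrightarrow> lin \<phi>"
  using lin_uact by blast

lemma has_PIexp_iff:
  assumes d0: "d > 0" and c: "\<And>n. n \<ge> 1 \<Longrightarrow> \<exists>R. codimension_space R n \<and> c n = fn.dim R"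
  shows "has_PIexp c (real d) \<longleftrightarrow> action_simple_algebra scale mul act"
proof
  assume "action_simple_algebra scale mul act"
  then have S: "stably_simple {}" using simple_iff_action_simple simple_iff by blast
  obtain N where N: "\<And>m. m \<ge> N \<Longrightarrow> \<exists>S f a. alt_multilin S f \<and> (\<forall>i<d. a i = bs i) \<and> f a \<noteq> 0 \<and> card S = m"
    using alt_multilin_exists_card[OF S d0] by blast
  show "has_PIexp c (real d)"
  proof (rule has_PIexp_of_lattice_words[where N = N])
    show "1 \<le> d" using d0 by simp
    show "c n \<le> d ^ n * d" if n: "n \<ge> 1" for n
    proof -
      obtain R where R: "codimension_space R n" "c n = fn.dim R" using c[OF n] by blast
      have "fn.dim R \<le> d ^ n * d"
        by (rule dim_le_power(1)[OF _ _ lin_Ops]) (use R(1) in \<open>auto simp: codimension_space_def\<close>)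
      then show ?thesis using R(2) by simp
    qed
    fix m K assume m: "m \<ge> N" and n: "1 \<le> m + d * (2 * K)"
    let ?n = "m + d * (2 * K)" and ?W = "lattice_words d (2 * K)"
    obtain R where R: "codimension_space R ?n" "c ?n = fn.dim R" using c[OF n] by blast
    have sR: "fn.subspace R" and mR: "\<And>f. f \<in> R \<Longrightarrow> multilin (range uact) {1..?n} f"
      and pR: "\<And>f. pmultilin {1..?n} f \<Longrightarrow> f \<in> R"
      using R(1) by (auto simp: codimension_space_def)
    obtain S f a where f: "alt_multilin S f" "\<forall>i<d. a i = bs i" "f a \<noteq> 0" and cS: "card S = m" using N[OF m] by blast
    obtain G pt where G: "\<forall>w\<in>?W. pmultilin {1..?n} (G w) \<and> G w (pt w) \<noteq> 0 \<and>
        (\<forall>w'\<in>?W. G w (pt w') \<noteq> 0 \<longrightarrow> w = w' \<or> (w, w') \<in> lexn less_than (d * (2 * K)))"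
      using triangular_family[OF S f d0, of K] unfolding cS by blast
    obtain T where T: "finite T" "R \<subseteq> fn.span T" using dim_le_power(2)[OF sR mR lin_Ops] by blast
    have "card ?W \<le> fn.dim R"
    proof (rule dim_ge_triangular[OF sR T finite_lattice_words])
      show "wf (lexn less_than (d * (2 * K)))" by (rule wf_lexn) (rule wf_less_than)
      show "G w \<in> R" if "w \<in> ?W" for w using G that pR by blast
      show "G w (pt w) \<noteq> 0" if "w \<in> ?W" for w using G that by blast
      show "w = w' \<or> (w, w') \<in> lexn less_than (d * (2 * K))"
        if "w \<in> ?W" "w' \<in> ?W" "G w (pt w') \<noteq> 0" for w w' using G that by blast
    qed
    then show "card ?W \<le> c ?n" using R(2) by simp
  qed
next
  assume P: "has_PIexp c (real d)"
  show "action_simple_algebra scale mul act"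
  proof (rule ccontr)
    assume "\<not> action_simple_algebra scale mul act"
    then have S: "\<not> stably_simple (range act)" by (simp add: action_simple_iff)
    have "Basis \<noteq> {}" using d0 by auto
    then have "\<exists>a::'a. a \<noteq> 0" using basis_UNIV(1) dependent_zero by (metis ex_in_conv)
    from not_stably_simple_annihilating_ideals[OF _ S this] derivation_act
    obtain I J where IJ: "stable_ideal (range act) I" "stable_ideal (range act) J" "I \<noteq> {0}" "J \<noteq> {0}"
      "I = J \<or> I \<inter> J = {0}" "\<And>x y. x \<in> I \<Longrightarrow> y \<in> J \<Longrightarrow> mul x y = 0 \<and> mul y x = 0" by blast
    have "\<not> has_PIexp c (real d)"
    proof (rule not_has_PIexp_of_small[where C = "2 * d ^ 2"])
      show "d \<ge> 1" using d0 by simp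
      fix n :: nat assume n: "n \<ge> 1"
      obtain R where R: "codimension_space R n" "c n = fn.dim R" using c[OF n] by blast
      have "fn.dim R \<le> 2 * n * d ^ 2 * (d - 1) ^ (n - 1)"
        by (rule dim_le_annihilating_ideals[OF _ _ lin_Ops stable_ideal_uact[OF IJ(1)] IJ(3)
              stable_ideal_uact[OF IJ(2)] IJ(4,5) IJ(6) n])
           (use R(1) in \<open>auto simp: codimension_space_def\<close>)
      then show "c n \<le> 2 * d ^ 2 * n * (d - 1) ^ (n - 1)" using R(2) by (simp add: mult_ac)
    qed
    then show False using P by simp
  qed
qed

end

lemma image_setcompr2: "F ` {u x y | x y. P x} = {F (u x y) | x y. P x}"
  by blast

context differential_algebra
begin

section \<open>Evaluation of multilinear polynomials\<close>

text \<open>The substitution \<open>x\<^sub>i \<mapsto> a\<^sub>i\<close>, under which the generator \<open>(i, \<beta>)\<close> takes the value \<open>\<gamma>\<^sub>\<beta> a\<^sub>i\<close>.\<close>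
abbreviation assignment :: "(nat \<Rightarrow> 'a) \<Rightarrow> nat \<times> 'l \<Rightarrow> 'a" where
  "assignment a \<equiv> \<lambda>(i, \<beta>). uact (\<gamma> \<beta>) (a i)"

lemma uact_var: "multilin (range uact) {i} (\<lambda>a. uact h (a i))"
  by (rule multilin.var) simp

lemma multilin_list_product:
  "ks \<noteq> [] \<Longrightarrow> inj_on \<sigma> (set ks) \<Longrightarrow> distinct ks \<Longrightarrow>
    multilin (range uact) (\<sigma> ` set ks) (\<lambda>a. list_product mul (map (\<lambda>k. uact (h k) (a (\<sigma> k))) ks))"
proof (induction ks)
  case (Cons k ks)
  show ?case
  proof (cases ks)
    case Nil
    then show ?thesis using uact_var by simp
  next
    case (Cons k' ks')
    have IH: "multilin (range uact) (\<sigma> ` set ks) (\<lambda>a. list_product mul (map (\<lambda>k. uact (h k) (a (\<sigma> k))) ks))"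
      by (rule Cons.IH) (use Cons.prems Cons in auto)
    have "multilin (range uact) ({\<sigma> k} \<union> \<sigma> ` set ks)
        (\<lambda>a. mul (uact (h k) (a (\<sigma> k))) (list_product mul (map (\<lambda>k. uact (h k) (a (\<sigma> k))) ks)))"
      by (rule multilin.prod[OF uact_var IH]) (use Cons.prems in auto)
    then show ?thesis using Cons by (simp add: insert_commute)
  qed
qed simp

lemma multilin_long_commutator:
  "ks \<noteq> [] \<Longrightarrow> inj_on \<sigma> (set ks) \<Longrightarrow> distinct ks \<Longrightarrow>
    multilin (range uact) (\<sigma> ` set ks) (\<lambda>a. long_commutator mul (map (\<lambda>k. uact (h k) (a (\<sigma> k))) ks))"
proof (induction ks rule: rev_induct)
  case (snoc k ks)
  show ?case
  proof (cases "ks = []")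
    case True
    then show ?thesis using uact_var by simp
  next
    case False
    have IH: "multilin (range uact) (\<sigma> ` set ks) (\<lambda>a. long_commutator mul (map (\<lambda>k. uact (h k) (a (\<sigma> k))) ks))"
      by (rule snoc.IH) (use snoc.prems False in \<open>auto simp: inj_on_Un\<close>)
    have dj: "\<sigma> ` set ks \<inter> {\<sigma> k} = {}" using snoc.prems by (auto simp: inj_on_def)
    have e: "\<sigma> ` set (ks @ [k]) = \<sigma> ` set ks \<union> {\<sigma> k}" by auto
    show ?thesis unfolding e
      using multilin.prod[OF IH uact_var dj] False by (simp add: long_commutator_snoc)
  qed
qed simp

definition substituted_products :: "('a list \<Rightarrow> 'a) \<Rightarrow> nat \<Rightarrow> ((nat \<Rightarrow> 'a) \<Rightarrow> 'a) set" where
  "substituted_products pf n =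
     {\<lambda>a. pf (map (\<lambda>k. uact (h k) (a (\<sigma> k))) [1..<Suc n]) | \<sigma> h. \<sigma> permutes {1..n}}"

text \<open>Let every \<open>h k\<close> be the unit of \<open>U(\<gg>)\<close>.\<close>
lemma orderings_subset_substituted_products: "orderings pf {1..n} \<subseteq> substituted_products pf n"
proof
  fix f assume "f \<in> orderings pf {1..n}"
  then obtain xs where f: "f = (\<lambda>a. pf (map a xs))" and xs: "distinct xs" "set xs = {1..n}"
    unfolding orderings_def by blast
  have len: "length xs = n" using distinct_card[OF xs(1)] xs(2) by simp
  define \<sigma> where "\<sigma> k = (if k \<in> {1..n} then xs ! (k - 1) else k)" for k
  have "bij_betw \<sigma> {1..n} {1..n}"
  proof (rule bij_betw_imageI)
    show "inj_on \<sigma> {1..n}"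
    proof (rule inj_onI)
      fix j k assume jk: "j \<in> {1..n}" "k \<in> {1..n}" "\<sigma> j = \<sigma> k"
      then have "xs ! (j - 1) = xs ! (k - 1)" by (simp add: \<sigma>_def)
      moreover have "j - 1 < length xs" "k - 1 < length xs" using jk len by auto
      ultimately have "j - 1 = k - 1" using nth_eq_iff_index_eq[OF xs(1)] by blast
      then show "j = k" using jk by auto
    qed
    show "\<sigma> ` {1..n} = {1..n}"
    proof (rule card_subset_eq)
      show "\<sigma> ` {1..n} \<subseteq> {1..n}"
      proof (rule image_subsetI)
        fix k assume k: "k \<in> {1..n}"
        then have "xs ! (k - 1) \<in> set xs" using len by (intro nth_mem) auto
        then show "\<sigma> k \<in> {1..n}" using k xs(2) by (simp add: \<sigma>_def)
      qed
      show "card (\<sigma> ` {1..n}) = card {1..n}" by (rule card_image[OF \<open>inj_on \<sigma> {1..n}\<close>])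
    qed simp
  qed
  then have perm: "\<sigma> permutes {1..n}" by (rule bij_imp_permutes) (auto simp: \<sigma>_def)
  have "map (\<lambda>k. uact 1 (a (\<sigma> k))) [1..<Suc n] = map a xs" for a
    by (rule nth_equalityI) (use len in \<open>auto simp: uact_one \<sigma>_def nth_append simp del: upt_Suc\<close>)
  then have one: "f = (\<lambda>a. pf (map (\<lambda>k. uact ((\<lambda>_. 1) k) (a (\<sigma> k))) [1..<Suc n]))"
    unfolding f by simp
  show "f \<in> substituted_products pf n"
    unfolding substituted_products_def
    by (rule CollectI, rule exI[of _ \<sigma>], rule exI[of _ "\<lambda>_. 1"], rule conjI[OF one perm])
qed

lemma codimension_space_span:
  assumes "n \<ge> 1"
    and "\<And>\<sigma> h (ks :: nat list). ks \<noteq> [] \<Longrightarrow> inj_on \<sigma> (set ks) \<Longrightarrow> distinct ks \<Longrightarrow>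
      multilin (range uact) (\<sigma> ` set ks) (\<lambda>a. pf (map (\<lambda>k. uact (h k) (a (\<sigma> k))) ks))"
    and "\<And>f. pmultilin {1..n} f \<Longrightarrow> f \<in> fn.span (orderings pf {1..n})"
  shows "codimension_space (fn.span (substituted_products pf n)) n"
  unfolding codimension_space_def
proof (intro conjI ballI allI impI)
  show "fn.subspace (fn.span (substituted_products pf n))" by (rule fn.subspace_span)
  fix f
  show "f \<in> fn.span (substituted_products pf n)" if "pmultilin {1..n} f"
    using fn.span_mono[OF orderings_subset_substituted_products] assms(3)[OF that] by blast
  assume f: "f \<in> fn.span (substituted_products pf n)"
  show "multilin (range uact) {1..n} f"
  proof (rule span_multilin[OF _ _ f])
    show "substituted_products pf n \<noteq> {}"
      unfolding substituted_products_def using permutes_id[of "{1..n}"] by blast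
    fix g assume "g \<in> substituted_products pf n"
    then obtain \<sigma> h where g: "g = (\<lambda>a. pf (map (\<lambda>k. uact (h k) (a (\<sigma> k))) [1..<Suc n]))"
      and p: "\<sigma> permutes {1..n}" unfolding substituted_products_def by blast
    have ks: "set [1..<Suc n] = {1..n}" by auto
    have "multilin (range uact) (\<sigma> ` set [1..<Suc n]) g"
      unfolding g by (rule assms(2)[where ks = "[1..<Suc n]" and \<sigma> = \<sigma> and h = h])
        (use assms(1) permutes_inj_on[OF p] in \<open>simp_all del: upt_Suc\<close>)
    then show "multilin (range uact) {1..n} g"
      unfolding ks permutes_image[OF p] .
  qed
qed

subsection \<open>Associative algebras\<close>

definition assoc_function :: "((nat \<times> 'l) word \<Rightarrow>\<^sub>0 'f) \<Rightarrow> ((nat \<Rightarrow> 'a) \<Rightarrow> 'a)" where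
  "assoc_function f = (\<lambda>a. assoc_eval scale mul (assignment a) f)"

lemma linear_assoc_function: "Vector_Spaces.linear pm_scale fscale assoc_function"
  unfolding Vector_Spaces.linear_iff
  by (auto simp: vector_space_pm_scale vector_space_fscale assoc_function_def assoc_eval_def
      lincomb_add lincomb_pm_scale fscale_def fun_eq_iff)

lemma word_neq_0: "w \<noteq> 0 \<longleftrightarrow> letters w \<noteq> []"
  by (cases w) (auto simp: zero_word_def)

lemma poly_mapping_mult_sum:
  fixes f g :: "'x word \<Rightarrow>\<^sub>0 'f"
  shows "f * g = (\<Sum>v\<in>Poly_Mapping.keys f. \<Sum>w\<in>Poly_Mapping.keys g.
    Poly_Mapping.single (v + w) (Poly_Mapping.lookup f v * Poly_Mapping.lookup g w))"
proof -
  have "f * g = (\<Sum>v\<in>Poly_Mapping.keys f. Poly_Mapping.single v (Poly_Mapping.lookup f v)) *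
      (\<Sum>w\<in>Poly_Mapping.keys g. Poly_Mapping.single w (Poly_Mapping.lookup g w))"
    by (simp flip: poly_mapping_as_sum)
  then show ?thesis by (simp add: sum_product mult_single)
qed

lemma keys_nonunit: "Poly_Mapping.lookup f 0 = 0 \<Longrightarrow> v \<in> Poly_Mapping.keys f \<Longrightarrow> letters v \<noteq> []"
  using word_neq_0[of v] by (auto simp: in_keys_iff)

lemma nonunit_mult:
  fixes f g :: "'x word \<Rightarrow>\<^sub>0 'f"
  assumes "Poly_Mapping.lookup f 0 = 0"
  shows "Poly_Mapping.lookup (f * g) 0 = 0"
proof -
  have "v + w \<noteq> 0" if "v \<in> Poly_Mapping.keys f" for v w
    using keys_nonunit[OF assms that] by (simp add: word_neq_0 plus_word_def)
  then show ?thesis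
    unfolding poly_mapping_mult_sum[of f g] lookup_sum lookup_single
    by (intro sum.neutral ballI) (simp add: when_def)
qed

lemma assoc_eval_letter: "assoc_eval scale mul s (letter x) = s x"
  by (simp add: assoc_eval_def letter_def)

text \<open>
  Multiplicativity is restricted to polynomials without constant term because the algebra need not
  have a unit that could be the value of the empty word.
\<close>
lemma assoc_eval_mult:
  assumes assoc: "\<And>x y z. mul (mul x y) z = mul x (mul y z)"
    and f: "Poly_Mapping.lookup f 0 = 0" and g: "Poly_Mapping.lookup g 0 = 0"
  shows "assoc_eval scale mul s (f * g) = mul (assoc_eval scale mul s f) (assoc_eval scale mul s g)"
proof -
  let ?p = "\<lambda>w. list_product mul (map s (letters w))"
  have app: "?p (v + w) = mul (?p v) (?p w)" if "v \<in> Poly_Mapping.keys f" "w \<in> Poly_Mapping.keys g" for v w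
    using keys_nonunit[OF f that(1)] keys_nonunit[OF g that(2)]
    by (simp add: plus_word_def list_product_append[OF assoc])
  have "assoc_eval scale mul s (f * g) = (\<Sum>v\<in>Poly_Mapping.keys f. \<Sum>w\<in>Poly_Mapping.keys g.
      scale (Poly_Mapping.lookup f v * Poly_Mapping.lookup g w) (?p (v + w)))"
    unfolding assoc_eval_def poly_mapping_mult_sum[of f g] lincomb_sum lincomb_single ..
  also have "\<dots> = (\<Sum>v\<in>Poly_Mapping.keys f. \<Sum>w\<in>Poly_Mapping.keys g.
      scale (Poly_Mapping.lookup f v) (scale (Poly_Mapping.lookup g w) (mul (?p v) (?p w))))"
    by (intro sum.cong refl) (simp add: app)
  also have "\<dots> = mul (assoc_eval scale mul s f) (assoc_eval scale mul s g)"
    unfolding assoc_eval_def lincomb_def mul_left.sum mul_right.sum mul_left.scale mul_right.scale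
    by (simp add: scale_sum_right, subst sum.swap, simp add: mult.commute)
  finally show ?thesis .
qed

lemma assoc_eval_prod_list:
  assumes assoc: "\<And>x y z. mul (mul x y) z = mul x (mul y z)"
    and F: "\<And>k. Poly_Mapping.lookup (F k) 0 = 0"
  shows "ks \<noteq> [] \<Longrightarrow> Poly_Mapping.lookup (prod_list (map F ks)) 0 = 0 \<and>
    assoc_eval scale mul s (prod_list (map F ks)) = list_product mul (map (\<lambda>k. assoc_eval scale mul s (F k)) ks)"
proof (induction ks)
  case (Cons k ks)
  show ?case
  proof (cases ks)
    case Nil
    then show ?thesis using F by simp
  next
    case (Cons k' ks')
    then have ne: "ks \<noteq> []" by simp
    have e: "prod_list (map F (k # ks)) = F k * prod_list (map F ks)" by simp
    have l: "list_product mul (map (\<lambda>k. assoc_eval scale mul s (F k)) (k # ks)) =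
        mul (assoc_eval scale mul s (F k)) (list_product mul (map (\<lambda>k. assoc_eval scale mul s (F k)) ks))"
      using Cons by simp
    show ?thesis
      unfolding e l using nonunit_mult[OF F[of k]] Cons.IH[OF ne] assoc_eval_mult[OF assoc F[of k]] by simp
  qed
qed simp

lemma lookup_assoc_var: "Poly_Mapping.lookup (assoc_var gscale gbracket \<Lambda> \<gamma> i h) 0 = 0"
  unfolding assoc_var_def lincomb_def lookup_sum
  by (intro sum.neutral ballI) (simp add: letter_def lookup_single when_def zero_word_def)

lemma assoc_eval_var:
  "assoc_eval scale mul (assignment a) (assoc_var gscale gbracket \<Lambda> \<gamma> i h) = uact h (a i)"
proof -
  have "assoc_eval scale mul (assignment a) (assoc_var gscale gbracket \<Lambda> \<gamma> i h) =
     lincomb scale (\<lambda>\<beta>. assoc_eval scale mul (assignment a) (letter (i, \<beta>)))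
       (quotient_coords pm_scale (uea_ideal gscale gbracket) \<Lambda> \<gamma> h)"
    unfolding assoc_eval_def assoc_var_def lincomb_lincomb ..
  also have "\<dots> = uact h (a i)" unfolding assoc_eval_letter uact_coords[of h "a i"] by simp
  finally show ?thesis .
qed

lemma assoc_codim_space:
  assumes assoc: "\<And>x y z. mul (mul x y) z = mul x (mul y z)" and n: "n \<ge> 1"
  shows "\<exists>R. codimension_space R n \<and> assoc_codim scale mul gscale gbracket act \<Lambda> \<gamma> n = fn.dim R"
proof -
  let ?P = "assoc_multilinear gscale gbracket \<Lambda> \<gamma> n" and ?R = "fn.span (substituted_products (list_product mul) n)"
  let ?x = "assoc_var gscale gbracket \<Lambda> \<gamma>"
  let ?G = "{prod_list (map (\<lambda>k. ?x (\<sigma> k) (h k)) [1..<Suc n]) | \<sigma> h. \<sigma> permutes {1..n}}"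
  have ks: "[1..<Suc n] \<noteq> []" using n by simp
  note ev = assoc_eval_prod_list[OF assoc lookup_assoc_var ks]
  interpret pf: vector_space_pair "pm_scale :: 'f \<Rightarrow> ((nat \<times> 'l) word \<Rightarrow>\<^sub>0 'f) \<Rightarrow> _" fscale ..
  have gen: "assoc_function (prod_list (map (\<lambda>k. ?x (\<sigma> k) (h k)) [1..<Suc n])) =
      (\<lambda>a. list_product mul (map (\<lambda>k. uact (h k) (a (\<sigma> k))) [1..<Suc n]))" for \<sigma> h
    unfolding assoc_function_def ev[THEN conjunct2] assoc_eval_var ..
  have "assoc_function ` ?G = substituted_products (list_product mul) n"
    unfolding image_setcompr2 gen substituted_products_def ..
  then have im: "assoc_function ` ?P = ?R"
    using pf.linear_span_image[OF linear_assoc_function, of ?G] unfolding assoc_multilinear_def by simp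
  have R: "codimension_space ?R n"
    by (rule codimension_space_span[OF n multilin_list_product pmultilin_in_span_list_products[OF assoc]])
  have "?P \<inter> assoc_identities scale mul act \<gamma> = ?P \<inter> {f. assoc_function f = 0}"
  proof -
    have "Poly_Mapping.lookup f 0 = 0" if "f \<in> ?P" for f
      using that unfolding assoc_multilinear_def
    proof (induction rule: pm.span_induct_alt)
      case (step c x y)
      then obtain \<sigma> h where "x = prod_list (map (\<lambda>k. ?x (\<sigma> k) (h k)) [1..<Suc n])" by blast
      then have "Poly_Mapping.lookup x 0 = 0" using ev[THEN conjunct1] by simp
      then show ?case using step by (simp add: lookup_add)
    qed simp
    then show ?thesis by (auto simp: assoc_identities_def assoc_function_def fun_eq_iff)
  qed
  then have "assoc_codim scale mul gscale gbracket act \<Lambda> \<gamma> n =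
      quotient_dim pm_scale ?P (?P \<inter> {f. assoc_function f = 0})"
    by (simp add: assoc_codim_def)
  also have "\<dots> = fn.dim (assoc_function ` ?P)"
  proof -
    have sR: "fn.subspace ?R" and mR: "\<And>f. f \<in> ?R \<Longrightarrow> multilin (range uact) {1..n} f"
      using R unfolding codimension_space_def by simp_all
    obtain T where T: "finite T" "?R \<subseteq> fn.span T" using dim_le_power(2)[OF sR mR lin_Ops] by blast
    have sV: "pm.subspace ?P" unfolding assoc_multilinear_def by (rule pm.subspace_span)
    show ?thesis
      by (rule quotient_dim_eq_dim_image[OF linear_assoc_function sV T(1)]) (simp only: im T(2))
  qed
  finally show ?thesis unfolding im using R by blast
qed

subsection \<open>Lie algebras\<close>

definition lie_function :: "(nat \<times> 'l, 'f) free_lie \<Rightarrow> ((nat \<Rightarrow> 'a) \<Rightarrow> 'a)" where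
  "lie_function f = (\<lambda>a. lie_eval scale mul (assignment a) f)"

lemma abs_rep_free_lie: "abs_free_lie (rep_free_lie f) = f"
  by (rule Quotient3_abs_rep[OF Quotient3_free_lie])

context
  assumes lie: "lie_algebra scale mul"
begin

text \<open>
  The value is defined by a chosen representative. For each operation of the free Lie algebra, the
  operation applied to chosen representatives gives another representative of the result, and
  the value does not depend on the choice.
\<close>
lemma lie_eval_add: "lie_eval scale mul s (f + g) = lie_eval scale mul s f + lie_eval scale mul s g"
proof -
  have "f + g = abs_free_lie (rep_free_lie f + rep_free_lie g)"
    by (simp flip: plus_free_lie.abs_eq add: abs_rep_free_lie)
  then show ?thesis
    by (simp only: lie_algebra.lie_eval_abs[OF lie] lincomb_add) (simp add: lie_eval_def)
qed

lemma lie_eval_scale: "lie_eval scale mul s (free_lie_scale c f) = scale c (lie_eval scale mul s f)"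
proof -
  have "free_lie_scale c f = abs_free_lie (pm_scale c (rep_free_lie f))"
    by (simp flip: free_lie_scale.abs_eq add: abs_rep_free_lie)
  then show ?thesis
    by (simp only: lie_algebra.lie_eval_abs[OF lie] lincomb_pm_scale) (simp add: lie_eval_def)
qed

lemma lie_eval_bracket:
  "lie_eval scale mul s (free_lie_bracket f g) = mul (lie_eval scale mul s f) (lie_eval scale mul s g)"
proof -
  have "free_lie_bracket f g = abs_free_lie (magma_mult (rep_free_lie f) (rep_free_lie g))"
    by (simp flip: free_lie_bracket.abs_eq add: abs_rep_free_lie)
  then show ?thesis
    by (simp only: lie_algebra.lie_eval_abs[OF lie] lincomb_magma_mult) (simp add: lie_eval_def)
qed

lemma lie_eval_gen: "lie_eval scale mul s (free_lie_gen x) = s x"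
  unfolding free_lie_gen.abs_eq lie_algebra.lie_eval_abs[OF lie] by simp

lemma linear_lie_eval: "Vector_Spaces.linear free_lie_scale scale (lie_eval scale mul s)"
  unfolding Vector_Spaces.linear_iff
  by (simp add: vector_space_free_lie vector_space_axioms lie_eval_add lie_eval_scale)

lemma linear_lie_function: "Vector_Spaces.linear free_lie_scale fscale lie_function"
  unfolding Vector_Spaces.linear_iff
  by (simp add: vector_space_free_lie vector_space_fscale lie_function_def lie_eval_add lie_eval_scale
      fscale_def fun_eq_iff)

lemma lie_eval_var:
  "lie_eval scale mul (assignment a) (lie_var gscale gbracket \<Lambda> \<gamma> i h) = uact h (a i)"
proof -
  interpret L: Vector_Spaces.linear free_lie_scale scale "lie_eval scale mul (assignment a)"
    by (rule linear_lie_eval)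
  show ?thesis
    unfolding lie_var_def lincomb_def L.sum L.scale lie_eval_gen
    unfolding uact_coords[of h "a i"] lincomb_def by simp
qed

lemma lie_eval_long_commutator:
  "xs \<noteq> [] \<Longrightarrow> lie_eval scale mul s (long_commutator free_lie_bracket xs) =
    long_commutator mul (map (lie_eval scale mul s) xs)"
proof (induction xs rule: rev_induct)
  case (snoc x xs)
  then show ?case by (cases "xs = []") (simp_all add: long_commutator_snoc lie_eval_bracket)
qed simp

lemma lie_codim_space:
  assumes br: "\<And>x y. mul x y = - mul y x" "\<And>x y z. mul (mul x y) z = mul x (mul y z) - mul y (mul x z)"
    and n: "n \<ge> 1"
  shows "\<exists>R. codimension_space R n \<and> lie_codim scale mul gscale gbracket act \<Lambda> \<gamma> n = fn.dim R"
proof -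
  let ?V = "lie_multilinear gscale gbracket \<Lambda> \<gamma> n" and ?R = "fn.span (substituted_products (long_commutator mul) n)"
  let ?x = "lie_var gscale gbracket \<Lambda> \<gamma>"
  let ?G = "{long_commutator free_lie_bracket (map (\<lambda>k. ?x (\<sigma> k) (h k)) [1..<Suc n]) | \<sigma> h. \<sigma> permutes {1..n}}"
  have ks: "map F [1..<Suc n] \<noteq> []" for F :: "nat \<Rightarrow> (nat \<times> 'l, 'f) free_lie" using n by simp
  interpret fl: vector_space "free_lie_scale :: 'f \<Rightarrow> (nat \<times> 'l, 'f) free_lie \<Rightarrow> _"
    by (rule vector_space_free_lie)
  interpret pf: vector_space_pair "free_lie_scale :: 'f \<Rightarrow> (nat \<times> 'l, 'f) free_lie \<Rightarrow> _" fscale ..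
  have gen: "lie_function (long_commutator free_lie_bracket (map (\<lambda>k. ?x (\<sigma> k) (h k)) [1..<Suc n])) =
      (\<lambda>a. long_commutator mul (map (\<lambda>k. uact (h k) (a (\<sigma> k))) [1..<Suc n]))" for \<sigma> h
    unfolding lie_function_def lie_eval_long_commutator[OF ks] map_map comp_def lie_eval_var ..
  have "lie_function ` ?G = substituted_products (long_commutator mul) n"
    unfolding image_setcompr2 gen substituted_products_def ..
  then have im: "lie_function ` ?V = ?R"
    using pf.linear_span_image[OF linear_lie_function, of ?G] unfolding lie_multilinear_def by simp
  have R: "codimension_space ?R n"
    by (rule codimension_space_span[OF n multilin_long_commutator pmultilin_in_span_long_commutators[OF br]])
  have "?V \<inter> lie_identities scale mul act \<gamma> = ?V \<inter> {f. lie_function f = 0}"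
    by (auto simp: lie_identities_def lie_function_def fun_eq_iff)
  then have "lie_codim scale mul gscale gbracket act \<Lambda> \<gamma> n =
      quotient_dim free_lie_scale ?V (?V \<inter> {f. lie_function f = 0})"
    by (simp add: lie_codim_def)
  also have "\<dots> = fn.dim (lie_function ` ?V)"
  proof -
    have sR: "fn.subspace ?R" and mR: "\<And>f. f \<in> ?R \<Longrightarrow> multilin (range uact) {1..n} f"
      using R unfolding codimension_space_def by simp_all
    obtain T where T: "finite T" "?R \<subseteq> fn.span T" using dim_le_power(2)[OF sR mR lin_Ops] by blast
    have sV: "fl.subspace ?V" unfolding lie_multilinear_def by (rule fl.subspace_span)
    show ?thesis
      by (rule quotient_dim_eq_dim_image[OF linear_lie_function sV T(1)]) (simp only: im T(2))
  qed
  finally show ?thesis unfolding im using R by blast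
qed

end

end

section \<open>The differential exponent of simple algebras\<close>

theorem theorem20:
  fixes scale :: "'f::{alg_closed_field, field_char_0} \<Rightarrow> 'a::ab_group_add \<Rightarrow> 'a"
    and mul :: "'a \<Rightarrow> 'a \<Rightarrow> 'a"
    and gscale :: "'f \<Rightarrow> 'g::ab_group_add \<Rightarrow> 'g"
    and gbracket :: "'g \<Rightarrow> 'g \<Rightarrow> 'g"
    and act :: "'g \<Rightarrow> 'a \<Rightarrow> 'a"
    and \<Lambda> :: "'l set"
    and \<gamma> :: "'l \<Rightarrow> ('g word \<Rightarrow>\<^sub>0 'f)"
  assumes "\<exists>Basis. finite_dimensional_vector_space scale Basis"
    and "\<exists>a :: 'a. a \<noteq> 0"
    and "lie_algebra gscale gbracket"
    and "derivation_action scale mul gscale gbracket act"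
    and "uea_basis gscale gbracket \<Lambda> \<gamma>"
  shows
    "(associative_algebra scale mul \<longrightarrow>
        (has_PIexp (assoc_codim scale mul gscale gbracket act \<Lambda> \<gamma>) (real (vector_space.dim scale UNIV))
           \<longleftrightarrow> action_simple_algebra scale mul act) \<and>
        (action_simple_algebra scale mul act \<longleftrightarrow> simple_algebra scale mul)) \<and>
     (lie_algebra scale mul \<longrightarrow>
        (has_PIexp (lie_codim scale mul gscale gbracket act \<Lambda> \<gamma>) (real (vector_space.dim scale UNIV))
           \<longleftrightarrow> action_simple_algebra scale mul act) \<and>
        (action_simple_algebra scale mul act \<longleftrightarrow> simple_algebra scale mul))"
proof -
  obtain Basis where fd: "finite_dimensional_vector_space scale Basis" using assms(1) by blast
  interpret fd: finite_dimensional_vector_space scale Basis by (rule fd)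
  interpret act: derivation_action scale mul gscale gbracket act by (rule assms(4))
  obtain bs where bs: "bij_betw bs {..<card Basis} Basis"
    using ex_bij_betw_nat_finite[OF fd.finite_Basis] by (auto simp: lessThan_atLeast0)
  have d0: "card Basis > 0"
  proof -
    have "Basis \<noteq> {}"
    proof
      assume "Basis = {}"
      then have "(UNIV :: 'a set) = {0}" using fd.span_Basis by simp
      then show False using assms(2) by blast
    qed
    then show ?thesis using fd.finite_Basis by (simp add: card_gt_0_iff)
  qed
  have setting: "differential_algebra scale Basis mul bs gscale gbracket act \<Lambda> \<gamma>"
    if "(\<forall>x y z. mul (mul x y) z = mul x (mul y z)) \<or>
      (\<forall>x. mul x x = 0) \<and> (\<forall>x y z. mul x (mul y z) + mul y (mul z x) + mul z (mul x y) = 0)"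
    by unfold_locales (use that bs assms(5) in auto)
  show ?thesis
  proof (intro conjI impI)
    assume A: "associative_algebra scale mul"
    interpret A: associative_algebra scale mul by (rule A)
    interpret D: differential_algebra scale Basis mul bs gscale gbracket act \<Lambda> \<gamma>
      by (rule setting) (use A.mul_assoc in blast)
    show "has_PIexp (assoc_codim scale mul gscale gbracket act \<Lambda> \<gamma>) (real (vector_space.dim scale UNIV))
           \<longleftrightarrow> action_simple_algebra scale mul act"
      unfolding fd.dim_UNIV by (rule D.has_PIexp_iff[OF d0 D.assoc_codim_space[OF A.mul_assoc]])
    show "action_simple_algebra scale mul act \<longleftrightarrow> simple_algebra scale mul"
      by (rule D.simple_iff_action_simple)
  next
    assume A: "lie_algebra scale mul"
    interpret A: lie_algebra scale mul by (rule A)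
    interpret D: differential_algebra scale Basis mul bs gscale gbracket act \<Lambda> \<gamma>
      by (rule setting) (use A.mul_self A.jacobi in blast)
    note br = D.lie_bracket_rules[OF A.mul_self A.jacobi]
    show "has_PIexp (lie_codim scale mul gscale gbracket act \<Lambda> \<gamma>) (real (vector_space.dim scale UNIV))
           \<longleftrightarrow> action_simple_algebra scale mul act"
      unfolding fd.dim_UNIV by (rule D.has_PIexp_iff[OF d0 D.lie_codim_space[OF A br]])
    show "action_simple_algebra scale mul act \<longleftrightarrow> simple_algebra scale mul"
      by (rule D.simple_iff_action_simple)
  qed
qed

end
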